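(* Let $\phi_1(x)=\sum_{n\in\mathbb{N}^*}c_n^1e^{inx}$ and $\phi_2(x)=\sum_{n\in\mathbb{N}^*}c_n^2e^{-inx}$. Suppose that there exist $-\infty<\alpha\le\beta<1/2$ and $c,C>0$ such that $$c\,n^\alpha\le|c_n^1|,\,|c_n^2|\le C\,n^\beta,\qquad\forall n\in\mathbb{N}^*.$$ Then the system $$\partial_tu-\Delta u=v_1(t)\phi_1+v_2(t)\phi_2 \ \text{ on }(0,T)\times\mathbb{T},\qquad u|_{t=0}=u_0,$$ is exactly null controllable in $L^2(\mathbb{T})$: for every $T>0$ and every $u_0\in L^2(\mathbb{T})$ with zero mean there exist $v_1,v_2\in L^2(0,T)$ such that the solution satisfies $u(T,\cdot)=0$.
   Context: $\mathbb{T}=\mathbb{R}/2\pi\mathbb{Z}$, $\mathbb{N}^*=\{1,2,\dots\}$, $\Delta=\partial_x^2$. Functions and controls are complex valued here. The condition $\beta<1/2$ ensures $\phi_1,\phi_2\in H^{-1}(\mathbb{T})$, so for $v_1,v_2\in L^2(0,T)$ the system is well posed in $C^0([0,T];L^2)\cap L^2((0,T);H^1)$. *)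

theory Defs
  imports "HOL-Analysis.Analysis"
begin

text \<open>
  Functions on the torus are represented by functions on the real line of period \<open>2 * pi\<close>;
  integrals over the torus are integrals over the fundamental domain \<open>{0..2 * pi}\<close>.
\<close>

definition square_integrable_on :: "(real \<Rightarrow> complex) \<Rightarrow> real set \<Rightarrow> bool"
    (infix "square'_integrable'_on" 46) where
  "f square_integrable_on S \<longleftrightarrow>
     f \<in> borel_measurable (lebesgue_on S) \<and> integrable (lebesgue_on S) (\<lambda>x. (cmod (f x))\<^sup>2)"

definition torus_fun :: "(real \<Rightarrow> complex) \<Rightarrow> bool" where
  "torus_fun f \<longleftrightarrow> (\<forall>x. f (x + 2 * pi) = f x)"

definition L2_torus :: "(real \<Rightarrow> complex) set" where
  "L2_torus = {f. torus_fun f \<and> f square_integrable_on {0..2 * pi}}"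

definition torus_integral :: "(real \<Rightarrow> complex) \<Rightarrow> complex" where
  "torus_integral f = integral\<^sup>L (lebesgue_on {0..2 * pi}) f"

definition L2_norm_torus :: "(real \<Rightarrow> complex) \<Rightarrow> real" where
  "L2_norm_torus f = sqrt (integral\<^sup>L (lebesgue_on {0..2 * pi}) (\<lambda>x. (cmod (f x))\<^sup>2))"

definition fourier_mode :: "int \<Rightarrow> real \<Rightarrow> complex" where
  "fourier_mode k x = exp (\<i> * of_int k * of_real x)"

definition fourier_coeff :: "(real \<Rightarrow> complex) \<Rightarrow> int \<Rightarrow> complex" where
  "fourier_coeff f k = torus_integral (\<lambda>x. f x * fourier_mode (- k) x) / of_real (2 * pi)"

text \<open>The squared Sobolev \<open>H\<^sup>1\<close> norm, which is infinite for an \<open>L\<^sup>2\<close> function outside \<open>H\<^sup>1\<close>.\<close>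

definition H1_norm_sq :: "(real \<Rightarrow> complex) \<Rightarrow> ennreal" where
  "H1_norm_sq f =
     (\<integral>\<^sup>+ k. ennreal ((1 + (real_of_int k)\<^sup>2) * (cmod (fourier_coeff f k))\<^sup>2) \<partial>count_space UNIV)"

definition D_x :: "(real \<Rightarrow> complex) \<Rightarrow> real \<Rightarrow> complex" where
  "D_x f x = vector_derivative f (at x)"

definition test_torus :: "(real \<Rightarrow> complex) set" where
  "test_torus = {\<psi>. torus_fun \<psi> \<and> (\<forall>k x. (D_x ^^ k) \<psi> differentiable (at x))}"

text \<open>
  A distribution on the torus is given by its values on \<open>test_torus\<close>; its values on other functions
  are irrelevant.  The duality bracket is bilinear (no complex conjugation), and a function is
  identified with the distribution that it defines by integration.
\<close>

type_synonym distr = "(real \<Rightarrow> complex) \<Rightarrow> complex"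

definition distr_of :: "(real \<Rightarrow> complex) \<Rightarrow> distr" where
  "distr_of f = (\<lambda>\<psi>. torus_integral (\<lambda>x. f x * \<psi> x))"

text \<open>Convergence of a series of functions to a distribution, in the sense of distributions.\<close>

definition distr_sums :: "(nat \<Rightarrow> real \<Rightarrow> complex) \<Rightarrow> distr \<Rightarrow> bool"
    (infix "distr'_sums" 46) where
  "f distr_sums \<phi> \<longleftrightarrow> (\<forall>\<psi>\<in>test_torus. (\<lambda>n. distr_of (f n) \<psi>) sums \<phi> \<psi>)"

definition C0_L2 :: "real \<Rightarrow> (real \<Rightarrow> real \<Rightarrow> complex) \<Rightarrow> bool" where
  "C0_L2 T u \<longleftrightarrow>
     (\<forall>t\<in>{0..T}. u t \<in> L2_torus) \<and>
     (\<forall>t\<in>{0..T}. ((\<lambda>s. L2_norm_torus (\<lambda>x. u s x - u t x)) \<longlongrightarrow> 0) (at t within {0..T}))"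

text \<open>
  This is only used together with \<open>C0_L2 T u\<close>, under which each Fourier coefficient of \<open>u t\<close> is
  continuous in \<open>t\<close>, so that \<open>u\<close> is measurable with values in \<open>H\<^sup>1\<close>.
\<close>

definition L2_H1 :: "real \<Rightarrow> (real \<Rightarrow> real \<Rightarrow> complex) \<Rightarrow> bool" where
  "L2_H1 T u \<longleftrightarrow> (\<integral>\<^sup>+ t. H1_norm_sq (u t) \<partial>lebesgue_on {0<..<T}) < \<infinity>"

text \<open>
  Solutions, in the class \<open>C\<^sup>0([0,T];L\<^sup>2) \<inter> L\<^sup>2((0,T);H\<^sup>1)\<close>, of
  \<open>\<partial>\<^sub>t u - \<Delta>u = v\<^sub>1(t) \<phi>\<^sub>1 + v\<^sub>2(t) \<phi>\<^sub>2\<close> on \<open>(0,T)\<close> times the torus with initial value \<open>u\<^sub>0\<close>.  The equation is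
  understood weakly: it is tested against smooth \<open>\<psi>\<close>, with both space derivatives moved onto \<open>\<psi>\<close>,
  and integrated in time.
\<close>

definition heat_solution ::
  "real \<Rightarrow> distr \<Rightarrow> distr \<Rightarrow> (real \<Rightarrow> complex) \<Rightarrow> (real \<Rightarrow> complex) \<Rightarrow> (real \<Rightarrow> complex)
    \<Rightarrow> (real \<Rightarrow> real \<Rightarrow> complex) \<Rightarrow> bool" where
  "heat_solution T \<phi>1 \<phi>2 v1 v2 u0 u \<longleftrightarrow>
     C0_L2 T u \<and> L2_H1 T u \<and>
     (AE x in lebesgue. u 0 x = u0 x) \<and>
     (\<forall>\<psi>\<in>test_torus. \<forall>t\<in>{0..T}.
        distr_of (u t) \<psi> - distr_of (u 0) \<psi> =
          integral\<^sup>L (lebesgue_on {0<..<t})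
            (\<lambda>s. distr_of (u s) (D_x (D_x \<psi>)) + v1 s * \<phi>1 \<psi> + v2 s * \<phi>2 \<psi>))"

end

theory Submission
  imports Defs "HOL-Complex_Analysis.Cauchy_Integral_Formula" "HOL-Real_Asymp.Real_Asymp"
begin

text \<open>
  In Fourier modes the problem decouples: the mode \<open>n \<ge> 1\<close> is steered to zero at time \<open>T\<close> if and only
  if \<open>\<integral>\<^sub>0\<^sup>T exp (n\<^sup>2 s) v\<^sub>1(s) ds = - a\<^sub>n / c\<^sub>n\<^sup>1\<close>, where \<open>a\<^sub>n\<close> is the mode of the datum, and likewise for
  \<open>v\<^sub>2\<close> and the negative modes.  The lower bound on the coefficients makes the right-hand sides grow at
  most polynomially.

  To solve this moment problem, let \<open>w\<close> be the bump \<open>exp (- 1 / t\<^sup>2 - 1 / (T - t)\<^sup>2)\<close>, which is of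
  Gevrey order \<open>3/2\<close> by Cauchy's inequality, and let \<open>F(z) = \<Sum>\<^sub>j \<pi>\<^sup>2\<^sup>j z\<^sup>j / (2 j + 1)!\<close>, an entire function of
  order \<open>1/2\<close> with \<open>F(- x\<^sup>2) = sin (\<pi> x) / (\<pi> x)\<close>.  Then \<open>g = F(d/dt) w\<close> converges, and all its moments
  against \<open>exp (n\<^sup>2 t)\<close> vanish, since integration by parts turns \<open>F(d/dt)\<close> into \<open>F(- n\<^sup>2) = 0\<close>.  The
  solutions \<open>q\<^sub>n\<close> of \<open>q\<^sub>n' + n\<^sup>2 q\<^sub>n = g\<close>, \<open>q\<^sub>n(0) = 0\<close>, therefore vanish at \<open>T\<close> too and are biorthogonal to the
  exponentials up to the factors \<open>F'(- n\<^sup>2) \<integral> exp (n\<^sup>2 t) w\<close>, at least of size \<open>exp (n\<^sup>2 T / 2) / n\<^sup>2\<close>, while the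
  \<open>q\<^sub>n\<close> stay bounded.  Hence the series of the \<open>q\<^sub>n\<close> with the required moments converges uniformly and
  gives continuous controls.

  For bounded controls and \<open>\<beta> < 1 / 2\<close>, the forced parts of the modes are \<open>O(n powr (\<beta> - 2))\<close> uniformly
  in time; this gives the solution and its regularity.  Every solution has the same modes, because
  testing with an exponential yields a scalar linear equation, so the Parseval identity shows that
  it vanishes at time \<open>T\<close>.
\<close>

section \<open>A compactly supported function of Gevrey order below two\<close>

text \<open>The argument is complex so that Cauchy's inequality bounds all derivatives at once; only
  real points between \<open>0\<close> and \<open>T\<close> are used later.\<close>

definition bump :: "real \<Rightarrow> complex \<Rightarrow> complex" where
  "bump T z = exp (- (1 / z\<^sup>2) - 1 / (of_real T - z)\<^sup>2)"

lemma bump_holomorphic_on: "bump T holomorphic_on - {0, of_real T}"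
  unfolding bump_def by (intro holomorphic_intros) auto

text \<open>With \<open>x\<close> and \<open>y\<close> the real and imaginary parts of
  \<open>z\<close>, \<open>Re (1 / z^2) = (x^2 - y^2) / (x^2 + y^2)^2\<close>. The disc of radius
  \<open>t / 4\<close> is small enough for \<open>x^2\<close> to dominate \<open>y^2\<close>, so the
  decay of \<open>exp (- 1 / t^2)\<close> survives off the real axis, up to the constant 5.\<close>

lemma Re_inverse_square_ge:
  fixes z :: complex and t :: real
  assumes "t > 0" and "cmod (z - of_real t) \<le> t / 4"
  shows "Re (1 / z\<^sup>2) \<ge> 1 / (5 * t\<^sup>2)"
proof -
  define x y where "x = Re z" and "y = Im z"
  have "\<bar>x - t\<bar> \<le> t / 4" "\<bar>y\<bar> \<le> t / 4"
    using abs_Re_le_cmod[of "z - of_real t"] abs_Im_le_cmod[of "z - of_real t"] assms(2)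
    by (auto simp: x_def y_def)
  hence x: "3/4 * t \<le> x" "x \<le> 5/4 * t" and y: "\<bar>y\<bar> \<le> t / 4" by linarith+
  have x2: "9/16 * t\<^sup>2 \<le> x\<^sup>2"
    using power_mono[OF x(1), of 2] \<open>t > 0\<close> by (simp add: power2_eq_square)
  have x2': "x\<^sup>2 \<le> 25/16 * t\<^sup>2"
    using power_mono[OF x(2), of 2] x(1) \<open>t > 0\<close> by (simp add: power2_eq_square)
  have y2: "y\<^sup>2 \<le> t\<^sup>2 / 16"
    using power_mono[OF y, of 2] by (simp add: power2_eq_square)
  have t2: "t\<^sup>2 > 0" using assms by simp
  have pos: "x\<^sup>2 + y\<^sup>2 > 0" using x2 t2 zero_le_power2[of y] by linarith
  have Re: "Re (1 / z\<^sup>2) = (x\<^sup>2 - y\<^sup>2) / (x\<^sup>2 + y\<^sup>2)\<^sup>2"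
  proof -
    have "z\<^sup>2 = Complex (x\<^sup>2 - y\<^sup>2) (2 * x * y)"
      by (simp add: complex_eq_iff x_def y_def power2_eq_square)
    moreover have "(x\<^sup>2 - y\<^sup>2)\<^sup>2 + (2 * x * y)\<^sup>2 = (x\<^sup>2 + y\<^sup>2)\<^sup>2" by algebra
    ultimately show ?thesis by (simp add: Re_divide)
  qed
  \<comment> \<open>Here \<open>13/8 = 25/16 + 1/16\<close> bounds one factor
    \<open>x^2 + y^2\<close>; what remains is \<open>53 * y^2 \<le> 27 * x^2\<close>, which holds
    with room to spare.\<close>
  have "(x\<^sup>2 + y\<^sup>2)\<^sup>2 \<le> 5 * t\<^sup>2 * (x\<^sup>2 - y\<^sup>2)"
  proof -
    have le: "x\<^sup>2 + y\<^sup>2 \<le> 13/8 * t\<^sup>2" using x2' y2 t2 by linarith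
    have "(x\<^sup>2 + y\<^sup>2)\<^sup>2 \<le> (13/8 * t\<^sup>2) * (x\<^sup>2 + y\<^sup>2)"
      unfolding power2_eq_square[of "x\<^sup>2 + y\<^sup>2"] by (rule mult_right_mono[OF le]) auto
    also have "\<dots> = t\<^sup>2 * (13/8 * (x\<^sup>2 + y\<^sup>2))" by simp
    also have "\<dots> \<le> t\<^sup>2 * (5 * (x\<^sup>2 - y\<^sup>2))"
    proof (rule mult_left_mono)
      have "53 * y\<^sup>2 \<le> 27 * x\<^sup>2" using x2 y2 t2 by linarith
      thus "13/8 * (x\<^sup>2 + y\<^sup>2) \<le> 5 * (x\<^sup>2 - y\<^sup>2)" by simp
    qed simp
    finally show ?thesis by (simp only: mult_ac)
  qed
  moreover have "(x\<^sup>2 + y\<^sup>2)\<^sup>2 > 0" "5 * t\<^sup>2 > 0" using pos t2 by auto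
  ultimately show ?thesis
    unfolding Re by (simp only: pos_le_divide_eq times_divide_eq_left pos_divide_le_eq mult_1_left mult.commute)
qed

text \<open>Both reciprocal squares have nonnegative real part on the disc, so the one of the nearer
  endpoint alone gives the bound.\<close>

lemma norm_bump_le:
  assumes t: "0 < t" "t < T" and z: "cmod (z - of_real t) \<le> min t (T - t) / 4"
  shows "cmod (bump T z) \<le> exp (- (1 / (5 * (min t (T - t))\<^sup>2)))"
proof -
  have 1: "Re (1 / z\<^sup>2) \<ge> 1 / (5 * t\<^sup>2)"
    using t z by (intro Re_inverse_square_ge) auto
  have 2: "Re (1 / (of_real T - z)\<^sup>2) \<ge> 1 / (5 * (T - t)\<^sup>2)"
    using t z by (intro Re_inverse_square_ge) (auto simp: norm_minus_commute algebra_simps)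
  have "1 / (5 * (min t (T - t))\<^sup>2) \<le> Re (1 / z\<^sup>2 + 1 / (of_real T - z)\<^sup>2)"
  proof (cases "t \<le> T - t")
    case True
    have 0: "(0::real) \<le> 1 / (5 * (T - t)\<^sup>2)" by simp
    have m: "min t (T - t) = t" using True by simp
    show ?thesis using 0 1 2 unfolding plus_complex.sel m by linarith
  next
    case False
    have 0: "(0::real) \<le> 1 / (5 * t\<^sup>2)" by simp
    have m: "min t (T - t) = T - t" using False by simp
    show ?thesis using 0 1 2 unfolding plus_complex.sel m by linarith
  qed
  thus ?thesis by (simp add: bump_def)
qed

text \<open>Cauchy's inequality on the circle of radius \<open>d / 4\<close> about \<open>t\<close>:
  the disc avoids both singularities, and \<open>norm_bump_le\<close> bounds the function on
  it.\<close>

lemma norm_bump_deriv_le: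
  assumes t: "0 < t" "t < T"
  defines "d \<equiv> min t (T - t)"
  shows "cmod ((deriv ^^ j) (bump T) (of_real t)) \<le> fact j * (4 / d) ^ j * exp (- (1 / (5 * d\<^sup>2)))"
proof -
  have d: "d > 0" using t by (simp add: d_def)
  have sub: "cball (of_real t) (d / 4) \<subseteq> - {0, complex_of_real T}"
  proof -
    have "cmod (complex_of_real t - of_real T) = T - t"
      using t by (metis abs_of_pos diff_gt_0_iff_gt norm_minus_commute norm_of_real of_real_diff)
    thus ?thesis using t d by (auto simp: dist_norm d_def min_def split: if_splits)
  qed
  have "cmod ((deriv ^^ j) (bump T) (of_real t)) \<le>
      fact j * exp (- (1 / (5 * d\<^sup>2))) / (d / 4) ^ j"
  proof (rule Cauchy_inequality)
    show "bump T holomorphic_on ball (of_real t) (d / 4)"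
      using sub ball_subset_cball by (intro holomorphic_on_subset[OF bump_holomorphic_on]) blast
    show "continuous_on (cball (of_real t) (d / 4)) (bump T)"
      using sub by (intro holomorphic_on_imp_continuous_on holomorphic_on_subset[OF bump_holomorphic_on])
    show "cmod (bump T z) \<le> exp (- (1 / (5 * d\<^sup>2)))" if "cmod (of_real t - z) = d / 4" for z
      using norm_bump_le[OF t, of z] that by (simp add: d_def norm_minus_commute)
  qed (use d in auto)
  also have "\<dots> = fact j * (4 / d) ^ j * exp (- (1 / (5 * d\<^sup>2)))"
    using d by (simp add: power_divide)
  finally show ?thesis .
qed

text \<open>Squaring and putting \<open>y = 2 * x^2 / 5\<close> reduces this to
  \<open>y ^ j * exp (- y) \<le> fact j\<close>, a single term of the exponential series; the factor
  \<open>5 / 2\<close> is rounded up to 4, the square of 2. The square root of the factorial is what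
  gives the Gevrey order 3/2.\<close>

lemma power_mult_exp_le:
  fixes x :: real
  assumes "x \<ge> 0"
  shows "x ^ j * exp (- (x\<^sup>2 / 5)) \<le> sqrt (fact j) * 2 ^ j"
proof -
  define y where "y = 2 * x\<^sup>2 / 5"
  have y: "y \<ge> 0" by (simp add: y_def)
  have "(\<Sum>n\<in>{j}. y ^ n /\<^sub>R fact n) \<le> exp y"
    unfolding exp_def by (rule sum_le_suminf) (use y summable_exp_generic[of y] in auto)
  hence "y ^ j \<le> fact j * exp y" by (simp add: divide_simps mult.commute)
  hence "y ^ j * exp (- y) \<le> fact j * exp y * exp (- y)" by (intro mult_right_mono) auto
  also have "\<dots> = fact j" by (simp add: exp_minus)
  finally have *: "y ^ j * exp (- y) \<le> fact j" .
  have "(x ^ j * exp (- (x\<^sup>2 / 5)))\<^sup>2 = (x\<^sup>2) ^ j * exp (2 * (- (x\<^sup>2 / 5)))"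
    by (simp only: power_mult_distrib exp_double power_mult[symmetric] mult.commute[of j])
  also have "\<dots> = (y * (5 / 2)) ^ j * exp (2 * (- (y * (5 / 2) / 5)))" by (simp add: y_def)
  also have "\<dots> = (5 / 2) ^ j * (y ^ j * exp (- y))"
    unfolding power_mult_distrib by simp
  also have "\<dots> \<le> 4 ^ j * fact j" by (intro mult_mono power_mono *) (use y in auto)
  also have "\<dots> = (sqrt (fact j) * 2 ^ j)\<^sup>2"
  proof -
    have "(4::real) ^ j = (2 ^ j)\<^sup>2" by (simp add: power2_eq_square flip: power_mult_distrib)
    thus ?thesis by (simp add: power_mult_distrib)
  qed
  finally show ?thesis by (rule power2_le_imp_le) auto
qed

text \<open>The derivatives are given directly, as complex derivatives extended by zero. That each
  one differentiates the preceding one is shown, and later needed, only inside the interval.\<close>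

definition bump_deriv :: "real \<Rightarrow> nat \<Rightarrow> real \<Rightarrow> complex" where
  "bump_deriv T j t = (if 0 < t \<and> t < T then (deriv ^^ j) (bump T) (of_real t) else 0)"

lemma bump_deriv_outside [simp]: "bump_deriv T j 0 = 0" "bump_deriv T j T = 0"
  by (auto simp: bump_deriv_def)

text \<open>By \<open>power_mult_exp_le\<close> at \<open>1 / d\<close>, the exponential absorbs the
  singular power of \<open>1 / d\<close> at the price of \<open>sqrt (fact j) * 2 ^ j\<close>,
  whatever the distance \<open>d\<close> to the boundary is.\<close>

lemma norm_bump_deriv_le_gevrey: "cmod (bump_deriv T j t) \<le> fact j * sqrt (fact j) * 8 ^ j"
proof (cases "0 < t \<and> t < T")
  case True
  define d where "d = min t (T - t)"
  have d: "d > 0" using True by (simp add: d_def)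
  have "cmod (bump_deriv T j t) \<le> fact j * (4 / d) ^ j * exp (- (1 / (5 * d\<^sup>2)))"
    using True norm_bump_deriv_le[of t T j] by (simp add: bump_deriv_def d_def)
  also have "\<dots> = fact j * 4 ^ j * ((1 / d) ^ j * exp (- ((1 / d)\<^sup>2 / 5)))"
    by (simp add: power_divide mult_ac)
  also have "\<dots> \<le> fact j * 4 ^ j * (sqrt (fact j) * 2 ^ j)"
    using d by (intro mult_left_mono power_mult_exp_le) auto
  also have "\<dots> = fact j * sqrt (fact j) * (4 * 2) ^ j" unfolding power_mult_distrib by simp
  finally show ?thesis by simp
qed (auto simp: bump_deriv_def)

text \<open>Spending one more power of \<open>1 / d\<close> on the exponential leaves a factor
  \<open>d\<close>; this gives continuity at the two endpoints.\<close>

lemma norm_bump_deriv_le_boundary: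
  obtains K where "\<And>t. 0 < t \<Longrightarrow> t < T \<Longrightarrow> cmod (bump_deriv T j t) \<le> K * min t (T - t)"
proof
  fix t assume t: "0 < t" "t < T"
  define d where "d = min t (T - t)"
  have d: "d > 0" using t by (simp add: d_def)
  have "cmod (bump_deriv T j t) \<le> fact j * (4 / d) ^ j * exp (- (1 / (5 * d\<^sup>2)))"
    using t norm_bump_deriv_le[of t T j] by (simp add: bump_deriv_def d_def)
  also have "\<dots> = fact j * 4 ^ j * ((1 / d) ^ Suc j * exp (- ((1 / d)\<^sup>2 / 5))) * d"
    using d by (simp add: power_divide mult_ac)
  also have "\<dots> \<le> fact j * 4 ^ j * (sqrt (fact (Suc j)) * 2 ^ Suc j) * d"
    using d by (intro mult_right_mono mult_left_mono power_mult_exp_le) auto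
  finally show "cmod (bump_deriv T j t) \<le> fact j * 4 ^ j * (sqrt (fact (Suc j)) * 2 ^ Suc j) * min t (T - t)"
    by (simp only: d_def)
qed

lemma has_vector_derivative_bump_deriv:
  assumes "0 < t" "t < T"
  shows "(bump_deriv T j has_vector_derivative bump_deriv T (Suc j) t) (at t)"
proof -
  have "(deriv ^^ j) (bump T) holomorphic_on - {0, of_real T}"
    by (intro holomorphic_higher_deriv bump_holomorphic_on) auto
  hence "((deriv ^^ j) (bump T) has_field_derivative (deriv ^^ Suc j) (bump T) (of_real t)) (at (of_real t))"
    using assms by (auto intro!: holomorphic_derivI[of _ "- {0, of_real T}"])
  hence "((\<lambda>t. (deriv ^^ j) (bump T) (of_real t)) has_vector_derivative (deriv ^^ Suc j) (bump T) (of_real t)) (at t)"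
    by (rule has_vector_derivative_real_field)
  hence "(bump_deriv T j has_vector_derivative (deriv ^^ Suc j) (bump T) (of_real t)) (at t)"
    by (rule has_vector_derivative_transform_within_open[of _ _ _ "{0<..<T}"])
       (use assms in \<open>auto simp: bump_deriv_def\<close>)
  thus ?thesis using assms by (simp add: bump_deriv_def)
qed

lemma continuous_on_bump_deriv: "continuous_on S (bump_deriv T j)"
proof -
  have "isCont (bump_deriv T j) t" for t
  proof -
    obtain K where K: "\<And>t. 0 < t \<Longrightarrow> t < T \<Longrightarrow> cmod (bump_deriv T j t) \<le> K * min t (T - t)"
      using norm_bump_deriv_le_boundary by blast
    \<comment> \<open>At an endpoint \<open>t\<close>, the factor \<open>min s (T - s)\<close> is at
      most the distance from \<open>s\<close> to \<open>t\<close>; the absolute value is taken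
      because nothing is known about the sign of \<open>K\<close>.\<close>
    have le: "cmod (bump_deriv T j s) \<le> \<bar>K\<bar> * \<bar>s - t\<bar>" if "t \<in> {0, T}" for s
    proof (cases "0 < s \<and> s < T")
      case True
      hence "cmod (bump_deriv T j s) \<le> K * min s (T - s)" using K by blast
      also have "\<dots> \<le> \<bar>K\<bar> * \<bar>s - t\<bar>" using True that by (intro mult_mono) auto
      finally show ?thesis .
    qed (auto simp: bump_deriv_def)
    consider "0 < t" "t < T" | "t \<in> {0, T}" | "t < 0" | "t > T" by force
    thus ?thesis
    proof cases
      case 1
      thus ?thesis using has_vector_derivative_bump_deriv has_vector_derivative_continuous by blast
    next
      case 2
      have "bump_deriv T j \<midarrow>t\<rightarrow> 0"
      proof (rule Lim_null_comparison)
        show "\<forall>\<^sub>F s in at t. cmod (bump_deriv T j s) \<le> \<bar>K\<bar> * \<bar>s - t\<bar>" using le 2 by simp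
        show "((\<lambda>s. \<bar>K\<bar> * \<bar>s - t\<bar>) \<longlongrightarrow> 0) (at t)" by (auto intro!: tendsto_eq_intros)
      qed
      thus ?thesis using 2 by (auto simp: isCont_def)
    next
      case 3
      have "\<forall>\<^sub>F s in nhds t. bump_deriv T j s = 0"
        using eventually_nhds_in_open[of "{..<0}" t] 3
        by (auto elim!: eventually_mono simp: bump_deriv_def)
      thus ?thesis using isCont_cong[of "bump_deriv T j" "\<lambda>_. 0"] by simp
    next
      case 4
      have "\<forall>\<^sub>F s in nhds t. bump_deriv T j s = 0"
        using eventually_nhds_in_open[of "{T<..}" t] 4
        by (auto elim!: eventually_mono simp: bump_deriv_def)
      thus ?thesis using isCont_cong[of "bump_deriv T j" "\<lambda>_. 0"] by simp
    qed
  qed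
  thus ?thesis by (simp add: continuous_at_imp_continuous_on)
qed

section \<open>Exponential moments of the derivatives of the bump\<close>

text \<open>Majorants make the series converge uniformly, which carries continuity over to the sum
  and permits integration term by term.\<close>

lemma sums_integral_of_M_test:
  fixes f :: "nat \<Rightarrow> real \<Rightarrow> complex"
  assumes cont: "\<And>j. continuous_on {a..b} (f j)"
    and bound: "\<And>j t. t \<in> {a..b} \<Longrightarrow> cmod (f j t) \<le> M j" and "summable M"
  shows "continuous_on {a..b} (\<lambda>t. \<Sum>j. f j t)"
    and "(\<lambda>j. integral {a..b} (f j)) sums integral {a..b} (\<lambda>t. \<Sum>j. f j t)"
proof -
  have lim: "uniform_limit {a..b} (\<lambda>n t. \<Sum>j<n. f j t) (\<lambda>t. \<Sum>j. f j t) sequentially"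
    using bound \<open>summable M\<close> by (rule Weierstrass_m_test)
  have c: "continuous_on {a..b} (\<lambda>t. \<Sum>j<n. f j t)" for n
    by (intro continuous_intros cont)
  show "continuous_on {a..b} (\<lambda>t. \<Sum>j. f j t)"
    by (rule uniform_limit_theorem[OF _ lim]) (use c in auto)
  obtain I J where I: "\<And>n. ((\<lambda>t. \<Sum>j<n. f j t) has_integral I n) {a..b}"
    and J: "((\<lambda>t. \<Sum>j. f j t) has_integral J) {a..b}" and "I \<longlonglongrightarrow> J"
    using uniform_limit_integral[OF lim c] by auto
  have "I n = (\<Sum>j<n. integral {a..b} (f j))" for n
    using integral_unique[OF I[of n]] integrable_continuous_real[OF cont]
    by (simp add: integral_sum)
  hence "I = (\<lambda>n. \<Sum>j<n. integral {a..b} (f j))" by blast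
  with \<open>I \<longlonglongrightarrow> J\<close> J show "(\<lambda>j. integral {a..b} (f j)) sums integral {a..b} (\<lambda>t. \<Sum>j. f j t)"
    by (simp add: sums_def integral_unique)
qed

text \<open>The boundary terms vanish with \<open>F\<close>. Derivatives are asked for in the open
  interval only, which suits functions extended by zero and indefinite integrals.\<close>

lemma integral_by_parts_complex:
  fixes E F :: "real \<Rightarrow> complex"
  assumes "a \<le> b" and cont: "continuous_on {a..b} E" "continuous_on {a..b} E'"
      "continuous_on {a..b} F" "continuous_on {a..b} F'"
    and deriv: "\<And>t. t \<in> {a<..<b} \<Longrightarrow> (E has_vector_derivative E' t) (at t)"
      "\<And>t. t \<in> {a<..<b} \<Longrightarrow> (F has_vector_derivative F' t) (at t)"
    and "F a = 0" "F b = 0"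
  shows "integral {a..b} (\<lambda>t. E t * F' t) = - integral {a..b} (\<lambda>t. E' t * F t)"
proof -
  define y where "y = integral {a..b} (\<lambda>t. E t * F' t)"
  have "((\<lambda>t. E t * F' t) has_integral y) {a..b}"
    unfolding y_def by (intro integrable_integral integrable_continuous_real continuous_intros cont)
  hence "((\<lambda>t. E' t * F t) has_integral - y) {a..b}"
    by (intro integration_by_parts_interior[OF bounded_bilinear_mult \<open>a \<le> b\<close> cont(1,3) deriv])
       (simp_all add: assms)
  thus ?thesis by (simp add: integral_unique y_def)
qed

text \<open>The Laplace transform of the bump with the sign of the variable reversed;
  \<open>bump_laplace_deriv\<close> is its derivative in \<open>l\<close>.\<close>

definition bump_laplace :: "real \<Rightarrow> real \<Rightarrow> complex" where
  "bump_laplace T l = integral {0..T} (\<lambda>s. of_real (exp (l * s)) * bump_deriv T 0 s)"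

definition bump_laplace_deriv :: "real \<Rightarrow> real \<Rightarrow> complex" where
  "bump_laplace_deriv T l = integral {0..T} (\<lambda>s. of_real (s * exp (l * s)) * bump_deriv T 0 s)"

text \<open>Each integration by parts moves one derivative from the bump to the exponential and
  costs a factor \<open>- l\<close>.\<close>

lemma integral_exp_bump_deriv:
  assumes "T > 0"
  shows "integral {0..T} (\<lambda>s. of_real (exp (l * s)) * bump_deriv T j s) =
    of_real ((- l) ^ j) * bump_laplace T l"
proof (induction j)
  case (Suc j)
  have "integral {0..T} (\<lambda>s. of_real (exp (l * s)) * bump_deriv T (Suc j) s) =
      - integral {0..T} (\<lambda>s. of_real (l * exp (l * s)) * bump_deriv T j s)"
  proof (rule integral_by_parts_complex)
    fix t assume "t \<in> {0<..<T}"
    show "((\<lambda>s. complex_of_real (exp (l * s))) has_vector_derivative of_real (l * exp (l * t))) (at t)"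
      by (intro has_vector_derivative_of_real)
         (auto intro!: derivative_eq_intros simp flip: has_real_derivative_iff_has_vector_derivative)
  qed (use assms has_vector_derivative_bump_deriv in
        \<open>auto intro!: continuous_intros continuous_on_bump_deriv\<close>)
  also have "\<dots> = - of_real l * integral {0..T} (\<lambda>s. of_real (exp (l * s)) * bump_deriv T j s)"
    by (simp add: mult.assoc)
  finally show ?case by (simp add: Suc)
qed (simp add: bump_laplace_def)

text \<open>This is the derivative in \<open>l\<close> of the preceding identity, obtained by its
  own induction. For \<open>j = 0\<close> the truncated exponent \<open>j - 1\<close> is harmless,
  since its factor is zero.\<close>

lemma integral_ident_exp_bump_deriv:
  assumes "T > 0"
  shows "integral {0..T} (\<lambda>s. of_real (s * exp (l * s)) * bump_deriv T j s) =
    of_real ((- l) ^ j) * bump_laplace_deriv T l - of_real (real j * (- l) ^ (j - 1)) * bump_laplace T l"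
proof (induction j)
  case (Suc j)
  have cont: "continuous_on {0..T} (\<lambda>s. of_real (exp (l * s)) * bump_deriv T j s)"
    "continuous_on {0..T} (\<lambda>s. of_real (s * exp (l * s)) * bump_deriv T j s)"
    by (intro continuous_intros continuous_on_bump_deriv)+
  have "integral {0..T} (\<lambda>s. of_real (s * exp (l * s)) * bump_deriv T (Suc j) s) =
      - integral {0..T} (\<lambda>s. of_real (exp (l * s) + l * (s * exp (l * s))) * bump_deriv T j s)"
  proof (rule integral_by_parts_complex)
    fix t assume "t \<in> {0<..<T}"
    show "((\<lambda>s. complex_of_real (s * exp (l * s))) has_vector_derivative
        of_real (exp (l * t) + l * (t * exp (l * t)))) (at t)"
      by (intro has_vector_derivative_of_real)
         (auto intro!: derivative_eq_intros simp flip: has_real_derivative_iff_has_vector_derivative)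
  qed (use assms has_vector_derivative_bump_deriv in
        \<open>auto intro!: continuous_intros continuous_on_bump_deriv\<close>)
  also have "integral {0..T} (\<lambda>s. of_real (exp (l * s) + l * (s * exp (l * s))) * bump_deriv T j s) =
      integral {0..T} (\<lambda>s. of_real (exp (l * s)) * bump_deriv T j s +
        of_real l * (of_real (s * exp (l * s)) * bump_deriv T j s))"
    by (simp add: algebra_simps)
  also have "\<dots> = integral {0..T} (\<lambda>s. of_real (exp (l * s)) * bump_deriv T j s) +
        of_real l * integral {0..T} (\<lambda>s. of_real (s * exp (l * s)) * bump_deriv T j s)"
    by (subst integral_add) (auto intro!: integrable_continuous_real cont continuous_intros continuous_on_bump_deriv)
  also have "\<dots> = of_real ((- l) ^ j) * bump_laplace T l + of_real l *
      (of_real ((- l) ^ j) * bump_laplace_deriv T l - of_real (real j * (- l) ^ (j - 1)) * bump_laplace T l)"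
    unfolding Suc integral_exp_bump_deriv[OF assms] ..
  finally have eq: "integral {0..T} (\<lambda>s. of_real (s * exp (l * s)) * bump_deriv T (Suc j) s) =
      - (of_real ((- l) ^ j) * bump_laplace T l + of_real l *
      (of_real ((- l) ^ j) * bump_laplace_deriv T l - of_real (real j * (- l) ^ (j - 1)) * bump_laplace T l))" .
  show ?case unfolding eq by (cases j) (simp_all add: algebra_simps)
qed (simp add: bump_laplace_deriv_def)

text \<open>The Taylor coefficients of the entire function \<open>F\<close> with
  \<open>F(x^2) = sinh (pi * x) / (pi * x)\<close>.\<close>

definition sinh_coeff :: "nat \<Rightarrow> real" where
  "sinh_coeff j = pi ^ (2 * j) / fact (2 * j + 1)"

text \<open>This is \<open>F(- n^2) = 0\<close>: the sine series at \<open>n * pi\<close>, divided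
  by \<open>n * pi\<close>.\<close>

lemma sinh_coeff_sums_zero:
  assumes "n \<ge> 1"
  shows "(\<lambda>j. sinh_coeff j * (- (real n)\<^sup>2) ^ j) sums 0"
proof -
  have "(\<lambda>j. (- 1) ^ j / fact (2 * j + 1) * (real n * pi) ^ (2 * j + 1)) sums 0"
    using sin_paired[of "real n * pi"] by simp
  hence "(\<lambda>j. (- 1) ^ j / fact (2 * j + 1) * (real n * pi) ^ (2 * j + 1) / (real n * pi)) sums (0 / (real n * pi))"
    by (rule sums_divide)
  moreover have "(- 1) ^ j / fact (2 * j + 1) * (real n * pi) ^ (2 * j + 1) / (real n * pi) =
      sinh_coeff j * (- (real n)\<^sup>2) ^ j" for j
  proof -
    have "(- (real n)\<^sup>2) ^ j = (- 1) ^ j * real n ^ (2 * j)"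
      by (subst power_minus) (simp add: power_mult)
    moreover have "(real n * pi) ^ (2 * j + 1) / (real n * pi) = (real n * pi) ^ (2 * j)"
      using assms by simp
    ultimately show ?thesis
      by (simp only: sinh_coeff_def power_mult_distrib times_divide_eq_right[symmetric]) simp
  qed
  ultimately show ?thesis by simp
qed

text \<open>This is the value of \<open>F'\<close> at \<open>- n^2\<close>. The cosine series at
  \<open>n * pi\<close> has the terms of \<open>F(- n^2)\<close> multiplied by
  \<open>2 * j + 1\<close>; subtracting \<open>F(- n^2) = 0\<close> leaves the factor
  \<open>2 * j\<close>, and a division by \<open>- 2 * n^2\<close> lowers the power.\<close>

lemma sinh_coeff_deriv_sums:
  assumes "n \<ge> 1"
  shows "(\<lambda>j. sinh_coeff j * (real j * (- (real n)\<^sup>2) ^ (j - 1))) sums (- ((- 1) ^ n) / (2 * (real n)\<^sup>2))"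
proof -
  have pow: "(- (real n)\<^sup>2) ^ j = (- 1) ^ j * real n ^ (2 * j)" for j
    by (subst power_minus) (simp add: power_mult)
  have fac: "fact (2 * j + 1) = (2 * real j + 1) * fact (2 * j)" for j by simp
  have "(\<lambda>j. (- 1) ^ j / fact (2 * j) * (real n * pi) ^ (2 * j)) sums (- 1) ^ n"
    using cos_paired[of "real n * pi"] by simp
  moreover have "(- 1) ^ j / fact (2 * j) * (real n * pi) ^ (2 * j) =
      (2 * real j + 1) * (sinh_coeff j * (- (real n)\<^sup>2) ^ j)" for j
  proof -
    have "k * (p / (k * F) * q) = p / F * q" if "k \<noteq> 0" for k p F q :: real using that by simp
    moreover have "2 * real j + 1 \<noteq> 0" by linarith
    ultimately show ?thesis
      unfolding sinh_coeff_def fac pow by (simp only: power_mult_distrib) simp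
  qed
  ultimately have "(\<lambda>j. (2 * real j + 1) * (sinh_coeff j * (- (real n)\<^sup>2) ^ j)) sums (- 1) ^ n" by simp
  from sums_diff[OF this sinh_coeff_sums_zero[OF assms]]
  have "(\<lambda>j. 2 * real j * (sinh_coeff j * (- (real n)\<^sup>2) ^ j)) sums (- 1) ^ n" 
    by (simp add: algebra_simps)
  from sums_divide[OF this, of "- 2 * (real n)\<^sup>2"]
  have "(\<lambda>j. 2 * real j * (sinh_coeff j * (- (real n)\<^sup>2) ^ j) / (- 2 * (real n)\<^sup>2)) sums (- ((- 1) ^ n) / (2 * (real n)\<^sup>2))"
    by simp
  moreover have "2 * real j * (sinh_coeff j * (- (real n)\<^sup>2) ^ j) / (- 2 * (real n)\<^sup>2) =
      sinh_coeff j * (real j * (- (real n)\<^sup>2) ^ (j - 1))" for j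
    using assms by (cases j) (simp_all add: field_simps)
  ultimately show ?thesis by simp
qed

lemma sinh_coeff_nonneg: "sinh_coeff j \<ge> 0"
  by (simp add: sinh_coeff_def)

text \<open>The factorial of \<open>2 * j + 1\<close> outgrows the power 3/2 of the factorial of
  \<open>j\<close> times any geometric sequence: consecutive terms have a ratio of order
  \<open>j powr (- 1 / 2)\<close>. This is where a Gevrey order below two is needed.\<close>

lemma summable_sinh_coeff_gevrey:
  "summable (\<lambda>j. sinh_coeff j * (fact j * sqrt (fact j) * R ^ j))"
proof -
  define f where "f = (\<lambda>j. sinh_coeff j * (fact j * sqrt (fact j) * R ^ j))"
  \<comment> \<open>From this index on, \<open>sqrt (real j + 1)\<close> exceeds
    \<open>pi\<^sup>2 * \<bar>R\<bar>\<close>, which brings the ratio below 1/2.\<close>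
  define N where "N = nat \<lceil>(pi\<^sup>2 * \<bar>R\<bar>)\<^sup>2\<rceil>"
  have "summable f"
  proof (rule summable_ratio_test)
    fix j assume j: "j \<ge> N"
    have "norm (f (Suc j)) =
      (pi\<^sup>2 * \<bar>R\<bar> * (real j + 1) * sqrt (real j + 1) / ((2 * real j + 2) * (2 * real j + 3))) * norm (f j)"
    proof -
      have 1: "sinh_coeff (Suc j) = pi\<^sup>2 / ((2 * real j + 2) * (2 * real j + 3)) * sinh_coeff j"
      proof -
        have "fact (2 * Suc j + 1) = (2 * real j + 2) * (2 * real j + 3) * fact (2 * j + 1)"
          by (simp add: algebra_simps)
        thus ?thesis by (simp only: sinh_coeff_def) (simp add: power2_eq_square)
      qed
      have 2: "fact (Suc j) = (real j + 1) * fact j" by simp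
      have 3: "sqrt (fact (Suc j)) = sqrt (real j + 1) * sqrt (fact j)"
        unfolding 2 by (rule real_sqrt_mult)
      show ?thesis
        unfolding f_def 1 3 unfolding 2 by (simp add: abs_mult sinh_coeff_nonneg)
    qed
    also have "\<dots> \<le> 1 / 2 * norm (f j)"
    proof (rule mult_right_mono)
      have "(pi\<^sup>2 * \<bar>R\<bar>)\<^sup>2 \<le> real j" using j unfolding N_def by linarith
      hence "pi\<^sup>2 * \<bar>R\<bar> \<le> sqrt (real j + 1)" by (intro real_le_rsqrt) linarith
      hence "pi\<^sup>2 * \<bar>R\<bar> * (real j + 1) * sqrt (real j + 1) \<le> sqrt (real j + 1) * (real j + 1) * sqrt (real j + 1)"
        by (intro mult_right_mono) auto
      also have "\<dots> = (real j + 1) * (real j + 1)" by simp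
      also have "\<dots> \<le> 1 / 2 * ((2 * real j + 2) * (2 * real j + 3))" by (simp add: algebra_simps)
      finally show "pi\<^sup>2 * \<bar>R\<bar> * (real j + 1) * sqrt (real j + 1) / ((2 * real j + 2) * (2 * real j + 3)) \<le> 1 / 2"
        by (simp add: divide_simps)
    qed simp
    finally show "norm (f (Suc j)) \<le> 1 / 2 * norm (f j)" .
  qed simp
  thus ?thesis by (simp add: f_def)
qed

section \<open>A biorthogonal family and the moment problem\<close>

text \<open>This is \<open>g = F(d/dt) w\<close>, applied term by term to the bump
  \<open>w\<close>.\<close>

definition null_kernel :: "real \<Rightarrow> real \<Rightarrow> complex" where
  "null_kernel T t = (\<Sum>j. of_real (sinh_coeff j) * bump_deriv T j t)"

lemma norm_null_kernel_summand_le: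
  "cmod (of_real (sinh_coeff j) * bump_deriv T j t) \<le> sinh_coeff j * (fact j * sqrt (fact j) * 8 ^ j)"
  unfolding norm_mult norm_of_real
  using norm_bump_deriv_le_gevrey[of T j t] sinh_coeff_nonneg[of j] by (simp add: mult_left_mono)

lemma continuous_on_null_kernel: "continuous_on {a..b} (null_kernel T)"
  unfolding null_kernel_def
  by (rule sums_integral_of_M_test(1)[OF _ norm_null_kernel_summand_le summable_sinh_coeff_gevrey])
     (intro continuous_intros continuous_on_bump_deriv)

lemma norm_null_kernel_le:
  "cmod (null_kernel T t) \<le> (\<Sum>j. sinh_coeff j * (fact j * sqrt (fact j) * 8 ^ j))"
  unfolding null_kernel_def
  by (rule norm_suminf_le[OF norm_null_kernel_summand_le summable_sinh_coeff_gevrey])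

text \<open>The weight is bounded by compactness, so the Gevrey majorants, scaled by its bound,
  still allow integration term by term.\<close>

lemma integral_mult_null_kernel_sums:
  assumes "continuous_on {0..T} h"
  shows "(\<lambda>j. of_real (sinh_coeff j) * integral {0..T} (\<lambda>s. of_real (h s) * bump_deriv T j s)) sums
    integral {0..T} (\<lambda>s. of_real (h s) * null_kernel T s)"
proof -
  obtain B where B: "\<And>s. s \<in> {0..T} \<Longrightarrow> \<bar>h s\<bar> \<le> B"
    using compact_imp_bounded[OF compact_continuous_image[OF assms compact_Icc]]
    unfolding bounded_iff by (metis imageI real_norm_def)
  define f where "f = (\<lambda>j s. of_real (sinh_coeff j) * (of_real (h s) * bump_deriv T j s))"
  have "(\<lambda>j. integral {0..T} (f j)) sums integral {0..T} (\<lambda>s. \<Sum>j. f j s)"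
  proof (rule sums_integral_of_M_test(2))
    show "continuous_on {0..T} (f j)" for j
      unfolding f_def by (intro continuous_intros continuous_on_bump_deriv assms)
    show "cmod (f j s) \<le> B * (sinh_coeff j * (fact j * sqrt (fact j) * 8 ^ j))" if "s \<in> {0..T}" for j s
    proof -
      have "cmod (f j s) = \<bar>h s\<bar> * cmod (of_real (sinh_coeff j) * bump_deriv T j s)"
        by (simp add: f_def norm_mult)
      also have "\<dots> \<le> B * (sinh_coeff j * (fact j * sqrt (fact j) * 8 ^ j))"
        using B[OF that] by (intro mult_mono norm_null_kernel_summand_le) auto
      finally show ?thesis .
    qed
    show "summable (\<lambda>j. B * (sinh_coeff j * (fact j * sqrt (fact j) * 8 ^ j)))"
      by (intro summable_mult summable_sinh_coeff_gevrey)
  qed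
  moreover have "(\<Sum>j. f j s) = of_real (h s) * null_kernel T s" for s
  proof -
    have "summable (\<lambda>j. of_real (sinh_coeff j) * bump_deriv T j s)"
      by (rule summable_comparison_test'[OF summable_sinh_coeff_gevrey norm_null_kernel_summand_le])
    from suminf_mult[OF this, of "of_real (h s)"] show ?thesis
      by (simp add: f_def null_kernel_def mult_ac)
  qed
  ultimately show ?thesis by (simp add: f_def)
qed

text \<open>Term by term, the moment is \<open>F(- n^2)\<close> times \<open>bump_laplace\<close>,
  and the first factor is zero.\<close>

lemma integral_exp_null_kernel:
  assumes "T > 0" "n \<ge> 1"
  shows "integral {0..T} (\<lambda>s. of_real (exp ((real n)\<^sup>2 * s)) * null_kernel T s) = 0"
proof -
  have "continuous_on {0..T} (\<lambda>s. exp ((real n)\<^sup>2 * s))" by (intro continuous_intros)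
  from integral_mult_null_kernel_sums[OF this]
  have "(\<lambda>j. of_real (sinh_coeff j * (- (real n)\<^sup>2) ^ j) * bump_laplace T ((real n)\<^sup>2)) sums
    integral {0..T} (\<lambda>s. of_real (exp ((real n)\<^sup>2 * s)) * null_kernel T s)"
    by (simp add: integral_exp_bump_deriv[OF \<open>T > 0\<close>] mult.assoc)
  moreover have "(\<lambda>j. of_real (sinh_coeff j * (- (real n)\<^sup>2) ^ j) * bump_laplace T ((real n)\<^sup>2)) sums
      (of_real 0 * bump_laplace T ((real n)\<^sup>2))"
    by (intro sums_mult2 sums_of_real sinh_coeff_sums_zero assms)
  ultimately show ?thesis using sums_unique2 by fastforce
qed

text \<open>Term by term, this moment is \<open>F(- n^2)\<close> times
  \<open>bump_laplace_deriv\<close> minus \<open>F'(- n^2)\<close> times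
  \<open>bump_laplace\<close>. Only the second product is left.\<close>

lemma integral_ident_exp_null_kernel:
  assumes "T > 0" "n \<ge> 1"
  shows "integral {0..T} (\<lambda>s. of_real (s * exp ((real n)\<^sup>2 * s)) * null_kernel T s) =
    of_real ((- 1) ^ n / (2 * (real n)\<^sup>2)) * bump_laplace T ((real n)\<^sup>2)"
proof -
  let ?l = "(real n)\<^sup>2"
  have "continuous_on {0..T} (\<lambda>s. s * exp (?l * s))" by (intro continuous_intros)
  from integral_mult_null_kernel_sums[OF this]
  have "(\<lambda>j. of_real (sinh_coeff j * (- ?l) ^ j) * bump_laplace_deriv T ?l -
      of_real (sinh_coeff j * (real j * (- ?l) ^ (j - 1))) * bump_laplace T ?l) sums
    integral {0..T} (\<lambda>s. of_real (s * exp (?l * s)) * null_kernel T s)"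
    unfolding integral_ident_exp_bump_deriv[OF \<open>T > 0\<close>] by (simp add: algebra_simps)
  moreover have "(\<lambda>j. of_real (sinh_coeff j * (- ?l) ^ j) * bump_laplace_deriv T ?l -
      of_real (sinh_coeff j * (real j * (- ?l) ^ (j - 1))) * bump_laplace T ?l) sums
      (of_real 0 * bump_laplace_deriv T ?l - of_real (- ((- 1) ^ n) / (2 * ?l)) * bump_laplace T ?l)"
    by (intro sums_diff sums_mult2 sums_of_real sinh_coeff_sums_zero sinh_coeff_deriv_sums assms)
  ultimately show ?thesis using sums_unique2 by fastforce
qed

text \<open>Duhamel's formula for the solution of \<open>q' + n^2 * q = null_kernel T\<close> with
  \<open>q(0) = 0\<close>.\<close>

definition biorth :: "real \<Rightarrow> nat \<Rightarrow> real \<Rightarrow> complex" where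
  "biorth T n t = of_real (exp (- (real n)\<^sup>2 * t)) *
     integral {0..t} (\<lambda>s. of_real (exp ((real n)\<^sup>2 * s)) * null_kernel T s)"

lemma continuous_on_biorth: "continuous_on {0..T} (biorth T n)"
  unfolding biorth_def
  by (intro continuous_intros indefinite_integral_continuous_1 integrable_continuous_real
        continuous_on_null_kernel)

text \<open>Under the integral the two exponentials combine to \<open>exp (- n^2 * (t - s))\<close>,
  which is at most 1. The bound is therefore the same for all \<open>n\<close>.\<close>

lemma norm_biorth_le:
  obtains B where "\<And>n t. t \<in> {0..T} \<Longrightarrow> cmod (biorth T n t) \<le> B"
proof
  fix n t assume t: "t \<in> {0..T}"
  define G where "G = (\<Sum>j. sinh_coeff j * (fact j * sqrt (fact j) * 8 ^ j))"
  have G: "cmod (null_kernel T s) \<le> G" for s using norm_null_kernel_le by (simp add: G_def)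
  have G0: "G \<ge> 0" using order_trans[OF norm_ge_zero G] .
  have "biorth T n t = integral {0..t} (\<lambda>s. of_real (exp (- (real n)\<^sup>2 * (t - s))) * null_kernel T s)"
    unfolding biorth_def integral_mult_right[symmetric]
    by (simp add: mult.assoc[symmetric] flip: of_real_mult exp_add) (simp add: algebra_simps)
  also have "cmod \<dots> \<le> G * (t - 0)"
  proof (rule integral_bound)
    show "cmod (of_real (exp (- (real n)\<^sup>2 * (t - s))) * null_kernel T s) \<le> G" if "s \<in> {0..t}" for s
    proof -
      have "exp (- (real n)\<^sup>2 * (t - s)) \<le> 1" using that by (simp add: mult_nonneg_nonneg)
      hence "exp (- (real n)\<^sup>2 * (t - s)) * cmod (null_kernel T s) \<le> 1 * G"
        by (intro mult_mono G) auto
      thus ?thesis by (simp add: norm_mult)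
    qed
  qed (use t in \<open>auto intro!: continuous_intros continuous_on_null_kernel\<close>)
  also have "\<dots> \<le> G * T" using t G0 by (intro mult_left_mono) auto
  finally show "cmod (biorth T n t) \<le> (\<Sum>j. sinh_coeff j * (fact j * sqrt (fact j) * 8 ^ j)) * T"
    unfolding G_def .
qed

text \<open>
  Since \<open>exp (n\<^sup>2 * t) * biorth T n t\<close> vanishes at both ends, integrating by parts leaves a vanishing
  moment of \<open>null_kernel\<close>, except for \<open>m = n\<close>, where the antiderivative of the weight is \<open>t\<close> and the
  first-order moment is left.
\<close>

lemma integral_exp_biorth:
  assumes "T > 0" "n \<ge> 1" "m \<ge> 1"
  shows "integral {0..T} (\<lambda>t. of_real (exp ((real m)\<^sup>2 * t)) * biorth T n t) =
    (if m = n then - of_real ((- 1) ^ n / (2 * (real n)\<^sup>2)) * bump_laplace T ((real n)\<^sup>2) else 0)"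
proof -
  define g where "g = (\<lambda>s. complex_of_real (exp ((real n)\<^sup>2 * s)) * null_kernel T s)"
  define G where "G = (\<lambda>t. integral {0..t} g)"
  define d where "d = (real m)\<^sup>2 - (real n)\<^sup>2"
  have g: "continuous_on {0..T} g"
    unfolding g_def by (intro continuous_intros continuous_on_null_kernel)
  have G: "continuous_on {0..T} G"
    unfolding G_def by (intro indefinite_integral_continuous_1 integrable_continuous_real g)
  have G': "(G has_vector_derivative g t) (at t)" if "t \<in> {0<..<T}" for t
    using integral_has_vector_derivative[OF g, of t] that at_within_Icc_at[of 0 t T]
    by (auto simp: G_def)
  have G0: "G 0 = 0" "G T = 0"
    using integral_exp_null_kernel[OF assms(1,2)] by (auto simp: G_def g_def)
  have parts: "integral {0..T} (\<lambda>t. E t * g t) = - integral {0..T} (\<lambda>t. E' t * G t)"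
    if "continuous_on {0..T} E" "continuous_on {0..T} E'"
      "\<And>t. (E has_vector_derivative E' t) (at t)" for E E' :: "real \<Rightarrow> complex"
    using assms that g G G' G0 by (intro integral_by_parts_complex) auto
  have eq: "integral {0..T} (\<lambda>t. of_real (exp ((real m)\<^sup>2 * t)) * biorth T n t) =
      integral {0..T} (\<lambda>t. of_real (exp (d * t)) * G t)"
    unfolding biorth_def G_def g_def d_def
    by (simp add: mult.assoc[symmetric] flip: of_real_mult exp_add) (simp add: algebra_simps)
  show ?thesis
  proof (cases "m = n")
    case True
    have "integral {0..T} (\<lambda>t. of_real t * g t) = - integral {0..T} (\<lambda>t. 1 * G t)"
      by (rule parts) (auto intro!: continuous_intros derivative_eq_intros simp: has_vector_derivative_of_real)
    also have "integral {0..T} (\<lambda>t. of_real t * g t) =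
        of_real ((- 1) ^ n / (2 * (real n)\<^sup>2)) * bump_laplace T ((real n)\<^sup>2)"
      using integral_ident_exp_null_kernel[OF assms(1,2)] by (simp add: g_def mult.assoc)
    finally show ?thesis using True unfolding eq by (simp add: d_def)
  next
    case False
    hence d: "d \<noteq> 0" by (simp add: d_def)
    have "integral {0..T} (\<lambda>t. of_real (exp (d * t) / d) * g t) = - integral {0..T} (\<lambda>t. of_real (exp (d * t)) * G t)"
    proof (rule parts)
      show "((\<lambda>t. complex_of_real (exp (d * t) / d)) has_vector_derivative of_real (exp (d * t))) (at t)" for t
        using d by (intro has_vector_derivative_of_real)
         (auto intro!: derivative_eq_intros simp flip: has_real_derivative_iff_has_vector_derivative)
    qed (use d in \<open>auto intro!: continuous_intros\<close>)
    \<comment> \<open>By the choice of \<open>d\<close>, the weight and the exponential inside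
      \<open>g\<close> multiply to the exponential of index \<open>m\<close>, whose moment vanishes
      as well.\<close>
    also have "integral {0..T} (\<lambda>t. of_real (exp (d * t) / d) * g t) =
        integral {0..T} (\<lambda>t. of_real (1 / d) * (of_real (exp ((real m)\<^sup>2 * t)) * null_kernel T t))"
    proof -
      have E: "exp ((real m)\<^sup>2 * t) = exp (d * t) * exp ((real n)\<^sup>2 * t)" for t
        by (simp add: d_def algebra_simps flip: exp_add)
      have "of_real (exp (d * t) / d) * g t =
          of_real (1 / d) * (of_real (exp ((real m)\<^sup>2 * t)) * null_kernel T t)" for t
        unfolding E by (simp add: g_def)
      thus ?thesis by (intro integral_cong)
    qed
    also have "\<dots> = of_real (1 / d) * integral {0..T} (\<lambda>t. of_real (exp ((real m)\<^sup>2 * t)) * null_kernel T t)"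
      by simp
    also have "\<dots> = 0" unfolding integral_exp_null_kernel[OF assms(1,3)] by simp
    finally show ?thesis using False unfolding eq by simp
  qed
qed

text \<open>The integrand is real and nonnegative, so the integral may be restricted to the interval
  from \<open>T/2\<close> to \<open>3*T/4\<close>, of length \<open>T/4\<close>. There the
  exponential is at least \<open>exp (l * T / 2)\<close> and the bump at least
  \<open>exp (- 4 / T^2 - 16 / T^2)\<close>.\<close>

lemma norm_bump_laplace_ge:
  assumes "T > 0" "l \<ge> 0"
  shows "cmod (bump_laplace T l) \<ge> T / 4 * exp (- (20 / T\<^sup>2)) * exp (l * T / 2)"
proof -
  define h where "h = (\<lambda>s. Re (of_real (exp (l * s)) * bump_deriv T 0 s))"
  have bump: "bump_deriv T 0 s = of_real (if 0 < s \<and> s < T then exp (- (1 / s\<^sup>2) - 1 / (T - s)\<^sup>2) else 0)" for s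
    by (simp add: bump_deriv_def bump_def exp_of_real[symmetric])
  have cont: "continuous_on S (\<lambda>s. of_real (exp (l * s)) * bump_deriv T 0 s)" for S
    by (intro continuous_intros continuous_on_bump_deriv)
  have int: "h integrable_on {a..b}" for a b
    unfolding h_def by (intro integrable_continuous_real continuous_intros cont)
  have "T / 4 * exp (- (20 / T\<^sup>2)) * exp (l * T / 2) =
      integral {T/2..3*T/4} (\<lambda>s. exp (- (20 / T\<^sup>2)) * exp (l * T / 2))"
    using assms by simp
  also have "\<dots> \<le> integral {T/2..3*T/4} h"
  proof (rule integral_le)
    fix s assume s: "s \<in> {T/2..3*T/4}"
    have "1 / s\<^sup>2 \<le> 1 / (T / 2)\<^sup>2"
      using s assms by (intro divide_left_mono power_mono) auto
    moreover have "1 / (T - s)\<^sup>2 \<le> 1 / (T / 4)\<^sup>2"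
      using s assms by (intro divide_left_mono power_mono) auto
    ultimately have "- (20 / T\<^sup>2) \<le> - (1 / s\<^sup>2) - 1 / (T - s)\<^sup>2"
      by (simp add: power_divide)
    moreover have "l * T / 2 \<le> l * s" using s assms mult_left_mono[of "T / 2" s l] by simp
    moreover have "h s = exp (- (1 / s\<^sup>2) - 1 / (T - s)\<^sup>2) * exp (l * s)"
      using s assms by (simp add: h_def bump)
    ultimately show "exp (- (20 / T\<^sup>2)) * exp (l * T / 2) \<le> h s" by (simp add: mult_mono)
  qed (use int in auto)
  also have "\<dots> \<le> integral {0..T} h"
    by (rule integral_subset_le) (use int assms in \<open>auto simp: h_def bump\<close>)
  also have "\<dots> = Re (bump_laplace T l)"
    unfolding h_def bump_laplace_def
    using integral_linear[OF integrable_continuous_real[OF cont] bounded_linear_Re] by (simp add: o_def)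
  also have "\<dots> \<le> cmod (bump_laplace T l)" by (rule complex_Re_le_cmod)
  finally show ?thesis .
qed

text \<open>The control is the series of \<open>d n / w n\<close> times \<open>biorth T n\<close>,
  with \<open>w n\<close> the diagonal moment. As \<open>w n\<close> grows like
  \<open>exp (n^2 * T / 2) / n^2\<close> at least and \<open>biorth\<close> is uniformly bounded,
  the series converges uniformly for data of exponential growth.\<close>

theorem exponential_moment_problem:
  fixes d :: "nat \<Rightarrow> complex"
  assumes "T > 0" and d: "\<And>n. n \<ge> 1 \<Longrightarrow> cmod (d n) \<le> K * exp (B * real n)"
  obtains v where "continuous_on {0..T} v"
    and "\<And>n. n \<ge> 1 \<Longrightarrow> integral {0..T} (\<lambda>s. of_real (exp ((real n)\<^sup>2 * s)) * v s) = d n"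
proof -
  obtain Q where Q: "\<And>n t. t \<in> {0..T} \<Longrightarrow> cmod (biorth T n t) \<le> Q"
    using norm_biorth_le by blast
  have Q0: "Q \<ge> 0" using Q[of 0] assms(1) norm_ge_zero order_trans by (metis atLeastAtMost_iff less_imp_le order_refl)
  define \<kappa> where "\<kappa> = T / 4 * exp (- (20 / T\<^sup>2))"
  have \<kappa>: "\<kappa> > 0" using assms by (simp add: \<kappa>_def)
  define w where "w = (\<lambda>n. - of_real ((- 1) ^ n / (2 * (real n)\<^sup>2)) * bump_laplace T ((real n)\<^sup>2))"
  have w: "cmod (w n) \<ge> \<kappa> * exp ((real n)\<^sup>2 * T / 2) / (2 * (real n)\<^sup>2)" if "n \<ge> 1" for n
  proof -
    have "cmod (w n) = cmod (bump_laplace T ((real n)\<^sup>2)) / (2 * (real n)\<^sup>2)"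
      by (simp add: w_def norm_mult norm_divide norm_power)
    thus ?thesis
      using divide_right_mono[OF norm_bump_laplace_ge[of T "(real n)\<^sup>2"], of "2 * (real n)\<^sup>2"] assms(1)
      by (simp only: \<kappa>_def) simp
  qed
  have w0: "w n \<noteq> 0" if "n \<ge> 1" for n
  proof -
    have "\<kappa> * exp ((real n)\<^sup>2 * T / 2) / (2 * (real n)\<^sup>2) > 0" using \<kappa> that by simp
    thus ?thesis using w[OF that] by auto
  qed
  \<comment> \<open>Series start at 0 but frequencies at 1, so the summand \<open>j\<close> belongs
    to the frequency \<open>Suc j\<close>.\<close>
  define M where "M = (\<lambda>j. let n = Suc j in K * exp (B * real n) * (2 * (real n)\<^sup>2) / (\<kappa> * exp ((real n)\<^sup>2 * T / 2)) * Q)"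
  define f where "f = (\<lambda>j t. d (Suc j) / w (Suc j) * biorth T (Suc j) t)"
  have cont: "continuous_on {0..T} (f j)" for j
    unfolding f_def by (intro continuous_intros continuous_on_biorth)
  have bound: "cmod (f j t) \<le> M j" if "t \<in> {0..T}" for j t
  proof -
    define n where "n = Suc j"
    have "cmod (d n / w n) \<le> (K * exp (B * real n)) / (\<kappa> * exp ((real n)\<^sup>2 * T / 2) / (2 * (real n)\<^sup>2))"
      unfolding norm_divide using \<kappa> d[of n] w[of n] order_trans[OF norm_ge_zero d[of n]]
      by (intro frac_le) (auto simp: n_def)
    hence "cmod (d n / w n) * cmod (biorth T n t) \<le>
        (K * exp (B * real n)) / (\<kappa> * exp ((real n)\<^sup>2 * T / 2) / (2 * (real n)\<^sup>2)) * Q"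
      using Q[OF that, of n] order_trans[OF norm_ge_zero d[of n]] \<kappa> by (intro mult_mono) (auto simp: n_def)
    thus ?thesis by (simp add: f_def M_def n_def norm_mult norm_divide)
  qed
  have summ: "summable M"
  proof -
    have bigo: "(\<lambda>j. exp (- real (Suc j)) * (real (Suc j))\<^sup>2) \<in> O(\<lambda>j. 1 / real (Suc j) ^ 2)"
      by real_asymp
    have inv: "summable (\<lambda>j. norm (1 / real (Suc j) ^ 2))"
    proof -
      have "summable (\<lambda>n. inverse (real n ^ 2))" by (rule inverse_power_summable) simp
      hence "summable (\<lambda>j. inverse (real (Suc j) ^ 2))"
        by (subst summable_Suc_iff[where f = "\<lambda>n. inverse (real n ^ 2)"])
      moreover have "norm (1 / real (Suc j) ^ 2) = inverse (real (Suc j) ^ 2)" for j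
        by (simp only: real_norm_def abs_of_nonneg[OF divide_nonneg_nonneg] zero_le_one zero_le_power2 inverse_eq_divide)
      ultimately show ?thesis by (simp only:)
    qed
    have summ: "summable (\<lambda>j. exp (- real (Suc j)) * (real (Suc j))\<^sup>2)"
      by (rule summable_comparison_test_bigo[OF inv bigo])
    define L where "L = exp ((B + 1)\<^sup>2 / (2 * T))"
    have K0: "K \<ge> 0" using order_trans[OF norm_ge_zero d[of 1]] by (simp add: zero_le_mult_iff)
    have "norm (M j) \<le> 2 * K * Q / \<kappa> * L * (exp (- real (Suc j)) * (real (Suc j))\<^sup>2)" for j
    proof -
      define n where "n = real (Suc j)"
      \<comment> \<open>Completing the square: the quadratic exponent absorbs
        \<open>(B + 1) * n\<close> at the cost of the constant \<open>L\<close>, which leaves the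
        summable factor \<open>exp (- n)\<close>.\<close>
      have "0 \<le> (T * n - (B + 1))\<^sup>2 / (2 * T)" using assms(1) by simp
      also have "\<dots> = n\<^sup>2 * T / 2 - (B + 1) * n + (B + 1)\<^sup>2 / (2 * T)"
        using assms(1) by (simp add: power2_eq_square divide_simps) (simp add: algebra_simps)
      finally have "exp (B * n - n\<^sup>2 * T / 2) \<le> L * exp (- n)"
        unfolding L_def exp_add[symmetric] by (simp add: algebra_simps)
      hence "2 * K * Q / \<kappa> * n\<^sup>2 * exp (B * n - n\<^sup>2 * T / 2) \<le> 2 * K * Q / \<kappa> * n\<^sup>2 * (L * exp (- n))"
        using K0 Q0 \<kappa> by (intro mult_left_mono) auto
      moreover have "M j = 2 * K * Q / \<kappa> * n\<^sup>2 * exp (B * n - n\<^sup>2 * T / 2)"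
        unfolding M_def Let_def n_def exp_diff by simp
      ultimately show ?thesis using K0 Q0 \<kappa> by (simp add: n_def abs_mult mult_ac)
    qed
    with summable_mult[OF summ] show ?thesis by (rule summable_comparison_test')
  qed
  show thesis
  proof
    show "continuous_on {0..T} (\<lambda>t. \<Sum>j. f j t)"
      by (rule sums_integral_of_M_test(1)[OF cont bound summ])
    fix m :: nat assume m: "m \<ge> 1"
    let ?e = "\<lambda>s. complex_of_real (exp ((real m)\<^sup>2 * s))"
    have "(\<lambda>j. integral {0..T} (\<lambda>s. ?e s * f j s)) sums integral {0..T} (\<lambda>s. \<Sum>j. ?e s * f j s)"
    proof (rule sums_integral_of_M_test(2))
      show "continuous_on {0..T} (\<lambda>s. ?e s * f j s)" for j by (intro continuous_intros cont)
      show "cmod (?e s * f j s) \<le> exp ((real m)\<^sup>2 * T) * M j" if "s \<in> {0..T}" for j s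
        unfolding norm_mult using that bound[OF that]
        by (intro mult_mono) (auto intro: mult_left_mono)
      show "summable (\<lambda>j. exp ((real m)\<^sup>2 * T) * M j)" by (intro summable_mult summ)
    qed
    \<comment> \<open>Biorthogonality leaves only the summand of frequency \<open>m\<close>, which
      has index \<open>m - 1\<close>.\<close>
    moreover have "integral {0..T} (\<lambda>s. ?e s * f j s) = (if j = m - 1 then d m else 0)" for j
    proof -
      have "integral {0..T} (\<lambda>s. ?e s * f j s) =
          integral {0..T} (\<lambda>s. d (Suc j) / w (Suc j) * (?e s * biorth T (Suc j) s))"
        by (simp add: f_def mult_ac)
      also have "\<dots> = d (Suc j) / w (Suc j) * integral {0..T} (\<lambda>s. ?e s * biorth T (Suc j) s)"
        by (rule integral_mult_right)
      also have "integral {0..T} (\<lambda>s. ?e s * biorth T (Suc j) s) = (if m = Suc j then w m else 0)"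
        unfolding w_def using assms(1) m by (subst integral_exp_biorth) auto
      finally show ?thesis using w0[OF m] m by auto
    qed
    moreover have "(\<Sum>j. ?e s * f j s) = ?e s * (\<Sum>j. f j s)" if "s \<in> {0..T}" for s
      using summable_comparison_test'[OF summ bound[OF that]] by (intro suminf_mult) auto
    hence "integral {0..T} (\<lambda>s. \<Sum>j. ?e s * f j s) = integral {0..T} (\<lambda>s. ?e s * (\<Sum>j. f j s))"
      by (rule integral_cong)
    ultimately have "(\<lambda>j. if j = m - 1 then d m else 0) sums integral {0..T} (\<lambda>s. ?e s * (\<Sum>j. f j s))"
      by (simp only:)
    thus "integral {0..T} (\<lambda>s. ?e s * (\<Sum>j. f j s)) = d m"
      using sums_single[of "m - 1" "\<lambda>_. d m"] sums_unique2 by blast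
  qed
qed

section \<open>Fourier coefficients of square integrable functions\<close>

lemma integrable_mult_of_square:
  fixes f g :: "'a \<Rightarrow> complex"
  assumes [measurable]: "f \<in> borel_measurable M" "g \<in> borel_measurable M"
    and "integrable M (\<lambda>x. (cmod (f x))\<^sup>2)" "integrable M (\<lambda>x. (cmod (g x))\<^sup>2)"
  shows "integrable M (\<lambda>x. f x * g x)"
proof (rule Bochner_Integration.integrable_bound)
  show "integrable M (\<lambda>x. (cmod (f x))\<^sup>2 + (cmod (g x))\<^sup>2)" using assms by simp
  have "cmod (f x * g x) \<le> (cmod (f x))\<^sup>2 + (cmod (g x))\<^sup>2" for x
    using sum_squares_bound[of "cmod (f x)" "cmod (g x)"] norm_ge_zero[of "f x * g x"]
    unfolding norm_mult by linarith
  thus "AE x in M. cmod (f x * g x) \<le> norm ((cmod (f x))\<^sup>2 + (cmod (g x))\<^sup>2)" by simp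
qed measurable

text \<open>The integral of \<open>(t * cmod (f x) - cmod (g x))^2\<close> is a nonnegative
  quadratic polynomial in \<open>t\<close>; its minimum, at \<open>t = a / A\<close>, gives the
  inequality.\<close>

lemma integral_Cauchy_Schwarz:
  fixes f g :: "'a \<Rightarrow> complex"
  assumes [measurable]: "f \<in> borel_measurable M" "g \<in> borel_measurable M"
    and int: "integrable M (\<lambda>x. (cmod (f x))\<^sup>2)" "integrable M (\<lambda>x. (cmod (g x))\<^sup>2)"
  shows "cmod (\<integral>x. f x * g x \<partial>M) \<le>
    sqrt (\<integral>x. (cmod (f x))\<^sup>2 \<partial>M) * sqrt (\<integral>x. (cmod (g x))\<^sup>2 \<partial>M)"
proof -
  define A where "A = (\<integral>x. (cmod (f x))\<^sup>2 \<partial>M)"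
  define B where "B = (\<integral>x. (cmod (g x))\<^sup>2 \<partial>M)"
  define a where "a = (\<integral>x. cmod (f x * g x) \<partial>M)"
  have fg: "integrable M (\<lambda>x. cmod (f x * g x))"
    by (intro integrable_norm integrable_mult_of_square assms)
  have "A \<ge> 0" "B \<ge> 0" by (auto simp: A_def B_def)
  have quad: "0 \<le> t\<^sup>2 * A - 2 * t * a + B" for t
  proof -
    have "0 \<le> (\<integral>x. (t * cmod (f x) - cmod (g x))\<^sup>2 \<partial>M)" by simp
    also have "\<dots> = (\<integral>x. t\<^sup>2 * (cmod (f x))\<^sup>2 - 2 * t * cmod (f x * g x) + (cmod (g x))\<^sup>2 \<partial>M)"
      by (simp add: norm_mult power2_diff power_mult_distrib algebra_simps)
    also have "\<dots> = t\<^sup>2 * A - 2 * t * a + B"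
      using int fg by (simp add: A_def B_def a_def)
    finally show ?thesis .
  qed
  have "a\<^sup>2 \<le> A * B"
  proof (cases "A = 0")
    case True
    have "a = 0"
    proof (rule ccontr)
      assume "a \<noteq> 0"
      \<comment> \<open>For \<open>A = 0\<close> the polynomial is affine, and at this
        \<open>t\<close> it takes the value -1.\<close>
      with quad[of "(B + 1) / (2 * a)"] True show False by (simp add: field_simps)
    qed
    thus ?thesis using True by simp
  next
    case False
    with \<open>A \<ge> 0\<close> have "A > 0" by simp
    with quad[of "a / A"] show ?thesis by (simp add: power2_eq_square field_simps)
  qed
  hence "a \<le> sqrt (A * B)" by (rule real_le_rsqrt)
  moreover have "cmod (\<integral>x. f x * g x \<partial>M) \<le> a" unfolding a_def by (rule integral_norm_bound)
  ultimately show ?thesis by (simp add: A_def B_def real_sqrt_mult)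
qed

section \<open>Square integrable functions on the torus\<close>

abbreviation torus_measure :: "real measure" where
  "torus_measure \<equiv> lebesgue_on {0..2 * pi}"

abbreviation sq_int :: "(real \<Rightarrow> complex) \<Rightarrow> bool" where
  "sq_int f \<equiv> f square_integrable_on {0..2 * pi}"

definition L2_norm_sq :: "(real \<Rightarrow> complex) \<Rightarrow> real" where
  "L2_norm_sq f = (\<integral>x. (cmod (f x))\<^sup>2 \<partial>torus_measure)"

lemma L2_norm_sq_nonneg [simp]: "L2_norm_sq f \<ge> 0"
  by (simp add: L2_norm_sq_def)

lemma L2_norm_torus_eq: "L2_norm_torus f = sqrt (L2_norm_sq f)"
  by (simp add: L2_norm_torus_def L2_norm_sq_def)

lemma finite_torus_measure: "finite_measure torus_measure"
  by (intro finite_measure_lebesgue_on) (metis cbox_interval lmeasurable_cbox)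

lemma sq_int_measurable: "sq_int f \<Longrightarrow> f \<in> borel_measurable torus_measure"
  by (simp add: square_integrable_on_def)

lemma sq_int_continuous: "continuous_on {a..b} f \<Longrightarrow> f square_integrable_on {a..b::real}"
  unfolding square_integrable_on_def
  by (intro conjI continuous_imp_measurable_on_sets_lebesgue continuous_imp_integrable_real
        continuous_intros) auto

lemma sq_int_bounded:
  assumes "f \<in> borel_measurable torus_measure" "\<And>x. cmod (f x) \<le> B"
  shows "sq_int f"
  unfolding square_integrable_on_def
proof
  interpret finite_measure torus_measure by (rule finite_torus_measure)
  show "integrable torus_measure (\<lambda>x. (cmod (f x))\<^sup>2)"
    using assms by (intro integrable_const_bound[of _ "B\<^sup>2"]) (auto intro!: AE_I2 power_mono)
qed fact

lemma sq_int_mult_integrable: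
  assumes "sq_int f" "sq_int g"
  shows "integrable torus_measure (\<lambda>x. f x * g x)"
  using assms integrable_mult_of_square by (auto simp: square_integrable_on_def)

lemma sq_int_cmult [intro]: "sq_int f \<Longrightarrow> sq_int (\<lambda>x. c * f x)"
  by (auto simp: square_integrable_on_def norm_mult power_mult_distrib)

lemma norm_add_sq_le: "(cmod (a + b))\<^sup>2 \<le> 2 * (cmod a)\<^sup>2 + 2 * (cmod b)\<^sup>2"
proof -
  have "(cmod (a + b))\<^sup>2 \<le> (cmod a + cmod b)\<^sup>2" by (intro power_mono norm_triangle_ineq) auto
  also have "\<dots> \<le> 2 * (cmod a)\<^sup>2 + 2 * (cmod b)\<^sup>2"
    using sum_squares_bound[of "cmod a" "cmod b"] by (simp add: power2_sum)
  finally show ?thesis .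
qed

lemma sq_int_add [intro]:
  assumes "sq_int f" "sq_int g"
  shows "sq_int (\<lambda>x. f x + g x)"
  unfolding square_integrable_on_def
proof
  show m: "(\<lambda>x. f x + g x) \<in> borel_measurable torus_measure"
    using assms by (auto simp: square_integrable_on_def)
  show "integrable torus_measure (\<lambda>x. (cmod (f x + g x))\<^sup>2)"
  proof (rule Bochner_Integration.integrable_bound)
    show "integrable torus_measure (\<lambda>x. 2 * (cmod (f x))\<^sup>2 + 2 * (cmod (g x))\<^sup>2)"
      using assms by (auto simp: square_integrable_on_def)
  qed (use m norm_add_sq_le in auto)
qed

lemma sq_int_diff [intro]: "sq_int f \<Longrightarrow> sq_int g \<Longrightarrow> sq_int (\<lambda>x. f x - g x)"
  using sq_int_add[of f "\<lambda>x. - 1 * g x"] sq_int_cmult[of g "- 1"] by simp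

lemma sq_int_cnj: "sq_int f \<Longrightarrow> sq_int (\<lambda>x. cnj (f x))"
  using measurable_compose[OF _ borel_measurable_continuous_onI[OF continuous_on_cnj[OF continuous_on_id]]]
  by (auto simp: square_integrable_on_def)

lemma L2_norm_sq_add_le:
  assumes "sq_int f" "sq_int g"
  shows "L2_norm_sq (\<lambda>x. f x + g x) \<le> 2 * L2_norm_sq f + 2 * L2_norm_sq g"
proof -
  have "L2_norm_sq (\<lambda>x. f x + g x) \<le> (\<integral>x. 2 * (cmod (f x))\<^sup>2 + 2 * (cmod (g x))\<^sup>2 \<partial>torus_measure)"
    unfolding L2_norm_sq_def using sq_int_add[OF assms] assms norm_add_sq_le
    by (intro integral_mono) (auto simp: square_integrable_on_def)
  also have "\<dots> = 2 * L2_norm_sq f + 2 * L2_norm_sq g"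
    using assms by (simp add: L2_norm_sq_def square_integrable_on_def)
  finally show ?thesis .
qed

lemma norm_torus_integral_mult_le:
  assumes "sq_int f" "sq_int g"
  shows "cmod (torus_integral (\<lambda>x. f x * g x)) \<le> sqrt (L2_norm_sq f) * sqrt (L2_norm_sq g)"
  unfolding torus_integral_def L2_norm_sq_def
  using assms by (intro integral_Cauchy_Schwarz) (auto simp: square_integrable_on_def)

section \<open>Fourier modes, orthogonality and Bessel's inequality\<close>

lemma fourier_mode_eq_cis: "fourier_mode k x = cis (of_int k * x)"
  by (simp add: fourier_mode_def cis_conv_exp mult_ac)

lemma norm_fourier_mode [simp]: "cmod (fourier_mode k x) = 1"
  by (simp add: fourier_mode_eq_cis)

lemma continuous_on_fourier_mode [continuous_intros]: "continuous_on S (fourier_mode k)"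
  unfolding fourier_mode_def by (intro continuous_intros)

lemma fourier_mode_mult: "fourier_mode k x * fourier_mode l x = fourier_mode (k + l) x"
  by (simp add: fourier_mode_eq_cis cis_mult algebra_simps)

lemma fourier_mode_0 [simp]: "fourier_mode 0 x = 1"
  by (simp add: fourier_mode_def)

lemma cnj_fourier_mode: "cnj (fourier_mode k x) = fourier_mode (- k) x"
  by (simp add: fourier_mode_eq_cis cis_cnj)

lemma fourier_mode_periodic: "fourier_mode k (x + 2 * pi) = fourier_mode k x"
proof -
  have "fourier_mode k (x + 2 * pi) = cis (of_int k * x) * cis (2 * pi * of_int k)"
    unfolding fourier_mode_eq_cis cis_mult by (simp add: algebra_simps)
  thus ?thesis by (simp add: fourier_mode_eq_cis cis_multiple_2pi)
qed

lemma fourier_mode_has_vector_derivative: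
  "(fourier_mode k has_vector_derivative \<i> * of_int k * fourier_mode k x) (at x within S)"
proof -
  have "((\<lambda>z. exp (\<i> * of_int k * z)) has_field_derivative \<i> * of_int k * exp (\<i> * of_int k * of_real x)) (at (of_real x))"
    by (auto intro!: derivative_eq_intros)
  from has_vector_derivative_real_field[OF this] show ?thesis unfolding fourier_mode_def .
qed

lemma sq_int_fourier_mode [simp, intro]: "sq_int (fourier_mode k)"
  by (intro sq_int_continuous continuous_intros)

lemma torus_integral_continuous:
  "continuous_on {0..2 * pi} f \<Longrightarrow> torus_integral f = integral {0..2 * pi} f"
  unfolding torus_integral_def by (intro lebesgue_integral_eq_integral continuous_imp_integrable_real) auto

lemma torus_integral_fourier_mode:
  "torus_integral (fourier_mode k) = (if k = 0 then of_real (2 * pi) else 0)"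
proof (cases "k = 0")
  case True
  hence "fourier_mode k = (\<lambda>_. 1)" by (auto simp: fun_eq_iff)
  thus ?thesis using True by (simp add: torus_integral_continuous scaleR_conv_of_real)
next
  case False
  have "((\<lambda>x. fourier_mode k x) has_integral
      fourier_mode k (2 * pi) / (\<i> * of_int k) - fourier_mode k 0 / (\<i> * of_int k)) {0..2 * pi}"
  proof (rule fundamental_theorem_of_calculus)
    fix x :: real
    show "((\<lambda>x. fourier_mode k x / (\<i> * of_int k)) has_vector_derivative fourier_mode k x) (at x within {0..2 * pi})"
      using has_vector_derivative_mult_right[OF fourier_mode_has_vector_derivative, of "1 / (\<i> * of_int k)" k x "{0..2 * pi}"] False
      by simp
  qed simp
  moreover have "fourier_mode k (2 * pi) = fourier_mode k 0" using fourier_mode_periodic[of k 0] by simp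
  ultimately show ?thesis using False by (simp add: torus_integral_continuous continuous_intros integral_unique)
qed

definition fourier_sum :: "nat \<Rightarrow> (real \<Rightarrow> complex) \<Rightarrow> real \<Rightarrow> complex" where
  "fourier_sum N f x = (\<Sum>k\<in>{- int N..int N}. fourier_coeff f k * fourier_mode k x)"

lemma fourier_coeff_add:
  assumes "sq_int f" "sq_int g"
  shows "fourier_coeff (\<lambda>x. f x + g x) k = fourier_coeff f k + fourier_coeff g k"
  unfolding fourier_coeff_def torus_integral_def
  using sq_int_mult_integrable[OF assms(1) sq_int_fourier_mode[of "- k"]]
    sq_int_mult_integrable[OF assms(2) sq_int_fourier_mode[of "- k"]]
  by (simp add: ring_distribs add_divide_distrib)

lemma fourier_coeff_cmult: "fourier_coeff (\<lambda>x. c * f x) k = c * fourier_coeff f k"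
  unfolding fourier_coeff_def torus_integral_def by (simp add: mult.assoc)

lemma fourier_coeff_diff:
  assumes "sq_int f" "sq_int g"
  shows "fourier_coeff (\<lambda>x. f x - g x) k = fourier_coeff f k - fourier_coeff g k"
  using fourier_coeff_add[OF assms(1) sq_int_cmult[OF assms(2), of "- 1"], of k]
    fourier_coeff_cmult[of "- 1" g k] by simp

lemma sq_int_sum [intro]: "(\<And>k. k \<in> A \<Longrightarrow> sq_int (f k)) \<Longrightarrow> sq_int (\<lambda>x. \<Sum>k\<in>A. f k x)"
proof (induction A rule: infinite_finite_induct)
  case (insert a A)
  thus ?case using sq_int_add[of "f a"] by simp
qed (use sq_int_cmult[OF sq_int_fourier_mode, of 0] in auto)

lemma fourier_coeff_mode: "fourier_coeff (fourier_mode l) k = (if k = l then 1 else 0)"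
  unfolding fourier_coeff_def fourier_mode_mult using torus_integral_fourier_mode[of "l - k"] by simp

lemma fourier_coeff_sum:
  assumes "\<And>k. k \<in> A \<Longrightarrow> sq_int (f k)"
  shows "fourier_coeff (\<lambda>x. \<Sum>k\<in>A. f k x) j = (\<Sum>k\<in>A. fourier_coeff (f k) j)"
  using assms
proof (induction A rule: infinite_finite_induct)
  case (insert a A)
  thus ?case using fourier_coeff_add[of "f a" "\<lambda>x. \<Sum>k\<in>A. f k x" j] by (simp add: sq_int_sum)
qed (use fourier_coeff_cmult[of 0 "\<lambda>_. 0" j] in auto)

lemma fourier_coeff_trig_sum:
  assumes "finite A"
  shows "fourier_coeff (\<lambda>x. \<Sum>k\<in>A. b k * fourier_mode k x) j = (if j \<in> A then b j else 0)"
  using assms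
  by (subst fourier_coeff_sum) (auto simp: fourier_coeff_cmult fourier_coeff_mode if_distrib sum.delta cong: if_cong)

lemma sq_int_fourier_sum [simp, intro]: "sq_int (fourier_sum N f)"
  unfolding fourier_sum_def by (intro sq_int_sum sq_int_cmult sq_int_fourier_mode)

text \<open>The bracket is bilinear, so a mode \<open>k\<close> meets the coefficient of
  \<open>h\<close> at \<open>- k\<close>.\<close>

lemma torus_integral_mult_trig_sum:
  assumes "sq_int h" "finite A"
  shows "torus_integral (\<lambda>x. h x * (\<Sum>k\<in>A. b k * fourier_mode k x)) =
    of_real (2 * pi) * (\<Sum>k\<in>A. b k * fourier_coeff h (- k))"
proof -
  have "torus_integral (\<lambda>x. h x * (\<Sum>k\<in>A. b k * fourier_mode k x)) =
      torus_integral (\<lambda>x. \<Sum>k\<in>A. b k * (h x * fourier_mode k x))"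
    by (simp add: sum_distrib_left mult_ac)
  also have "\<dots> = (\<Sum>k\<in>A. b k * torus_integral (\<lambda>x. h x * fourier_mode k x))"
    unfolding torus_integral_def using sq_int_mult_integrable[OF assms(1) sq_int_fourier_mode] by simp
  finally show ?thesis by (simp add: fourier_coeff_def sum_distrib_left)
qed

lemma L2_norm_sq_eq_Re: "L2_norm_sq f = Re (torus_integral (\<lambda>x. f x * cnj (f x)))"
proof -
  have "(\<lambda>x. f x * cnj (f x)) = (\<lambda>x. complex_of_real ((cmod (f x))\<^sup>2))"
    by (simp only: complex_norm_square)
  thus ?thesis by (simp add: torus_integral_def L2_norm_sq_def del: of_real_power)
qed

text \<open>Conjugation turns the sum into one over the reflected frequencies, to which the bilinear
  formula applies.\<close>

lemma L2_norm_sq_trig_sum: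
  assumes "finite A"
  shows "L2_norm_sq (\<lambda>x. \<Sum>k\<in>A. b k * fourier_mode k x) = 2 * pi * (\<Sum>k\<in>A. (cmod (b k))\<^sup>2)"
proof -
  let ?p = "\<lambda>x. \<Sum>k\<in>A. b k * fourier_mode k x"
  have p: "sq_int ?p" by (intro sq_int_sum sq_int_cmult sq_int_fourier_mode)
  have "torus_integral (\<lambda>x. ?p x * cnj (?p x)) =
      torus_integral (\<lambda>x. ?p x * (\<Sum>k\<in>uminus ` A. cnj (b (- k)) * fourier_mode k x))"
    by (simp add: sum.reindex cnj_fourier_mode)
  also have "\<dots> = of_real (2 * pi) * (\<Sum>k\<in>uminus ` A. cnj (b (- k)) * fourier_coeff ?p (- k))"
    using assms by (intro torus_integral_mult_trig_sum p) auto
  also have "\<dots> = of_real (2 * pi) * (\<Sum>k\<in>A. cnj (b k) * b k)"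
    using assms by (simp add: sum.reindex fourier_coeff_trig_sum)
  also have "\<dots> = of_real (2 * pi * (\<Sum>k\<in>A. (cmod (b k))\<^sup>2))"
    unfolding of_real_mult of_real_sum complex_norm_square by (simp add: mult.commute)
  finally show ?thesis unfolding L2_norm_sq_eq_Re by (metis Re_complex_of_real)
qed

text \<open>Pythagoras: the remainder has no modes up to \<open>N\<close>, hence is orthogonal to
  the partial sum.\<close>

lemma L2_norm_sq_fourier_remainder:
  assumes h: "sq_int h"
  shows "L2_norm_sq (\<lambda>x. h x - fourier_sum N h x) =
    L2_norm_sq h - 2 * pi * (\<Sum>k\<in>{- int N..int N}. (cmod (fourier_coeff h k))\<^sup>2)"
proof -
  let ?A = "{- int N..int N}" and ?s = "fourier_sum N h"
  define r where "r = (\<lambda>x. h x - ?s x)"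
  have r: "sq_int r" unfolding r_def by (intro sq_int_diff h sq_int_fourier_sum)
  have coeff: "fourier_coeff r k = 0" if "k \<in> ?A" for k
    using that fourier_coeff_trig_sum[of ?A "fourier_coeff h" k]
    unfolding r_def fourier_coeff_diff[OF h sq_int_fourier_sum] by (simp add: fourier_sum_def[abs_def])
  have orth: "torus_integral (\<lambda>x. r x * cnj (?s x)) = 0"
  proof -
    have im: "uminus ` ?A = ?A" by auto
    have "cnj (?s x) = (\<Sum>k\<in>uminus ` ?A. cnj (fourier_coeff h (- k)) * fourier_mode k x)" for x
      by (simp add: sum.reindex fourier_sum_def cnj_fourier_mode del: image_uminus_atLeastAtMost)
    hence "torus_integral (\<lambda>x. r x * cnj (?s x)) =
        of_real (2 * pi) * (\<Sum>k\<in>?A. cnj (fourier_coeff h (- k)) * fourier_coeff r (- k))"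
      unfolding im using torus_integral_mult_trig_sum[OF r] by simp
    also have "\<dots> = 0" using coeff by (auto intro!: sum.neutral)
    finally show ?thesis .
  qed
  have "L2_norm_sq h = L2_norm_sq r + L2_norm_sq ?s"
  proof -
    have "(cmod (h x))\<^sup>2 = (cmod (r x))\<^sup>2 + (cmod (?s x))\<^sup>2 + 2 * Re (r x * cnj (?s x))" for x
    proof -
      have "h x = r x + ?s x" by (simp add: r_def)
      thus ?thesis unfolding cmod_power2 by (simp add: power2_eq_square algebra_simps)
    qed
    hence "L2_norm_sq h = (\<integral>x. (cmod (r x))\<^sup>2 + (cmod (?s x))\<^sup>2 + 2 * Re (r x * cnj (?s x)) \<partial>torus_measure)"
      by (simp add: L2_norm_sq_def)
    also have "\<dots> = L2_norm_sq r + L2_norm_sq ?s + 2 * (\<integral>x. Re (r x * cnj (?s x)) \<partial>torus_measure)"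
      using r sq_int_fourier_sum[of N h] sq_int_mult_integrable[OF r sq_int_cnj[OF sq_int_fourier_sum[of N h]]]
      unfolding L2_norm_sq_def square_integrable_on_def by (simp del: complex_cnj_mult times_complex.sel)
    also have "(\<integral>x. Re (r x * cnj (?s x)) \<partial>torus_measure) = Re (torus_integral (\<lambda>x. r x * cnj (?s x)))"
      using sq_int_mult_integrable[OF r sq_int_cnj[OF sq_int_fourier_sum[of N h]]]
      unfolding torus_integral_def by (rule integral_Re)
    finally show ?thesis using orth by simp
  qed
  moreover have "L2_norm_sq ?s = 2 * pi * (\<Sum>k\<in>?A. (cmod (fourier_coeff h k))\<^sup>2)"
    unfolding fourier_sum_def[abs_def] by (rule L2_norm_sq_trig_sum) simp
  ultimately show ?thesis by (simp add: r_def)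
qed

lemma L2_norm_sq_fourier_remainder_le:
  assumes "sq_int h"
  shows "L2_norm_sq (\<lambda>x. h x - fourier_sum N h x) \<le> L2_norm_sq h"
  using L2_norm_sq_fourier_remainder[OF assms, of N] by (simp add: sum_nonneg)

lemma Bessel_inequality:
  assumes "sq_int h"
  shows "2 * pi * (\<Sum>k\<in>{- int N..int N}. (cmod (fourier_coeff h k))\<^sup>2) \<le> L2_norm_sq h"
  using L2_norm_sq_fourier_remainder[OF assms, of N] L2_norm_sq_nonneg by (metis diff_ge_0_iff_ge)

section \<open>Density of trigonometric polynomials and the Parseval identity\<close>

text \<open>The linear span of the modes. The inductive form avoids frequency sets and makes closure
  under products a nested induction.\<close>

inductive trig_poly :: "(real \<Rightarrow> complex) \<Rightarrow> bool" where
  trig_poly_mode: "trig_poly (fourier_mode k)"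
| trig_poly_cmult: "trig_poly p \<Longrightarrow> trig_poly (\<lambda>x. c * p x)"
| trig_poly_add: "trig_poly p \<Longrightarrow> trig_poly q \<Longrightarrow> trig_poly (\<lambda>x. p x + q x)"

lemma trig_poly_const: "trig_poly (\<lambda>_. c)"
  using trig_poly_cmult[OF trig_poly_mode[of 0], of c] by simp

lemma trig_poly_mult:
  assumes "trig_poly p" "trig_poly q"
  shows "trig_poly (\<lambda>x. p x * q x)"
  using assms
proof (induction p)
  case (trig_poly_mode k)
  show ?case using trig_poly_mode
  proof (induction q)
    case (trig_poly_cmult p c)
    thus ?case using trig_poly.trig_poly_cmult[of _ c] by (simp add: mult_ac)
  next
    case (trig_poly_add p q)
    thus ?case using trig_poly.trig_poly_add by (simp add: ring_distribs)
  qed (simp add: fourier_mode_mult trig_poly.trig_poly_mode)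
next
  case (trig_poly_cmult p c)
  thus ?case using trig_poly.trig_poly_cmult[of "\<lambda>x. p x * q x" c] by (simp add: mult_ac)
next
  case (trig_poly_add p p')
  thus ?case using trig_poly.trig_poly_add by (simp add: ring_distribs)
qed

lemma sq_int_trig_poly: "trig_poly p \<Longrightarrow> sq_int p"
  by (induction p rule: trig_poly.induct) auto

text \<open>Partial sums reproduce a trigonometric polynomial once \<open>N\<close> passes its
  frequencies; the eventual form lets two such thresholds be combined without naming them.\<close>

lemma fourier_sum_trig_poly:
  "trig_poly p \<Longrightarrow> \<forall>\<^sub>F N in sequentially. \<forall>x. fourier_sum N p x = p x"
proof (induction p rule: trig_poly.induct)
  case (trig_poly_mode k)
  have "fourier_sum N (fourier_mode k) x = fourier_mode k x" if "N \<ge> nat \<bar>k\<bar>" for N x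
  proof -
    have "fourier_sum N (fourier_mode k) x = (\<Sum>j\<in>{- int N..int N}. if j = k then fourier_mode j x else 0)"
      unfolding fourier_sum_def fourier_coeff_mode by (intro sum.cong) auto
    thus ?thesis using that by (simp add: abs_le_iff nat_le_iff)
  qed
  thus ?case unfolding eventually_sequentially by blast
next
  case (trig_poly_cmult p c)
  thus ?case
    by (auto elim!: eventually_mono simp: fourier_sum_def fourier_coeff_cmult mult.assoc
          simp flip: sum_distrib_left)
next
  case (trig_poly_add p q)
  have "fourier_sum N (\<lambda>x. p x + q x) x = fourier_sum N p x + fourier_sum N q x" for N x
    by (simp add: fourier_sum_def fourier_coeff_add sq_int_trig_poly trig_poly_add.hyps
          ring_distribs sum.distrib)
  with trig_poly_add.IH show ?case by (auto elim: eventually_elim2)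
qed

text \<open>Needed to read the polynomials of Stone-Weierstrass on the circle as trigonometric ones:
  a real-linear functional at \<open>cis x\<close> is a combination of \<open>cos x\<close> and
  \<open>sin x\<close>, and products stay in the class.\<close>

lemma trig_poly_real_polynomial_function_cis:
  "real_polynomial_function g \<Longrightarrow> trig_poly (\<lambda>x. of_real (g (cis x)))"
proof (induction g rule: real_polynomial_function.induct)
  case (linear f)
  interpret bounded_linear f by fact
  have "complex_of_real (f (cis x)) =
      of_real (f 1) * (1 / 2 * (fourier_mode 1 x + fourier_mode (- 1) x)) +
      of_real (f \<i>) * (- \<i> / 2 * (fourier_mode 1 x + - 1 * fourier_mode (- 1) x))" for x
  proof -
    have "cis x = cos x *\<^sub>R 1 + sin x *\<^sub>R \<i>" by (simp add: complex_eq_iff)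
    hence "f (cis x) = cos x * f 1 + sin x * f \<i>" by (metis add scaleR real_scaleR_def)
    thus ?thesis by (simp add: fourier_mode_eq_cis complex_eq_iff)
  qed
  moreover have "trig_poly (\<lambda>x. of_real (f 1) * (1 / 2 * (fourier_mode 1 x + fourier_mode (- 1) x)) +
      of_real (f \<i>) * (- \<i> / 2 * (fourier_mode 1 x + - 1 * fourier_mode (- 1) x)))"
    by (intro trig_poly.intros)
  ultimately show ?case by presburger
next
  case (const c)
  show ?case by (rule trig_poly_const)
next
  case (add f g)
  thus ?case using trig_poly_add by simp
next
  case (mult f g)
  thus ?case using trig_poly_mult by simp
qed

lemma trig_poly_polynomial_function_cis:
  assumes "polynomial_function (g :: complex \<Rightarrow> complex)"
  shows "trig_poly (\<lambda>x. g (cis x))"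
proof -
  have "real_polynomial_function (\<lambda>z. Re (g z))" "real_polynomial_function (\<lambda>z. Im (g z))"
    using assms bounded_linear_Re bounded_linear_Im by (auto simp: polynomial_function_def o_def)
  hence "trig_poly (\<lambda>x. of_real (Re (g (cis x))) + \<i> * of_real (Im (g (cis x))))"
    by (intro trig_poly_add trig_poly_cmult trig_poly_real_polynomial_function_cis)
  thus ?thesis by (simp flip: complex_eq)
qed

section \<open>Approximation in the square mean, starting from functions bounded by
  truncation\<close>

definition radial_trunc :: "real \<Rightarrow> complex \<Rightarrow> complex" where
  "radial_trunc B z = of_real (B / max B (cmod z)) * z"

lemma continuous_on_radial_trunc: "B > 0 \<Longrightarrow> continuous_on S (radial_trunc B)"
  unfolding radial_trunc_def by (intro continuous_intros) auto

lemma norm_radial_trunc_le: "B > 0 \<Longrightarrow> cmod (radial_trunc B z) \<le> B"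
  unfolding radial_trunc_def norm_mult norm_of_real by (auto simp: field_simps max_def abs_if)

lemma radial_trunc_eq: "B > 0 \<Longrightarrow> cmod z \<le> B \<Longrightarrow> radial_trunc B z = z"
  by (simp add: radial_trunc_def max_def)

lemma norm_diff_radial_trunc_le: "B > 0 \<Longrightarrow> cmod (z - radial_trunc B z) \<le> cmod z"
proof -
  assume B: "B > 0"
  have "z - radial_trunc B z = of_real (1 - B / max B (cmod z)) * z"
    by (simp add: radial_trunc_def algebra_simps)
  moreover have "\<bar>1 - B / max B (cmod z)\<bar> \<le> 1"
  proof -
    have "0 \<le> B / max B (cmod z)" "B / max B (cmod z) \<le> 1" using B by (auto simp: divide_le_eq_1)
    thus ?thesis by linarith
  qed
  ultimately show ?thesis by (simp add: norm_mult mult_left_le_one_le del: of_real_diff of_real_divide)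
qed

lemma L2_norm_sq_tendsto_zero:
  assumes [measurable]: "\<And>n. f n \<in> borel_measurable torus_measure"
    and w: "integrable torus_measure w"
    and bound: "\<And>n x. (cmod (f n x))\<^sup>2 \<le> w x"
    and lim: "AE x in torus_measure. (\<lambda>n. f n x) \<longlonglongrightarrow> 0"
  shows "(\<lambda>n. L2_norm_sq (f n)) \<longlonglongrightarrow> 0"
proof -
  have "(\<lambda>n. \<integral>x. (cmod (f n x))\<^sup>2 \<partial>torus_measure) \<longlonglongrightarrow> (\<integral>x. 0 \<partial>torus_measure)"
  proof (rule integral_dominated_convergence[OF _ _ w])
    show "AE x in torus_measure. (\<lambda>n. (cmod (f n x))\<^sup>2) \<longlonglongrightarrow> 0"
      using lim by eventually_elim (auto intro!: tendsto_eq_intros)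
  qed (use bound in auto)
  thus ?thesis by (simp add: L2_norm_sq_def)
qed

text \<open>
  The factor \<open>min 1 (n * (1 - Re z))\<close> removes the jump of \<open>Arg2pi\<close> at \<open>1\<close>, so that a continuous
  function on the line becomes a continuous function on the circle.
\<close>

lemma continuous_on_sphere_cutoff:
  fixes G :: "real \<Rightarrow> complex"
  assumes G: "continuous_on UNIV G" "\<And>x. cmod (G x) \<le> B" and "n \<ge> 0"
  shows "continuous_on (sphere 0 1) (\<lambda>z. of_real (min 1 (n * (1 - Re z))) * G (Arg2pi z))"
proof (rule continuous_at_imp_continuous_on, rule ballI)
  fix z :: complex assume z: "z \<in> sphere 0 1"
  define w where "w = (\<lambda>z. min 1 (n * (1 - Re z)))"
  show "isCont (\<lambda>z. of_real (w z) * G (Arg2pi z)) z"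
  proof (cases "z \<in> \<real>\<^sub>\<ge>\<^sub>0")
    case False
    have "isCont G x" for x using G(1) by (simp add: continuous_on_eq_continuous_at)
    hence "isCont (\<lambda>z. G (Arg2pi z)) z"
      by (intro isCont_o2[OF continuous_at_Arg2pi[OF False]])
    moreover have "continuous_on UNIV w" unfolding w_def by (intro continuous_intros)
    hence "isCont w z" by (simp add: continuous_on_eq_continuous_at)
    ultimately show ?thesis by (intro continuous_intros)
  next
    case True
    hence "z = 1" using z by (auto simp: nonneg_Reals_def)
    have B: "B \<ge> 0" using G(2)[of 0] norm_ge_zero order_trans by blast
    have "(\<lambda>z. of_real (w z) * G (Arg2pi z)) \<midarrow>1\<rightarrow> 0"
    proof (rule Lim_null_comparison)
      have "cmod (of_real (w y) * G (Arg2pi y)) \<le> \<bar>w y\<bar> * B" for y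
        using G(2) B by (simp add: norm_mult mult_left_mono)
      thus "\<forall>\<^sub>F y in at 1. cmod (of_real (w y) * G (Arg2pi y)) \<le> \<bar>w y\<bar> * B" by simp
      have "continuous_on UNIV (\<lambda>y. \<bar>w y\<bar> * B)" unfolding w_def by (intro continuous_intros)
      hence "isCont (\<lambda>y. \<bar>w y\<bar> * B) 1" by (simp add: continuous_on_eq_continuous_at)
      thus "(\<lambda>y. \<bar>w y\<bar> * B) \<midarrow>1\<rightarrow> 0" by (simp add: isCont_def w_def)
    qed
    thus ?thesis by (simp add: isCont_def \<open>z = 1\<close> w_def)
  qed
qed

lemma L2_norm_sq_le_uniform:
  assumes "\<And>x. cmod (f x) \<le> \<epsilon>" and "sq_int f"
  shows "L2_norm_sq f \<le> 2 * pi * \<epsilon>\<^sup>2"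
proof -
  have "L2_norm_sq f \<le> (\<integral>x. \<epsilon>\<^sup>2 \<partial>torus_measure)"
    unfolding L2_norm_sq_def using assms by (intro integral_mono) (auto simp: square_integrable_on_def intro: power_mono)
  also have "\<dots> = 2 * pi * \<epsilon>\<^sup>2" by (subst lebesgue_integral_eq_integral) auto
  finally show ?thesis .
qed

text \<open>A measurable function is almost everywhere a limit of continuous functions
  \<open>F n\<close>. These are truncated at \<open>B\<close>, moved to the circle by the cutoff,
  and converge in the square mean by dominated convergence; Stone-Weierstrass then approximates one
  of them uniformly.\<close>

lemma trig_poly_dense_bounded:
  assumes f: "f \<in> borel_measurable torus_measure" "\<And>x. cmod (f x) \<le> B" and "B > 0" "\<epsilon> > 0"
  obtains p where "trig_poly p" "L2_norm_sq (\<lambda>x. f x - p x) < \<epsilon>"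
proof -
  have "f measurable_on {0..2 * pi}" using f by (simp add: measurable_on_iff_borel_measurable)
  then obtain N F where N: "negligible N" and F: "\<And>n. continuous_on UNIV (F n)"
    and lim: "\<And>x. x \<notin> N \<Longrightarrow> (\<lambda>n. F n x) \<longlonglongrightarrow> (if x \<in> {0..2 * pi} then f x else 0)"
    unfolding measurable_on_def by metis
  define G where "G = (\<lambda>n x. radial_trunc B (F n x))"
  have G: "continuous_on UNIV (G n)" "cmod (G n x) \<le> B" for n x
    unfolding G_def
    by (auto intro!: continuous_on_compose2[OF continuous_on_radial_trunc F] norm_radial_trunc_le \<open>B > 0\<close>)
  define h where "h = (\<lambda>n z. of_real (min 1 (real n * (1 - Re z))) * G n (Arg2pi z))"
  have h: "continuous_on (sphere 0 1) (h n)" for n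
    unfolding h_def by (intro continuous_on_sphere_cutoff[OF G]) auto
  have hcis: "continuous_on S (\<lambda>x. h n (cis x))" for n S
    by (rule continuous_on_compose2[OF h continuous_on_cis]) (auto intro!: continuous_intros)
  have norm_h: "cmod (h n z) \<le> B" if "cmod z = 1" for n z
  proof -
    have "0 \<le> min 1 (real n * (1 - Re z))" using complex_Re_le_cmod[of z] that by simp
    hence "cmod (h n z) \<le> 1 * B"
      unfolding h_def norm_mult norm_of_real using G \<open>B > 0\<close> by (intro mult_mono) auto
    thus ?thesis by simp
  qed
  have "(\<lambda>n. L2_norm_sq (\<lambda>x. f x - h n (cis x))) \<longlonglongrightarrow> 0"
  proof (rule L2_norm_sq_tendsto_zero[where w = "\<lambda>_. (2 * B)\<^sup>2"])
    show "(\<lambda>x. f x - h n (cis x)) \<in> borel_measurable torus_measure" for n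
      by (intro borel_measurable_diff f(1) continuous_imp_measurable_on_sets_lebesgue hcis) auto
    show "(cmod (f x - h n (cis x)))\<^sup>2 \<le> (2 * B)\<^sup>2" for n x
    proof (rule power_mono)
      show "cmod (f x - h n (cis x)) \<le> 2 * B"
        using norm_triangle_ineq4[of "f x" "h n (cis x)"] f(2)[of x] norm_h[OF norm_cis, of n x] by linarith
    qed simp
    \<comment> \<open>The endpoints are excluded along with the exceptional set, because the cutoff
      is zero there for every \<open>n\<close>.\<close>
    have "AE x in lebesgue. x \<notin> N \<union> {0, 2 * pi}"
      using N by (intro AE_not_in) (auto simp: negligible_iff_null_sets[symmetric])
    hence "AE x in lebesgue. x \<in> {0..2 * pi} \<longrightarrow> (\<lambda>n. f x - h n (cis x)) \<longlonglongrightarrow> 0"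
    proof eventually_elim
      case (elim x)
      show ?case
      proof
        assume "x \<in> {0..2 * pi}"
        with elim have x: "0 < x" "x < 2 * pi" "x \<notin> N" by auto
        have arg: "Arg2pi (cis x) = x" using x Arg2pi_unique[of 1 x "cis x"] by (simp add: cis_conv_exp)
        have "cos x < 1"
        proof -
          have "sin (x / 2) > 0" using x by (intro sin_gt_zero) auto
          thus ?thesis using cos_double_sin[of "x / 2"] by simp
        qed
        have "\<forall>\<^sub>F n in sequentially. real n \<ge> 1 / (1 - cos x)"
          using filterlim_real_sequentially by (simp add: filterlim_at_top)
        hence "\<forall>\<^sub>F n in sequentially. h n (cis x) = G n x"
        proof eventually_elim
          case (elim n)
          hence "real n * (1 - cos x) \<ge> 1" using \<open>cos x < 1\<close> by (simp add: pos_divide_le_eq)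
          thus ?case by (simp add: h_def arg)
        qed
        moreover have "(\<lambda>n. G n x) \<longlonglongrightarrow> f x"
        proof -
          have "isCont (radial_trunc B) (f x)"
            using continuous_on_radial_trunc[OF \<open>B > 0\<close>, of UNIV] by (simp add: continuous_on_eq_continuous_at)
          moreover have "(\<lambda>n. F n x) \<longlonglongrightarrow> f x" using lim[of x] x by simp
          ultimately have "(\<lambda>n. radial_trunc B (F n x)) \<longlonglongrightarrow> radial_trunc B (f x)"
            by (rule isCont_tendsto_compose)
          thus ?thesis using f(2) \<open>B > 0\<close> by (simp add: G_def radial_trunc_eq)
        qed
        ultimately have "(\<lambda>n. h n (cis x)) \<longlonglongrightarrow> f x" by (simp add: tendsto_cong)
        from tendsto_diff[OF tendsto_const this, of "f x"] show "(\<lambda>n. f x - h n (cis x)) \<longlonglongrightarrow> 0" by simp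
      qed
    qed
    thus "AE x in torus_measure. (\<lambda>n. f x - h n (cis x)) \<longlonglongrightarrow> 0"
      by (subst AE_restrict_space_iff) auto
  qed auto
  hence "\<forall>\<^sub>F n in sequentially. L2_norm_sq (\<lambda>x. f x - h n (cis x)) < \<epsilon> / 4"
    using \<open>\<epsilon> > 0\<close> by (intro order_tendstoD) auto
  then obtain n where n: "L2_norm_sq (\<lambda>x. f x - h n (cis x)) < \<epsilon> / 4"
    by (auto simp: eventually_sequentially)
  \<comment> \<open>With this choice \<open>2 * pi * \<delta>\<^sup>2 = \<epsilon> / 4\<close>;
    \<open>L2_norm_sq_add_le\<close> doubles both errors, which add up to less than
    \<open>\<epsilon>\<close>.\<close>
  define \<delta> where "\<delta> = sqrt (\<epsilon> / (8 * pi))"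
  have \<delta>: "\<delta> > 0" "\<delta>\<^sup>2 = \<epsilon> / (8 * pi)" using \<open>\<epsilon> > 0\<close> by (auto simp: \<delta>_def)
  obtain g where g: "polynomial_function g" "\<And>z. z \<in> sphere 0 1 \<Longrightarrow> cmod (h n z - g z) < \<delta>"
    using Stone_Weierstrass_polynomial_function[OF compact_sphere h \<delta>(1)] by blast
  define p where "p = (\<lambda>x. g (cis x))"
  have p: "trig_poly p" unfolding p_def by (rule trig_poly_polynomial_function_cis[OF g(1)])
  have sq1: "sq_int (\<lambda>x. f x - h n (cis x))"
    by (intro sq_int_diff sq_int_bounded[OF f] sq_int_continuous hcis)
  have sq2: "sq_int (\<lambda>x. h n (cis x) - p x)"
    by (intro sq_int_diff sq_int_trig_poly p sq_int_continuous hcis)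
  have "L2_norm_sq (\<lambda>x. h n (cis x) - p x) \<le> 2 * pi * \<delta>\<^sup>2"
    using g(2) by (intro L2_norm_sq_le_uniform sq2) (auto simp: p_def intro!: less_imp_le)
  hence "L2_norm_sq (\<lambda>x. h n (cis x) - p x) \<le> \<epsilon> / 4" unfolding \<delta> by simp
  with n L2_norm_sq_add_le[OF sq1 sq2] have "L2_norm_sq (\<lambda>x. f x - p x) < \<epsilon>" by simp
  with p show thesis using that by blast
qed

text \<open>Truncation at height \<open>Suc n\<close> reduces to the bounded case, the truncation
  error being dominated by the square of \<open>f\<close>.\<close>

lemma trig_poly_dense:
  assumes f: "sq_int f" and "\<epsilon> > 0"
  obtains p where "trig_poly p" "L2_norm_sq (\<lambda>x. f x - p x) < \<epsilon>"
proof -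
  define g where "g = (\<lambda>n x. radial_trunc (real (Suc n)) (f x))"
  have g: "g n \<in> borel_measurable torus_measure" for n
    unfolding g_def
    by (intro measurable_compose[OF sq_int_measurable[OF f]] borel_measurable_continuous_onI
          continuous_on_radial_trunc) simp
  have "(\<lambda>n. L2_norm_sq (\<lambda>x. f x - g n x)) \<longlonglongrightarrow> 0"
  proof (rule L2_norm_sq_tendsto_zero)
    show "(\<lambda>x. f x - g n x) \<in> borel_measurable torus_measure" for n
      using g sq_int_measurable[OF f] by auto
    show "integrable torus_measure (\<lambda>x. (cmod (f x))\<^sup>2)" using f by (simp add: square_integrable_on_def)
    show "(cmod (f x - g n x))\<^sup>2 \<le> (cmod (f x))\<^sup>2" for n x
      unfolding g_def by (intro power_mono norm_diff_radial_trunc_le) auto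
    show "AE x in torus_measure. (\<lambda>n. f x - g n x) \<longlonglongrightarrow> 0"
    proof (rule AE_I2)
      fix x
      have "\<forall>\<^sub>F n in sequentially. real n \<ge> cmod (f x)"
        using filterlim_real_sequentially by (simp add: filterlim_at_top)
      hence "\<forall>\<^sub>F n in sequentially. f x - g n x = 0"
        by eventually_elim (simp add: g_def radial_trunc_eq)
      thus "(\<lambda>n. f x - g n x) \<longlonglongrightarrow> 0" by (rule tendsto_eventually)
    qed
  qed
  hence "\<forall>\<^sub>F n in sequentially. L2_norm_sq (\<lambda>x. f x - g n x) < \<epsilon> / 4"
    using \<open>\<epsilon> > 0\<close> by (intro order_tendstoD) auto
  then obtain n where n: "L2_norm_sq (\<lambda>x. f x - g n x) < \<epsilon> / 4"
    by (auto simp: eventually_sequentially)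
  have le: "cmod (g n x) \<le> real (Suc n)" for x unfolding g_def by (rule norm_radial_trunc_le) simp
  obtain p where p: "trig_poly p" "L2_norm_sq (\<lambda>x. g n x - p x) < \<epsilon> / 4"
    using trig_poly_dense_bounded[OF g le, where \<epsilon> = "\<epsilon> / 4"] \<open>\<epsilon> > 0\<close> by auto
  have "sq_int (\<lambda>x. f x - g n x)" "sq_int (\<lambda>x. g n x - p x)"
    using sq_int_bounded[OF g le] f sq_int_trig_poly[OF p(1)] by auto
  from L2_norm_sq_add_le[OF this] n p have "L2_norm_sq (\<lambda>x. f x - p x) < \<epsilon>" by simp
  with p show thesis using that by blast
qed

text \<open>For large \<open>N\<close> the partial sum fixes a nearby trigonometric polynomial
  \<open>p\<close>, so the remainder of \<open>f\<close> equals that of \<open>f - p\<close>, and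
  taking remainders does not increase the norm.\<close>

lemma fourier_sum_tendsto_L2:
  assumes f: "sq_int f"
  shows "(\<lambda>N. L2_norm_sq (\<lambda>x. f x - fourier_sum N f x)) \<longlonglongrightarrow> 0"
proof (rule LIMSEQ_I)
  fix \<epsilon> :: real assume "\<epsilon> > 0"
  then obtain p where p: "trig_poly p" "L2_norm_sq (\<lambda>x. f x - p x) < \<epsilon>"
    using trig_poly_dense[OF f] by blast
  have sq: "sq_int (\<lambda>x. f x - p x)" using f sq_int_trig_poly[OF p(1)] by auto
  have "\<forall>\<^sub>F N in sequentially. L2_norm_sq (\<lambda>x. f x - fourier_sum N f x) < \<epsilon>"
    using fourier_sum_trig_poly[OF p(1)]
  proof eventually_elim
    case (elim N)
    have "fourier_sum N (\<lambda>x. f x - p x) x = fourier_sum N f x - p x" for x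
      using elim by (simp add: fourier_sum_def fourier_coeff_diff f sq_int_trig_poly p(1) left_diff_distrib sum_subtractf)
    hence "L2_norm_sq (\<lambda>x. f x - fourier_sum N f x) =
        L2_norm_sq (\<lambda>x. (f x - p x) - fourier_sum N (\<lambda>x. f x - p x) x)"
      by simp
    also have "\<dots> \<le> L2_norm_sq (\<lambda>x. f x - p x)" by (rule L2_norm_sq_fourier_remainder_le[OF sq])
    finally show ?case using p by simp
  qed
  thus "\<exists>N0. \<forall>N\<ge>N0. norm (L2_norm_sq (\<lambda>x. f x - fourier_sum N f x) - 0) < \<epsilon>"
    by (simp add: eventually_sequentially)
qed

lemma Parseval:
  assumes "sq_int f"
  shows "(\<lambda>N. 2 * pi * (\<Sum>k\<in>{- int N..int N}. (cmod (fourier_coeff f k))\<^sup>2)) \<longlonglongrightarrow> L2_norm_sq f"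
proof -
  have "(\<lambda>N. L2_norm_sq f - L2_norm_sq (\<lambda>x. f x - fourier_sum N f x)) \<longlonglongrightarrow> L2_norm_sq f - 0"
    by (intro tendsto_diff tendsto_const fourier_sum_tendsto_L2 assms)
  thus ?thesis by (simp add: L2_norm_sq_fourier_remainder[OF assms])
qed

text \<open>The bilinear form of the Parseval identity: the finite sums are brackets of
  \<open>g\<close> with partial sums of \<open>f\<close>, and Cauchy-Schwarz controls the
  remainder.\<close>

lemma torus_integral_mult_tendsto:
  assumes f: "sq_int f" and g: "sq_int g"
  shows "(\<lambda>N. of_real (2 * pi) * (\<Sum>k\<in>{- int N..int N}. fourier_coeff f k * fourier_coeff g (- k)))
    \<longlonglongrightarrow> torus_integral (\<lambda>x. f x * g x)"
proof -
  have eq: "of_real (2 * pi) * (\<Sum>k\<in>{- int N..int N}. fourier_coeff f k * fourier_coeff g (- k)) =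
      torus_integral (\<lambda>x. g x * fourier_sum N f x)" for N
    unfolding fourier_sum_def by (subst torus_integral_mult_trig_sum[OF g]) auto
  have diff: "torus_integral (\<lambda>x. g x * fourier_sum N f x) - torus_integral (\<lambda>x. f x * g x) =
      - torus_integral (\<lambda>x. (f x - fourier_sum N f x) * g x)" for N
  proof -
    have "torus_integral (\<lambda>x. (f x - fourier_sum N f x) * g x) =
        torus_integral (\<lambda>x. f x * g x - g x * fourier_sum N f x)"
      by (simp add: algebra_simps)
    also have "\<dots> = torus_integral (\<lambda>x. f x * g x) - torus_integral (\<lambda>x. g x * fourier_sum N f x)"
      unfolding torus_integral_def
      by (intro Bochner_Integration.integral_diff sq_int_mult_integrable f g sq_int_fourier_sum)
    finally show ?thesis by simp
  qed
  show ?thesis unfolding eq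
  proof (rule LIM_zero_cancel, rule Lim_null_comparison)
    show "\<forall>\<^sub>F N in sequentially. cmod (torus_integral (\<lambda>x. g x * fourier_sum N f x) - torus_integral (\<lambda>x. f x * g x))
        \<le> sqrt (L2_norm_sq (\<lambda>x. f x - fourier_sum N f x)) * sqrt (L2_norm_sq g)"
      unfolding diff norm_minus_cancel
      by (intro always_eventually allI norm_torus_integral_mult_le sq_int_diff f g sq_int_fourier_sum)
    have "(\<lambda>N. sqrt (L2_norm_sq (\<lambda>x. f x - fourier_sum N f x)) * sqrt (L2_norm_sq g)) \<longlonglongrightarrow> sqrt 0 * sqrt (L2_norm_sq g)"
      by (intro tendsto_intros fourier_sum_tendsto_L2 f)
    thus "(\<lambda>N. sqrt (L2_norm_sq (\<lambda>x. f x - fourier_sum N f x)) * sqrt (L2_norm_sq g)) \<longlonglongrightarrow> 0" by simp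
  qed
qed

text \<open>The norm sees one period only; by periodicity the exceptional set is covered by
  countably many translates of a null set.\<close>

lemma AE_zero_of_L2_norm_sq:
  assumes f: "f \<in> L2_torus" and "L2_norm_sq f = 0"
  shows "AE x in lebesgue. f x = 0"
proof -
  have per: "f (x + 2 * pi) = f x" for x using f by (auto simp: L2_torus_def torus_fun_def)
  have sq: "sq_int f" using f by (simp add: L2_torus_def)
  have "AE x in torus_measure. (cmod (f x))\<^sup>2 = 0"
    using assms(2) sq integral_nonneg_eq_0_iff_AE[of torus_measure "\<lambda>x. (cmod (f x))\<^sup>2"]
    by (simp add: L2_norm_sq_def square_integrable_on_def)
  hence "AE x in lebesgue. x \<in> {0..2 * pi} \<longrightarrow> f x = 0"
    by (subst (asm) AE_restrict_space_iff) auto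
  then obtain N where N: "N \<in> null_sets lebesgue" "{x. \<not> (x \<in> {0..2 * pi} \<longrightarrow> f x = 0)} \<subseteq> N"
    by (auto simp: eventually_ae_filter)
  have shift: "f (x + of_int k * (2 * pi)) = f x" for x k
  proof (induction k rule: int_induct[where k = 0])
    case (step1 i)
    thus ?case using per[of "x + of_int i * (2 * pi)"] by (simp add: algebra_simps)
  next
    case (step2 i)
    thus ?case using per[of "x + of_int (i - 1) * (2 * pi)"] by (simp add: algebra_simps)
  qed simp
  define Z where "Z = (\<Union>k::int. (+) (of_int k * (2 * pi)) ` N)"
  have "Z \<in> null_sets lebesgue"
    unfolding Z_def using N(1) negligible_translation
    by (intro null_sets_UN) (auto simp: negligible_iff_null_sets[symmetric])
  moreover have "{x. f x \<noteq> 0} \<subseteq> Z"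
  proof safe
    fix x assume x: "f x \<noteq> 0"
    define k where "k = \<lfloor>x / (2 * pi)\<rfloor>"
    define y where "y = x - of_int k * (2 * pi)"
    have "of_int k \<le> x / (2 * pi)" "x / (2 * pi) < of_int k + 1" by (auto simp: k_def)
    hence "y \<in> {0..2 * pi}" by (auto simp: y_def field_simps)
    moreover have "f y = f x" using shift[of y k] by (simp add: y_def)
    ultimately have "y \<in> N" using N(2) x by auto
    thus "x \<in> Z" unfolding Z_def y_def by (auto intro!: bexI[of _ k] image_eqI[of _ _ "x - of_int k * (2 * pi)"])
  qed
  ultimately show ?thesis by (auto intro: AE_I')
qed

section \<open>Series over the integers, test functions and linear equations\<close>

lemma sum_symmetric_interval:
  "(\<Sum>k\<in>{- int N..int N}. f k) = f 0 + (\<Sum>n<N. f (int (Suc n)) + f (- int (Suc n)))"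
proof (induction N)
  case (Suc N)
  have "{- int (Suc N)..int (Suc N)} = insert (int (Suc N)) (insert (- int (Suc N)) {- int N..int N})"
    by auto
  hence "(\<Sum>k\<in>{- int (Suc N)..int (Suc N)}. f k) =
      f (int (Suc N)) + (f (- int (Suc N)) + (\<Sum>k\<in>{- int N..int N}. f k))"
    by simp
  thus ?case using Suc by (simp add: add_ac)
qed simp

text \<open>\<open>int_decode\<close> enumerates the integers, so that series over the naturals can
  be used. Any finite part of the enumeration lies in a symmetric interval.\<close>

lemma summable_int_decode:
  fixes B :: "int \<Rightarrow> real"
  assumes nonneg: "\<And>k. B k \<ge> 0" and bound: "\<And>N. (\<Sum>k\<in>{- int N..int N}. B k) \<le> K"
  shows "summable (\<lambda>n. B (int_decode n))"
proof (rule summableI_nonneg_bounded)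
  fix m
  define N where "N = nat (Max (insert 0 ((\<lambda>n. \<bar>int_decode n\<bar>) ` {..<m})))"
  have "\<bar>int_decode n\<bar> \<le> int N" if "n < m" for n
    using that by (simp add: N_def le_nat_iff)
  hence "int_decode n \<in> {- int N..int N}" if "n < m" for n
    unfolding atLeastAtMost_iff using that by (simp add: abs_le_iff minus_le_iff)
  hence sub: "int_decode ` {..<m} \<subseteq> {- int N..int N}" by blast
  have "(\<Sum>n<m. B (int_decode n)) = (\<Sum>k\<in>int_decode ` {..<m}. B k)"
    by (simp add: sum.reindex inj_int_decode)
  also have "\<dots> \<le> (\<Sum>k\<in>{- int N..int N}. B k)" by (rule sum_mono2) (use sub nonneg in auto)
  finally show "(\<Sum>n<m. B (int_decode n)) \<le> K" using bound order_trans by blast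
qed (rule nonneg)

lemma sum_symmetric_le_suminf:
  fixes B :: "int \<Rightarrow> real"
  assumes nonneg: "\<And>k. B k \<ge> 0" and "summable (\<lambda>n. B (int_decode n))"
  shows "(\<Sum>k\<in>{- int N..int N}. B k) \<le> (\<Sum>n. B (int_decode n))"
proof -
  have "(\<Sum>k\<in>{- int N..int N}. B k) = (\<Sum>n\<in>int_encode ` {- int N..int N}. B (int_decode n))"
    by (simp add: sum.reindex inj_int_encode)
  also have "\<dots> \<le> (\<Sum>n. B (int_decode n))"
    by (rule sum_le_suminf) (use assms in auto)
  finally show ?thesis .
qed

text \<open>The index 0 contributes \<open>0 powr p = 0\<close>; the other indices pair up to twice
  a convergent series over the positive integers.\<close>

lemma summable_int_powr:
  assumes "p < - 1"
  shows "summable (\<lambda>n. \<bar>real_of_int (int_decode n)\<bar> powr p)"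
proof (rule summable_int_decode)
  have s: "summable (\<lambda>n. real (Suc n) powr p)"
    using assms by (subst summable_Suc_iff[where f = "\<lambda>n. real n powr p"]) (simp add: summable_real_powr_iff)
  show "(\<Sum>k\<in>{- int N..int N}. \<bar>real_of_int k\<bar> powr p) \<le> 2 * (\<Sum>n. real (Suc n) powr p)" for N
  proof -
    have "(\<Sum>k\<in>{- int N..int N}. \<bar>real_of_int k\<bar> powr p) = 2 * (\<Sum>n<N. real (Suc n) powr p)"
      unfolding sum_symmetric_interval by (simp add: sum_distrib_left add.commute)
    also have "\<dots> \<le> 2 * (\<Sum>n. real (Suc n) powr p)"
      by (intro mult_left_mono sum_le_suminf s) auto
    finally show ?thesis .
  qed
qed simp

lemma summable_fourier_coeff_sq:
  assumes "sq_int f"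
  shows "summable (\<lambda>n. (cmod (fourier_coeff f (int_decode n)))\<^sup>2)"
proof (rule summable_int_decode)
  show "(\<Sum>k\<in>{- int N..int N}. (cmod (fourier_coeff f k))\<^sup>2) \<le> L2_norm_sq f / (2 * pi)" for N
    using Bessel_inequality[OF assms, of N] by (simp add: field_simps)
qed simp

lemma L2_norm_sq_le_suminf:
  assumes "sq_int f"
  shows "L2_norm_sq f \<le> 2 * pi * (\<Sum>n. (cmod (fourier_coeff f (int_decode n)))\<^sup>2)"
proof (rule LIMSEQ_le_const2[OF Parseval[OF assms]])
  show "\<exists>N0. \<forall>N\<ge>N0. 2 * pi * (\<Sum>k\<in>{- int N..int N}. (cmod (fourier_coeff f k))\<^sup>2)
      \<le> 2 * pi * (\<Sum>n. (cmod (fourier_coeff f (int_decode n)))\<^sup>2)"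
    by (intro exI[of _ 0] allI impI mult_left_mono sum_symmetric_le_suminf
          summable_fourier_coeff_sq assms) auto
qed

lemma L2_norm_sq_zero_of_fourier_coeff:
  assumes "sq_int f" "\<And>k. fourier_coeff f k = 0"
  shows "L2_norm_sq f = 0"
  using L2_norm_sq_le_suminf[OF assms(1)] assms(2) L2_norm_sq_nonneg[of f] by simp

lemma norm_fourier_coeff_sq_le:
  assumes "sq_int f"
  shows "(cmod (fourier_coeff f k))\<^sup>2 \<le> L2_norm_sq f / (2 * pi)"
proof -
  have "(cmod (fourier_coeff f k))\<^sup>2 \<le> (\<Sum>k\<in>{- int (nat \<bar>k\<bar>)..int (nat \<bar>k\<bar>)}. (cmod (fourier_coeff f k))\<^sup>2)"
    by (rule member_le_sum) auto
  hence "2 * pi * (cmod (fourier_coeff f k))\<^sup>2 \<le>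
      2 * pi * (\<Sum>k\<in>{- int (nat \<bar>k\<bar>)..int (nat \<bar>k\<bar>)}. (cmod (fourier_coeff f k))\<^sup>2)"
    by (intro mult_left_mono) auto
  also have "\<dots> \<le> L2_norm_sq f" by (rule Bessel_inequality[OF assms])
  finally show ?thesis by (simp add: field_simps)
qed

text \<open>With absolutely summable coefficients the Fourier series converges uniformly, and
  integration term by term against a conjugate mode picks out one coefficient.\<close>

lemma fourier_synthesis:
  fixes b :: "int \<Rightarrow> complex"
  assumes "summable (\<lambda>n. cmod (b (int_decode n)))"
  obtains f where "f \<in> L2_torus" "\<And>k. fourier_coeff f k = b k"
proof
  define f where "f = (\<lambda>x. \<Sum>n. b (int_decode n) * fourier_mode (int_decode n) x)"
  have cont: "continuous_on {0..2 * pi} f"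
    unfolding f_def
    by (rule sums_integral_of_M_test(1)[OF _ _ assms]) (auto intro!: continuous_intros simp: norm_mult)
  show "f \<in> L2_torus"
    unfolding L2_torus_def torus_fun_def
    using sq_int_continuous[OF cont] by (simp add: f_def fourier_mode_periodic)
  fix k
  define g where "g = (\<lambda>n x. b (int_decode n) * fourier_mode (int_decode n) x * fourier_mode (- k) x)"
  have "(\<lambda>n. integral {0..2 * pi} (g n)) sums integral {0..2 * pi} (\<lambda>x. \<Sum>n. g n x)"
    by (rule sums_integral_of_M_test(2)[OF _ _ assms])
       (auto intro!: continuous_intros simp: norm_mult g_def)
  moreover have "integral {0..2 * pi} (g n) = (if n = int_encode k then of_real (2 * pi) * b k else 0)" for n
  proof -
    have "integral {0..2 * pi} (g n) = torus_integral (g n)"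
      unfolding g_def by (intro torus_integral_continuous[symmetric] continuous_intros)
    also have "\<dots> = b (int_decode n) * torus_integral (fourier_mode (int_decode n - k))"
      unfolding g_def torus_integral_def by (simp add: mult.assoc fourier_mode_mult)
    finally show ?thesis unfolding torus_integral_fourier_mode by auto
  qed
  moreover have "(\<Sum>n. g n x) = f x * fourier_mode (- k) x" for x
    unfolding g_def f_def
    by (intro suminf_mult2[symmetric] summable_comparison_test'[OF assms]) (simp add: norm_mult)
  ultimately have "(\<lambda>n. if n = int_encode k then of_real (2 * pi) * b k else 0) sums
      integral {0..2 * pi} (\<lambda>x. f x * fourier_mode (- k) x)"
    by simp
  hence "integral {0..2 * pi} (\<lambda>x. f x * fourier_mode (- k) x) = of_real (2 * pi) * b k"
    using sums_single[of "int_encode k" "\<lambda>_. of_real (2 * pi) * b k"] sums_unique2 by blast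
  moreover have "integral {0..2 * pi} (\<lambda>x. f x * fourier_mode (- k) x) =
      torus_integral (\<lambda>x. f x * fourier_mode (- k) x)"
    by (intro torus_integral_continuous[symmetric] continuous_intros cont)
  ultimately show "fourier_coeff f k = b k" by (simp add: fourier_coeff_def)
qed

section \<open>Test functions and their Fourier coefficients\<close>

lemma has_vector_derivative_D_x:
  assumes "\<psi> \<in> test_torus"
  shows "(\<psi> has_vector_derivative D_x \<psi> x) (at x)"
proof -
  have "((D_x ^^ 0) \<psi>) differentiable (at x)" using assms unfolding test_torus_def by blast
  thus ?thesis by (simp add: D_x_def vector_derivative_works)
qed

lemma continuous_on_test_torus: "\<psi> \<in> test_torus \<Longrightarrow> continuous_on S \<psi>"
  by (intro continuous_at_imp_continuous_on ballI has_vector_derivative_continuous[OF has_vector_derivative_D_x])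

lemma D_x_test_torus:
  assumes "\<psi> \<in> test_torus"
  shows "D_x \<psi> \<in> test_torus"
proof -
  have per: "\<psi> (x + 2 * pi) = \<psi> x" for x using assms by (simp add: test_torus_def torus_fun_def)
  have "D_x \<psi> (x + 2 * pi) = D_x \<psi> x" for x
  proof -
    have "((\<lambda>x. \<psi> (x + 2 * pi)) has_vector_derivative 1 *\<^sub>R D_x \<psi> (x + 2 * pi)) (at x)"
      by (rule vector_diff_chain_at[of "\<lambda>x. x + 2 * pi", unfolded o_def])
         (auto intro!: derivative_eq_intros has_vector_derivative_D_x assms)
    hence "(\<psi> has_vector_derivative D_x \<psi> (x + 2 * pi)) (at x)" using per by simp
    thus ?thesis unfolding D_x_def[of \<psi> x] by (simp add: vector_derivative_at)
  qed
  moreover have "(D_x ^^ k) (D_x \<psi>) differentiable (at x)" for k x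
  proof -
    have "(D_x ^^ Suc k) \<psi> differentiable (at x)" using assms unfolding test_torus_def by blast
    thus ?thesis by (simp only: funpow_Suc_right o_def)
  qed
  ultimately show ?thesis by (simp add: test_torus_def torus_fun_def)
qed

lemma sq_int_test_torus: "\<psi> \<in> test_torus \<Longrightarrow> sq_int \<psi>"
  by (intro sq_int_continuous continuous_on_test_torus)

text \<open>Integration by parts over one period, where the boundary terms cancel by
  periodicity.\<close>

lemma fourier_coeff_D_x:
  assumes "\<psi> \<in> test_torus"
  shows "fourier_coeff (D_x \<psi>) k = \<i> * of_int k * fourier_coeff \<psi> k"
proof -
  note cont = continuous_on_test_torus[OF assms] continuous_on_test_torus[OF D_x_test_torus[OF assms]]
  define I where "I = integral {0..2 * pi} (\<lambda>x. \<psi> x * fourier_mode (- k) x)"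
  have per: "\<psi> (2 * pi) = \<psi> 0" "fourier_mode (- k) (2 * pi) = fourier_mode (- k) 0"
    using assms fourier_mode_periodic[of "- k" 0] by (auto simp: test_torus_def torus_fun_def dest: spec[of _ 0])
  have "((\<lambda>x. D_x \<psi> x * fourier_mode (- k) x) has_integral \<i> * of_int k * I) {0..2 * pi}"
  proof (rule integration_by_parts[OF bounded_bilinear_mult])
    have "((\<lambda>x. (\<i> * of_int (- k)) * (\<psi> x * fourier_mode (- k) x)) has_integral (\<i> * of_int (- k)) * I) {0..2 * pi}"
      unfolding I_def
      by (intro has_integral_mult_right integrable_integral integrable_continuous_real continuous_intros cont)
    thus "((\<lambda>x. \<psi> x * (\<i> * of_int (- k) * fourier_mode (- k) x)) has_integral
        \<psi> (2 * pi) * fourier_mode (- k) (2 * pi) - \<psi> 0 * fourier_mode (- k) 0 - \<i> * of_int k * I) {0..2 * pi}"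
      unfolding per by (simp add: mult_ac)
  qed (use has_vector_derivative_D_x[OF assms] fourier_mode_has_vector_derivative[of "- k"] in
        \<open>auto intro!: continuous_intros cont\<close>)
  hence "torus_integral (\<lambda>x. D_x \<psi> x * fourier_mode (- k) x) = \<i> * of_int k * I"
    by (subst torus_integral_continuous) (auto intro!: continuous_intros cont integral_unique)
  moreover have "torus_integral (\<lambda>x. \<psi> x * fourier_mode (- k) x) = I"
    unfolding I_def by (intro torus_integral_continuous continuous_intros cont)
  ultimately show ?thesis by (simp add: fourier_coeff_def)
qed

lemma fourier_coeff_D_x_D_x:
  assumes "\<psi> \<in> test_torus"
  shows "fourier_coeff (D_x (D_x \<psi>)) k = - (of_int k)\<^sup>2 * fourier_coeff \<psi> k"
proof -
  have "fourier_coeff (D_x (D_x \<psi>)) k = (\<i> * of_int k)\<^sup>2 * fourier_coeff \<psi> k"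
    by (simp only: fourier_coeff_D_x D_x_test_torus assms power2_eq_square mult.assoc)
  thus ?thesis by (simp add: power_mult_distrib)
qed

lemma D_x_cmult_fourier_mode:
  "D_x (\<lambda>x. c * fourier_mode k x) = (\<lambda>x. (\<i> * of_int k * c) * fourier_mode k x)"
proof
  fix x
  have "((\<lambda>x. c * fourier_mode k x) has_vector_derivative c * (\<i> * of_int k * fourier_mode k x)) (at x)"
    by (intro has_vector_derivative_mult_right fourier_mode_has_vector_derivative)
  thus "D_x (\<lambda>x. c * fourier_mode k x) x = (\<i> * of_int k * c) * fourier_mode k x"
    unfolding D_x_def by (simp add: vector_derivative_at mult_ac)
qed

lemma fourier_mode_test_torus: "fourier_mode k \<in> test_torus"
proof -
  have "\<exists>c. (D_x ^^ n) (fourier_mode k) = (\<lambda>x. c * fourier_mode k x)" for n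
  proof (induction n)
    case 0
    show ?case by (auto intro!: exI[of _ 1])
  next
    case (Suc n)
    thus ?case using D_x_cmult_fourier_mode by fastforce
  qed
  moreover have "(\<lambda>x. c * fourier_mode k x) differentiable (at x)" for c x
    using has_vector_derivative_mult_right[OF fourier_mode_has_vector_derivative]
    by (blast intro: differentiableI_vector)
  ultimately have "(D_x ^^ n) (fourier_mode k) differentiable (at x)" for n x by metis
  thus ?thesis by (simp add: test_torus_def torus_fun_def fourier_mode_periodic)
qed

lemma distr_of_fourier_mode: "distr_of f (fourier_mode (- k)) = of_real (2 * pi) * fourier_coeff f k"
  by (simp add: distr_of_def fourier_coeff_def)

text \<open>Links the Lebesgue integrals over open intervals in \<open>heat_solution\<close> with
  the gauge integrals over closed intervals used for the calculus.\<close>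

lemma lebesgue_integral_open_interval:
  fixes f :: "real \<Rightarrow> 'b :: euclidean_space"
  assumes "continuous_on {a..b} f"
  shows "integrable (lebesgue_on {a<..<b}) f"
    and "integral\<^sup>L (lebesgue_on {a<..<b}) f = integral {a..b} f"
proof -
  have "f absolutely_integrable_on {a..b}" using assms by (rule absolutely_integrable_continuous_real)
  hence "f absolutely_integrable_on {a<..<b}" by (rule set_integrable_subset) auto
  thus i: "integrable (lebesgue_on {a<..<b}) f"
    by (subst integrable_restrict_space) (auto simp: set_integrable_def)
  show "integral\<^sup>L (lebesgue_on {a<..<b}) f = integral {a..b} f"
    unfolding integral_open_interval_real by (rule lebesgue_integral_eq_integral[OF i]) simp
qed

lemma square_integrable_open_interval:
  fixes f :: "real \<Rightarrow> complex"
  assumes "continuous_on {a..b} f"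
  shows "f square_integrable_on {a<..<b}"
  unfolding square_integrable_on_def
proof
  show "f \<in> borel_measurable (lebesgue_on {a<..<b})"
    using lebesgue_integral_open_interval(1)[OF assms] by auto
  show "integrable (lebesgue_on {a<..<b}) (\<lambda>x. (cmod (f x))\<^sup>2)"
    by (intro lebesgue_integral_open_interval(1) continuous_intros assms)
qed

section \<open>The scalar equation \<open>y' = - l * y + f\<close> and variation of
  constants\<close>

definition linear_ode_solution :: "real \<Rightarrow> complex \<Rightarrow> (real \<Rightarrow> complex) \<Rightarrow> real \<Rightarrow> complex" where
  "linear_ode_solution l a f t =
     of_real (exp (- l * t)) * (a + integral {0..t} (\<lambda>s. of_real (exp (l * s)) * f s))"

lemma linear_ode_solution_0 [simp]: "linear_ode_solution l a f 0 = a"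
  by (simp add: linear_ode_solution_def)

lemma continuous_on_linear_ode_solution:
  assumes "continuous_on {0..T} f"
  shows "continuous_on {0..T} (linear_ode_solution l a f)"
  unfolding linear_ode_solution_def
  by (intro continuous_intros indefinite_integral_continuous_1 integrable_continuous_real assms)

lemma linear_ode_solution_integral_eq:
  assumes f: "continuous_on {0..T} f" and t: "t \<in> {0..T}"
  shows "integral {0..t} (\<lambda>s. - of_real l * linear_ode_solution l a f s + f s) =
    linear_ode_solution l a f t - a"
proof -
  let ?F = "\<lambda>s. of_real (exp (l * s)) * f s"
  let ?y = "linear_ode_solution l a f"
  have F: "continuous_on {0..T} ?F" by (intro continuous_intros f)
  have "((\<lambda>s. - of_real l * ?y s + f s) has_integral ?y t - ?y 0) {0..t}"
  proof (rule fundamental_theorem_of_calculus)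
    fix s assume s: "s \<in> {0..t}"
    have "((\<lambda>u. integral {0..u} ?F) has_vector_derivative ?F s) (at s within {0..T})"
      using s t by (intro integral_has_vector_derivative F) auto
    moreover have "((\<lambda>u. complex_of_real (exp (- l * u))) has_vector_derivative of_real (- l * exp (- l * s))) (at s within {0..T})"
      by (intro has_vector_derivative_of_real)
         (auto intro!: derivative_eq_intros simp flip: has_real_derivative_iff_has_vector_derivative)
    moreover have "((\<lambda>u. a + integral {0..u} ?F) has_vector_derivative 0 + ?F s) (at s within {0..T})"
      by (intro has_vector_derivative_add has_vector_derivative_const calculation)
    ultimately have "(?y has_vector_derivative
        of_real (exp (- l * s)) * ?F s + of_real (- l * exp (- l * s)) * (a + integral {0..s} ?F)) (at s within {0..T})"
      unfolding linear_ode_solution_def[abs_def]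
      by (intro has_vector_derivative_mult) simp_all
    moreover have E: "of_real (exp (- l * s)) * ?F s = f s"
      by (simp add: mult.assoc[symmetric] flip: of_real_mult exp_add)
    have "of_real (exp (- l * s)) * ?F s + of_real (- l * exp (- l * s)) * (a + integral {0..s} ?F) =
        - of_real l * ?y s + f s"
      unfolding E linear_ode_solution_def by simp
    ultimately have "(?y has_vector_derivative - of_real l * ?y s + f s) (at s within {0..T})"
      by (simp only:)
    thus "(?y has_vector_derivative - of_real l * ?y s + f s) (at s within {0..t})"
      using t by (elim has_vector_derivative_within_subset) auto
  qed (use t in auto)
  thus ?thesis by (simp add: integral_unique)
qed

text \<open>The integral equation makes \<open>z\<close> differentiable; with the integrating factor
  \<open>exp (l * s)\<close> the derivative of the product is
  \<open>exp (l * s) * f s\<close>.\<close>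

lemma linear_ode_unique:
  fixes z f :: "real \<Rightarrow> complex"
  assumes "T > 0" and f: "continuous_on {0..T} f" and z: "continuous_on {0..T} z"
    and eq: "\<And>t. t \<in> {0..T} \<Longrightarrow> z t - z 0 = integral {0..t} (\<lambda>s. - of_real l * z s + f s)"
  shows "of_real (exp (l * T)) * z T = z 0 + integral {0..T} (\<lambda>s. of_real (exp (l * s)) * f s)"
proof -
  let ?g = "\<lambda>s. - of_real l * z s + f s"
  have g: "continuous_on {0..T} ?g" by (intro continuous_intros f z)
  have "((\<lambda>s. of_real (exp (l * s)) * f s) has_integral
      of_real (exp (l * T)) * z T - of_real (exp (l * 0)) * z 0) {0..T}"
  proof (rule fundamental_theorem_of_calculus)
    fix s assume s: "s \<in> {0..T}"
    have "((\<lambda>t. z 0 + integral {0..t} ?g) has_vector_derivative ?g s) (at s within {0..T})"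
      using has_vector_derivative_add[OF has_vector_derivative_const integral_has_vector_derivative[OF g s], of "z 0"]
      by simp
    hence "(z has_vector_derivative ?g s) (at s within {0..T})"
    proof (rule has_vector_derivative_transform[OF s, rotated])
      show "z t = z 0 + integral {0..t} ?g" if "t \<in> {0..T}" for t
        unfolding eq[OF that, symmetric] by simp
    qed
    moreover have "((\<lambda>u. complex_of_real (exp (l * u))) has_vector_derivative of_real (l * exp (l * s))) (at s within {0..T})"
      by (intro has_vector_derivative_of_real)
         (auto intro!: derivative_eq_intros simp flip: has_real_derivative_iff_has_vector_derivative)
    ultimately have "((\<lambda>s. of_real (exp (l * s)) * z s) has_vector_derivative
        of_real (exp (l * s)) * ?g s + of_real (l * exp (l * s)) * z s) (at s within {0..T})"
      by (intro has_vector_derivative_mult)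
    thus "((\<lambda>s. of_real (exp (l * s)) * z s) has_vector_derivative of_real (exp (l * s)) * f s) (at s within {0..T})"
      by (simp add: algebra_simps)
  qed (use assms in auto)
  thus ?thesis by (simp add: integral_unique)
qed

text \<open>The integral of \<open>exp (- l * (t - s))\<close> over \<open>s\<close> from
  \<open>0\<close> to \<open>t\<close> is at most \<open>1 / l\<close>. With \<open>l\<close> the
  square of the frequency, this gains two powers of the frequency, uniformly in time.\<close>

lemma norm_linear_ode_solution_diff_le:
  assumes f: "continuous_on {0..T} f" "\<And>s. s \<in> {0..T} \<Longrightarrow> cmod (f s) \<le> F"
    and "l > 0" and t: "t \<in> {0..T}"
  shows "cmod (linear_ode_solution l a f t - of_real (exp (- l * t)) * a) \<le> F / l"
proof -
  have F: "F \<ge> 0" using f(2)[OF t] norm_ge_zero order_trans by blast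
  have ft: "continuous_on {0..t} f" using f(1) t continuous_on_subset by fastforce
  have "((\<lambda>s. F * exp (l * s)) has_integral F * exp (l * t) / l - F * exp (l * 0) / l) {0..t}"
  proof (rule fundamental_theorem_of_calculus)
    fix s show "((\<lambda>s. F * exp (l * s) / l) has_vector_derivative F * exp (l * s)) (at s within {0..t})"
      using \<open>l > 0\<close>
      by (auto intro!: derivative_eq_intros simp flip: has_real_derivative_iff_has_vector_derivative)
  qed (use t in auto)
  hence "integral {0..t} (\<lambda>s. F * exp (l * s)) = F * exp (l * t) / l - F * exp (l * 0) / l"
    by (rule integral_unique)
  also have "\<dots> = F * (exp (l * t) - 1) / l"
    by (simp add: right_diff_distrib diff_divide_distrib)
  finally have int: "integral {0..t} (\<lambda>s. F * exp (l * s)) = F * (exp (l * t) - 1) / l" .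
  have "cmod (integral {0..t} (\<lambda>s. of_real (exp (l * s)) * f s)) \<le> integral {0..t} (\<lambda>s. F * exp (l * s))"
  proof (rule Henstock_Kurzweil_Integration.integral_norm_bound_integral)
    show "cmod (of_real (exp (l * s)) * f s) \<le> F * exp (l * s)" if "s \<in> {0..t}" for s
      using f(2)[of s] that t by (simp add: norm_mult mult.commute)
  qed (intro integrable_continuous_real continuous_intros ft)+
  also have "\<dots> \<le> F * exp (l * t) / l"
    unfolding int using F \<open>l > 0\<close> by (intro divide_right_mono mult_left_mono) auto
  finally have "exp (- l * t) * cmod (integral {0..t} (\<lambda>s. of_real (exp (l * s)) * f s)) \<le>
      exp (- l * t) * (F * exp (l * t) / l)" by (intro mult_left_mono) auto
  also have "\<dots> = F / l" by (simp add: exp_minus field_simps)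
  finally show ?thesis by (simp add: linear_ode_solution_def ring_distribs norm_mult)
qed

section \<open>Solutions of the controlled heat equation\<close>

lemma H1_norm_sq_eq_suminf:
  "H1_norm_sq f = (\<Sum>n. ennreal ((1 + (real_of_int (int_decode n))\<^sup>2) * (cmod (fourier_coeff f (int_decode n)))\<^sup>2))"
  unfolding H1_norm_sq_def nn_integral_bij_count_space[OF bij_int_decode, symmetric]
  by (rule nn_integral_count_space_nat)

text \<open>The forward problem for fixed continuous controls, kept apart from their choice.\<close>

locale controlled_heat =
  fixes c1 c2 :: "nat \<Rightarrow> complex" and \<phi>1 \<phi>2 :: distr and \<beta> C T :: real
    and u0 v1 v2 :: "real \<Rightarrow> complex"
  assumes phi1: "(\<lambda>n x. c1 (Suc n) * fourier_mode (int (Suc n)) x) distr_sums \<phi>1"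
    and phi2: "(\<lambda>n x. c2 (Suc n) * fourier_mode (- int (Suc n)) x) distr_sums \<phi>2"
    and beta: "\<beta> < 1 / 2" and C: "C > 0"
    and c1: "\<And>n. n \<ge> 1 \<Longrightarrow> cmod (c1 n) \<le> C * real n powr \<beta>"
    and c2: "\<And>n. n \<ge> 1 \<Longrightarrow> cmod (c2 n) \<le> C * real n powr \<beta>"
    and T: "T > 0" and u0: "u0 \<in> L2_torus" and mean: "torus_integral u0 = 0"
    and v1: "continuous_on {0..T} v1" and v2: "continuous_on {0..T} v2"
begin

text \<open>The Fourier modes of the right-hand side. Neither profile contains the constant mode, so
  the mean cannot be influenced; hence the zero-mean condition on the datum.\<close>

definition force :: "int \<Rightarrow> real \<Rightarrow> complex" where
  "force k s = (if k > 0 then c1 (nat k) * v1 s else if k < 0 then c2 (nat (- k)) * v2 s else 0)"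

definition mode_at :: "int \<Rightarrow> real \<Rightarrow> complex" where
  "mode_at k = linear_ode_solution ((of_int k)\<^sup>2) (fourier_coeff u0 k) (force k)"

definition vmax :: real where
  "vmax = (SOME V. \<forall>s\<in>{0..T}. cmod (v1 s) \<le> V \<and> cmod (v2 s) \<le> V)"

text \<open>The bound \<open>F / l\<close> on the forced part of a mode, with \<open>F\<close> the
  bound on its force and \<open>l\<close> the square of \<open>k\<close>. At \<open>k = 0\<close> it
  is zero because \<open>0 powr (\<beta> - 2) = 0\<close>.\<close>

definition modulus :: "int \<Rightarrow> real" where
  "modulus k = C * vmax * \<bar>of_int k\<bar> powr (\<beta> - 2)"

section \<open>Bounds on the modes of the solution\<close>

lemma vmax: "s \<in> {0..T} \<Longrightarrow> cmod (v1 s) \<le> vmax" "s \<in> {0..T} \<Longrightarrow> cmod (v2 s) \<le> vmax"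
proof -
  obtain V1 V2 where V: "\<And>s. s \<in> {0..T} \<Longrightarrow> cmod (v1 s) \<le> V1" "\<And>s. s \<in> {0..T} \<Longrightarrow> cmod (v2 s) \<le> V2"
    using compact_imp_bounded[OF compact_continuous_image[OF v1 compact_Icc]]
      compact_imp_bounded[OF compact_continuous_image[OF v2 compact_Icc]]
    unfolding bounded_iff by (metis imageI)
  have "\<forall>s\<in>{0..T}. cmod (v1 s) \<le> vmax \<and> cmod (v2 s) \<le> vmax"
    unfolding vmax_def by (rule someI[of _ "max V1 V2"]) (use V in \<open>auto simp: le_max_iff_disj\<close>)
  thus "s \<in> {0..T} \<Longrightarrow> cmod (v1 s) \<le> vmax" "s \<in> {0..T} \<Longrightarrow> cmod (v2 s) \<le> vmax" by auto
qed

lemma vmax_nonneg: "vmax \<ge> 0"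
  using order_trans[OF norm_ge_zero vmax(1)[of 0]] T by simp

lemma modulus_nonneg: "modulus k \<ge> 0"
  using C vmax_nonneg by (simp add: modulus_def)

lemma u0_sq_int: "sq_int u0"
  using u0 by (simp add: L2_torus_def)

lemma fourier_coeff_u0_0 [simp]: "fourier_coeff u0 0 = 0"
  using mean by (simp add: fourier_coeff_def)

lemma continuous_on_force: "continuous_on {0..T} (force k)"
  unfolding force_def[abs_def] using v1 v2
  by (cases k "0::int" rule: linorder_cases) (auto intro!: continuous_intros)

lemma continuous_on_mode_at: "continuous_on {0..T} (mode_at k)"
  unfolding mode_at_def by (rule continuous_on_linear_ode_solution[OF continuous_on_force])

lemma norm_force_le:
  assumes "s \<in> {0..T}"
  shows "cmod (force k s) \<le> C * \<bar>of_int k\<bar> powr \<beta> * vmax"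
proof -
  consider "k > 0" | "k < 0" | "k = 0" by linarith
  thus ?thesis
  proof cases
    case 1
    thus ?thesis using c1[of "nat k"] vmax(1)[OF assms] C
      by (auto simp: force_def norm_mult intro!: mult_mono)
  next
    case 2
    thus ?thesis using c2[of "nat (- k)"] vmax(2)[OF assms] C
      by (auto simp: force_def norm_mult intro!: mult_mono)
  qed (simp add: force_def)
qed

lemma norm_mode_at_diff_le:
  assumes t: "t \<in> {0..T}"
  shows "cmod (mode_at k t - of_real (exp (- (of_int k)\<^sup>2 * t)) * fourier_coeff u0 k) \<le> modulus k"
proof (cases "k = 0")
  case True
  have "force 0 = (\<lambda>_. 0)" by (simp add: force_def fun_eq_iff)
  thus ?thesis using True modulus_nonneg[of k] by (simp add: mode_at_def linear_ode_solution_def)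
next
  case False
  have "cmod (mode_at k t - of_real (exp (- (of_int k)\<^sup>2 * t)) * fourier_coeff u0 k) \<le>
      C * \<bar>of_int k\<bar> powr \<beta> * vmax / (of_int k)\<^sup>2"
    unfolding mode_at_def
    by (rule norm_linear_ode_solution_diff_le[OF continuous_on_force norm_force_le _ t]) (use False in auto)
  also have "\<dots> = modulus k"
    using False by (simp add: modulus_def powr_diff powr_numeral)
  finally show ?thesis .
qed

lemma norm_mode_at_le:
  assumes t: "t \<in> {0..T}"
  shows "cmod (mode_at k t) \<le> exp (- (of_int k)\<^sup>2 * t) * cmod (fourier_coeff u0 k) + modulus k"
  using norm_mode_at_diff_le[OF t, of k]
    norm_triangle_ineq2[of "mode_at k t" "of_real (exp (- (of_int k)\<^sup>2 * t)) * fourier_coeff u0 k"]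
  by (simp add: norm_mult)

text \<open>The exponential factor is kept for the estimate in the Sobolev norm;
  \<open>mode_bound\<close> drops it where uniformity in time suffices.\<close>

lemma norm_mode_at_sq_le:
  assumes t: "t \<in> {0..T}"
  shows "(cmod (mode_at k t))\<^sup>2 \<le>
    2 * exp (- 2 * (of_int k)\<^sup>2 * t) * (cmod (fourier_coeff u0 k))\<^sup>2 + 2 * (modulus k)\<^sup>2"
proof -
  define p where "p = exp (- (of_int k)\<^sup>2 * t) * cmod (fourier_coeff u0 k)"
  have "(cmod (mode_at k t))\<^sup>2 \<le> (p + modulus k)\<^sup>2"
    using norm_mode_at_le[OF t, of k] by (intro power_mono) (auto simp: p_def)
  also have "\<dots> \<le> 2 * p\<^sup>2 + 2 * (modulus k)\<^sup>2"
    using sum_squares_bound[of p "modulus k"] by (simp add: power2_sum)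
  also have "p\<^sup>2 = exp (- 2 * (of_int k)\<^sup>2 * t) * (cmod (fourier_coeff u0 k))\<^sup>2"
    by (simp add: p_def power_mult_distrib flip: exp_double)
  finally show ?thesis by simp
qed

definition mode_bound :: "int \<Rightarrow> real" where
  "mode_bound k = 2 * (cmod (fourier_coeff u0 k))\<^sup>2 + 2 * (modulus k)\<^sup>2"

lemma norm_mode_at_sq_le_bound:
  assumes t: "t \<in> {0..T}"
  shows "(cmod (mode_at k t))\<^sup>2 \<le> mode_bound k"
proof -
  have "exp (- 2 * (of_int k)\<^sup>2 * t) \<le> 1" using t by simp
  hence "exp (- 2 * (of_int k)\<^sup>2 * t) * (cmod (fourier_coeff u0 k))\<^sup>2 \<le> 1 * (cmod (fourier_coeff u0 k))\<^sup>2"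
    by (intro mult_right_mono) auto
  thus ?thesis using norm_mode_at_sq_le[OF t, of k] by (simp add: mode_bound_def)
qed

lemma summable_modulus: "summable (\<lambda>n. modulus (int_decode n))"
  unfolding modulus_def by (intro summable_mult summable_int_powr) (use beta in simp)

text \<open>The summands have the size of \<open>\<bar>k\<bar> powr (2 * \<beta> - 2)\<close>, and
  this exponent is below -1 precisely for \<open>\<beta> < 1 / 2\<close>.\<close>

lemma summable_weighted_modulus:
  "summable (\<lambda>n. (1 + (of_int (int_decode n))\<^sup>2) * (modulus (int_decode n))\<^sup>2)"
proof (rule summable_comparison_test')
  show "summable (\<lambda>n. 2 * (C * vmax)\<^sup>2 * \<bar>real_of_int (int_decode n)\<bar> powr (2 * \<beta> - 2))"
    by (intro summable_mult summable_int_powr) (use beta in simp)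
  show "norm ((1 + (of_int (int_decode n))\<^sup>2) * (modulus (int_decode n))\<^sup>2) \<le>
      2 * (C * vmax)\<^sup>2 * \<bar>real_of_int (int_decode n)\<bar> powr (2 * \<beta> - 2)" for n
  proof (cases "int_decode n = 0")
    case False
    define x where "x = \<bar>real_of_int (int_decode n)\<bar>"
    have x: "x \<ge> 1" using False by (simp add: x_def)
    have sq: "(of_int (int_decode n))\<^sup>2 = x\<^sup>2" by (simp add: x_def)
    have "(modulus (int_decode n))\<^sup>2 = (C * vmax)\<^sup>2 * x powr (2 * (\<beta> - 2))"
      by (simp add: modulus_def x_def[symmetric] power_mult_distrib power2_eq_square[of "x powr (\<beta> - 2)"]
            flip: powr_add)
    moreover have "(1 + x\<^sup>2) * x powr (2 * (\<beta> - 2)) \<le> 2 * x powr (2 * \<beta> - 2)"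
    proof -
      have "(1 + x\<^sup>2) * x powr (2 * (\<beta> - 2)) \<le> (2 * x\<^sup>2) * x powr (2 * (\<beta> - 2))"
        using x by (intro mult_right_mono) auto
      also have "\<dots> = 2 * (x powr 2 * x powr (2 * (\<beta> - 2)))" using x by simp
      also have "x powr 2 * x powr (2 * (\<beta> - 2)) = x powr (2 * \<beta> - 2)"
        unfolding powr_add[symmetric] by (rule arg_cong[of _ _ "(powr) x"]) simp
      finally show ?thesis .
    qed
    hence "(C * vmax)\<^sup>2 * ((1 + x\<^sup>2) * x powr (2 * (\<beta> - 2))) \<le> (C * vmax)\<^sup>2 * (2 * x powr (2 * \<beta> - 2))"
      by (rule mult_left_mono) simp
    ultimately show ?thesis unfolding sq x_def[symmetric] by (simp add: mult_ac)
  qed (simp add: modulus_def)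
qed

lemma summable_mode_bound: "summable (\<lambda>n. mode_bound (int_decode n))"
proof -
  have "summable (\<lambda>n. (modulus (int_decode n))\<^sup>2)"
    by (rule summable_comparison_test'[OF summable_weighted_modulus]) (simp add: mult_right_mono ring_distribs)
  thus ?thesis unfolding mode_bound_def
    by (intro summable_add summable_mult summable_fourier_coeff_sq u0_sq_int)
qed

lemma mode_bound_nonneg: "mode_bound k \<ge> 0"
  by (simp add: mode_bound_def)

text \<open>Smoothing by the heat flow: \<open>exp (- k^2 * t) \<le> 1 / (k^2 * t)\<close> for
  nonzero \<open>k\<close> and positive \<open>t\<close>. Absolute summability is what
  \<open>fourier_synthesis\<close> asks for.\<close>

lemma summable_norm_mode_at:
  assumes "0 < t" "t \<le> T"
  shows "summable (\<lambda>n. cmod (mode_at (int_decode n) t))"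
proof (rule summable_comparison_test')
  define A where "A = sqrt (L2_norm_sq u0 / (2 * pi))"
  show "summable (\<lambda>n. A / t * \<bar>real_of_int (int_decode n)\<bar> powr (- 2) + modulus (int_decode n))"
    by (intro summable_add summable_mult summable_int_powr summable_modulus) simp
  show "norm (cmod (mode_at (int_decode n) t)) \<le>
      A / t * \<bar>real_of_int (int_decode n)\<bar> powr (- 2) + modulus (int_decode n)" for n
  proof -
    define k where "k = int_decode n"
    have "exp (- (of_int k)\<^sup>2 * t) * cmod (fourier_coeff u0 k) \<le> A / t * \<bar>real_of_int k\<bar> powr (- 2)"
    proof (cases "k = 0")
      case False
      have A: "cmod (fourier_coeff u0 k) \<le> A"
        unfolding A_def using norm_fourier_coeff_sq_le[OF u0_sq_int] by (intro real_le_rsqrt)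
      have pos: "(of_int k)\<^sup>2 * t > 0" using False assms by simp
      have "exp (- ((of_int k)\<^sup>2 * t)) \<le> 1 / ((of_int k)\<^sup>2 * t)"
      proof -
        have "(of_int k)\<^sup>2 * t \<le> exp ((of_int k)\<^sup>2 * t)"
          using exp_ge_add_one_self[of "(of_int k)\<^sup>2 * t"] by linarith
        thus ?thesis using pos by (simp add: exp_minus divide_simps)
      qed
      hence "exp (- ((of_int k)\<^sup>2 * t)) * cmod (fourier_coeff u0 k) \<le> 1 / ((of_int k)\<^sup>2 * t) * A"
        using A pos by (intro mult_mono) auto
      thus ?thesis by (simp add: powr_minus powr_numeral divide_simps mult_ac)
    qed simp
    thus ?thesis using norm_mode_at_le[of t k] assms by (simp add: k_def)
  qed
qed

text \<open>
  At time \<open>0\<close> the modes of the datum need not be absolutely summable, and the datum itself is taken.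
\<close>

lemma trajectory_exists:
  obtains u where "u 0 = u0" "\<And>t. t \<in> {0..T} \<Longrightarrow> u t \<in> L2_torus"
    "\<And>t k. t \<in> {0..T} \<Longrightarrow> fourier_coeff (u t) k = mode_at k t"
proof -
  have "\<forall>t\<in>{0<..T}. \<exists>f. f \<in> L2_torus \<and> (\<forall>k. fourier_coeff f k = mode_at k t)"
    using fourier_synthesis[OF summable_norm_mode_at] by (metis greaterThanAtMost_iff)
  then obtain U where U: "\<forall>t\<in>{0<..T}. U t \<in> L2_torus \<and> (\<forall>k. fourier_coeff (U t) k = mode_at k t)"
    by metis
  show thesis
    by (rule that[of "\<lambda>t. if t = 0 then u0 else U t"]) (use U u0 in \<open>auto simp: mode_at_def\<close>)
qed

text \<open>For nonzero \<open>k\<close> the weight \<open>1 + k^2\<close> is at most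
  \<open>l = 2 * k^2\<close>, and the integral of \<open>l * exp (- l * t)\<close> over all positive
  times is at most 1; hence the free part costs no derivative of the datum.\<close>

lemma nn_integral_mode_at_le:
  "(\<integral>\<^sup>+ t. ennreal ((1 + (real_of_int k)\<^sup>2) * (cmod (mode_at k t))\<^sup>2) \<partial>lebesgue_on {0<..<T}) \<le>
    ennreal (2 * (cmod (fourier_coeff u0 k))\<^sup>2 + 2 * T * ((1 + (real_of_int k)\<^sup>2) * (modulus k)\<^sup>2))"
proof -
  define A where "A = (cmod (fourier_coeff u0 k))\<^sup>2"
  define l where "l = 2 * (real_of_int k)\<^sup>2"
  define m where "m = 2 * ((1 + (real_of_int k)\<^sup>2) * (modulus k)\<^sup>2)"
  define g where "g = (\<lambda>t. 2 * A * (l * exp (- l * t)) + m)"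
  have nonneg: "A \<ge> 0" "l \<ge> 0" "m \<ge> 0" by (auto simp: A_def l_def m_def)
  have le: "(1 + (real_of_int k)\<^sup>2) * (cmod (mode_at k t))\<^sup>2 \<le> g t" if t: "t \<in> {0..T}" for t
  proof -
    have "(1 + (real_of_int k)\<^sup>2) * (cmod (mode_at k t))\<^sup>2 \<le>
        (1 + (real_of_int k)\<^sup>2) * (2 * exp (- l * t) * A + 2 * (modulus k)\<^sup>2)"
      using norm_mode_at_sq_le[OF t, of k] by (intro mult_left_mono) (auto simp: l_def A_def)
    also have "\<dots> = 2 * ((1 + (real_of_int k)\<^sup>2) * A * exp (- l * t)) + m"
      by (simp add: m_def algebra_simps)
    also have "\<dots> \<le> 2 * (l * A * exp (- l * t)) + m"
    proof -
      have "(1 + (real_of_int k)\<^sup>2) * A \<le> l * A"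
      \<comment> \<open>For \<open>k = 0\<close> both sides vanish, since the datum has zero
        mean.\<close>
      proof (cases "k = 0")
        case False
        hence "1 \<le> (real_of_int k)\<^sup>2" using one_le_power[of "\<bar>real_of_int k\<bar>" 2] by simp
        thus ?thesis using nonneg by (intro mult_right_mono) (auto simp: l_def)
      qed (simp add: A_def)
      thus ?thesis by (simp add: mult_right_mono)
    qed
    finally show ?thesis by (simp add: g_def mult_ac)
  qed
  have cont: "continuous_on {0..T} g" unfolding g_def by (intro continuous_intros)
  have "(g has_integral (- 2 * A * exp (- l * T) + m * T) - (- 2 * A * exp (- l * 0) + m * 0)) {0..T}"
  proof (rule fundamental_theorem_of_calculus)
    show "((\<lambda>t. - 2 * A * exp (- l * t) + m * t) has_vector_derivative g t) (at t within {0..T})" for t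
      unfolding g_def
      by (auto intro!: derivative_eq_intros simp flip: has_real_derivative_iff_has_vector_derivative)
  qed (use T in simp)
  hence "integral {0..T} g = 2 * A * (1 - exp (- l * T)) + m * T"
    by (simp add: integral_unique algebra_simps)
  also have "\<dots> \<le> 2 * A * 1 + m * T" using nonneg by (intro add_right_mono mult_left_mono) auto
  finally have int: "integral {0..T} g \<le> 2 * A + m * T" by simp
  have "(\<integral>\<^sup>+ t. ennreal ((1 + (real_of_int k)\<^sup>2) * (cmod (mode_at k t))\<^sup>2) \<partial>lebesgue_on {0<..<T}) \<le>
      (\<integral>\<^sup>+ t. ennreal (g t) \<partial>lebesgue_on {0<..<T})"
    using le by (intro nn_integral_mono) (auto intro!: ennreal_leI)
  also have "\<dots> = ennreal (integral\<^sup>L (lebesgue_on {0<..<T}) g)"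
    by (intro nn_integral_eq_integral lebesgue_integral_open_interval cont AE_I2)
       (use nonneg in \<open>auto simp: g_def\<close>)
  also have "\<dots> \<le> ennreal (2 * A + m * T)"
    using int lebesgue_integral_open_interval(2)[OF cont] by (intro ennreal_leI) simp
  finally show ?thesis by (simp add: A_def m_def mult_ac)
qed

section \<open>Regularity of a trajectory with the prescribed modes\<close>

context
  fixes u :: "real \<Rightarrow> real \<Rightarrow> complex"
  assumes u_0: "u 0 = u0" and u_L2: "\<And>t. t \<in> {0..T} \<Longrightarrow> u t \<in> L2_torus"
    and u_coeff: "\<And>t k. t \<in> {0..T} \<Longrightarrow> fourier_coeff (u t) k = mode_at k t"
begin

lemma u_sq_int: "t \<in> {0..T} \<Longrightarrow> sq_int (u t)"
  using u_L2 by (simp add: L2_torus_def)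

text \<open>By the Parseval identity, the squared distance of two states is at most a series of
  continuous functions of time, uniformly convergent thanks to \<open>mode_bound\<close> and zero at
  \<open>s = t\<close>.\<close>

lemma trajectory_C0_L2: "C0_L2 T u"
  unfolding C0_L2_def
proof (intro conjI ballI)
  fix t assume t: "t \<in> {0..T}"
  define D where "D = (\<lambda>s. \<Sum>n. (cmod (mode_at (int_decode n) s - mode_at (int_decode n) t))\<^sup>2)"
  have bound: "norm ((cmod (mode_at k s - mode_at k t))\<^sup>2) \<le> 4 * mode_bound k"
    if "s \<in> {0..T}" for s k
    using norm_add_sq_le[of "mode_at k s" "- mode_at k t"] norm_mode_at_sq_le_bound[OF that, of k]
      norm_mode_at_sq_le_bound[OF t, of k] by simp
  have "uniform_limit {0..T} (\<lambda>N s. \<Sum>n<N. (cmod (mode_at (int_decode n) s - mode_at (int_decode n) t))\<^sup>2) D sequentially"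
    unfolding D_def
    by (rule Weierstrass_m_test[OF bound]) (auto intro: summable_mult summable_mode_bound)
  moreover have "\<forall>\<^sub>F N in sequentially. continuous_on {0..T}
      (\<lambda>s. \<Sum>n<N. (cmod (mode_at (int_decode n) s - mode_at (int_decode n) t))\<^sup>2)"
    by (intro always_eventually allI continuous_intros continuous_on_mode_at)
  ultimately have "continuous_on {0..T} D" by (intro uniform_limit_theorem) auto
  moreover have "D t = 0" by (simp add: D_def)
  ultimately have "(D \<longlongrightarrow> 0) (at t within {0..T})" using t unfolding continuous_on_def by fastforce
  hence lim: "((\<lambda>s. sqrt (2 * pi * D s)) \<longlongrightarrow> 0) (at t within {0..T})"
    by (auto intro!: tendsto_eq_intros)
  have le: "L2_norm_torus (\<lambda>x. u s x - u t x) \<le> sqrt (2 * pi * D s)" if s: "s \<in> {0..T}" for s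
    unfolding L2_norm_torus_eq D_def
    using L2_norm_sq_le_suminf[OF sq_int_diff[OF u_sq_int[OF s] u_sq_int[OF t]]]
    by (intro real_sqrt_le_mono)
      (simp only: fourier_coeff_diff[OF u_sq_int[OF s] u_sq_int[OF t]] u_coeff[OF s] u_coeff[OF t])
  show "((\<lambda>s. L2_norm_torus (\<lambda>x. u s x - u t x)) \<longlongrightarrow> 0) (at t within {0..T})"
  proof (rule tendsto_sandwich[OF _ _ tendsto_const lim])
    show "\<forall>\<^sub>F s in at t within {0..T}. 0 \<le> L2_norm_torus (\<lambda>x. u s x - u t x)"
      by (simp add: L2_norm_torus_eq)
    show "\<forall>\<^sub>F s in at t within {0..T}. L2_norm_torus (\<lambda>x. u s x - u t x) \<le> sqrt (2 * pi * D s)"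
      unfolding eventually_at_filter using le by (auto intro: always_eventually)
  qed
qed (rule u_L2)

text \<open>All terms are nonnegative, so sum and time integral may be exchanged and the modes
  estimated one by one.\<close>

lemma trajectory_L2_H1: "L2_H1 T u"
proof -
  define h where "h = (\<lambda>n t. ennreal ((1 + (real_of_int (int_decode n))\<^sup>2) * (cmod (mode_at (int_decode n) t))\<^sup>2))"
  define B where "B = (\<lambda>k. 2 * (cmod (fourier_coeff u0 k))\<^sup>2 + 2 * T * ((1 + (real_of_int k)\<^sup>2) * (modulus k)\<^sup>2))"
  have meas: "h n \<in> borel_measurable (lebesgue_on {0<..<T})" for n
    unfolding h_def
    by (intro measurable_compose[OF _ measurable_ennreal] continuous_imp_measurable_on_sets_lebesgue
          continuous_intros continuous_on_subset[OF continuous_on_mode_at]) auto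
  have "(\<integral>\<^sup>+ t. H1_norm_sq (u t) \<partial>lebesgue_on {0<..<T}) = (\<integral>\<^sup>+ t. (\<Sum>n. h n t) \<partial>lebesgue_on {0<..<T})"
    by (intro nn_integral_cong) (auto simp: H1_norm_sq_eq_suminf h_def u_coeff)
  also have "\<dots> = (\<Sum>n. \<integral>\<^sup>+ t. h n t \<partial>lebesgue_on {0<..<T})"
    by (rule nn_integral_suminf[OF meas])
  also have "\<dots> \<le> (\<Sum>n. ennreal (B (int_decode n)))"
    unfolding h_def B_def by (intro suminf_le nn_integral_mode_at_le) auto
  also have "\<dots> < \<infinity>"
    unfolding infinity_ennreal_def less_top[symmetric]
  proof (rule ennreal_suminf_neq_top)
    show "summable (\<lambda>n. B (int_decode n))"
      unfolding B_def
      by (intro summable_add summable_mult summable_fourier_coeff_sq u0_sq_int summable_weighted_modulus)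
    show "0 \<le> B (int_decode n)" for n using T by (simp add: B_def)
  qed
  finally show ?thesis by (simp add: L2_H1_def)
qed

end

section \<open>The weak equation: existence of a solution and its modes\<close>

lemma distr_of_mode_mult: "distr_of (\<lambda>x. a * fourier_mode k x) \<psi> = a * (of_real (2 * pi) * fourier_coeff \<psi> (- k))"
  by (simp add: distr_of_def fourier_coeff_def torus_integral_def mult_ac)

lemma phi1_sums:
  "\<psi> \<in> test_torus \<Longrightarrow> (\<lambda>n. c1 (Suc n) * (of_real (2 * pi) * fourier_coeff \<psi> (- int (Suc n)))) sums \<phi>1 \<psi>"
  using phi1 unfolding distr_sums_def distr_of_mode_mult by blast

lemma phi2_sums:
  "\<psi> \<in> test_torus \<Longrightarrow> (\<lambda>n. c2 (Suc n) * (of_real (2 * pi) * fourier_coeff \<psi> (int (Suc n)))) sums \<phi>2 \<psi>"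
  using phi2 unfolding distr_sums_def distr_of_mode_mult minus_minus by blast

text \<open>A symmetric partial sum over the force collects equally long partial sums of the two
  profile series; \<open>\<phi>1\<close> meets the negative coefficients of the test function
  because the bracket is bilinear.\<close>

lemma sum_force:
  "of_real (2 * pi) * (\<Sum>k\<in>{- int N..int N}. force k s * fourier_coeff \<psi> (- k)) =
    v1 s * (\<Sum>n<N. c1 (Suc n) * (of_real (2 * pi) * fourier_coeff \<psi> (- int (Suc n)))) +
    v2 s * (\<Sum>n<N. c2 (Suc n) * (of_real (2 * pi) * fourier_coeff \<psi> (int (Suc n))))"
proof -
  have "force (int (Suc n)) s = c1 (Suc n) * v1 s" "force (- int (Suc n)) s = c2 (Suc n) * v2 s" for n
    by (simp_all add: force_def nat_add_distrib del: of_nat_Suc)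
  thus ?thesis
    unfolding sum_symmetric_interval
    by (simp add: force_def[of 0] sum.distrib sum_distrib_left ring_distribs mult_ac del: of_nat_Suc)
qed

text \<open>Tested with a single mode, the partial sums of the profiles are eventually
  constant.\<close>

lemma phi_fourier_mode:
  "v1 s * \<phi>1 (fourier_mode (- k)) + v2 s * \<phi>2 (fourier_mode (- k)) = of_real (2 * pi) * force k s"
proof -
  let ?\<psi> = "fourier_mode (- k)"
  have lim: "(\<lambda>N. v1 s * (\<Sum>n<N. c1 (Suc n) * (of_real (2 * pi) * fourier_coeff ?\<psi> (- int (Suc n)))) +
      v2 s * (\<Sum>n<N. c2 (Suc n) * (of_real (2 * pi) * fourier_coeff ?\<psi> (int (Suc n)))))
    \<longlonglongrightarrow> v1 s * \<phi>1 ?\<psi> + v2 s * \<phi>2 ?\<psi>"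
    using phi1_sums[OF fourier_mode_test_torus] phi2_sums[OF fourier_mode_test_torus]
    unfolding sums_def by (intro tendsto_intros)
  have ev: "\<forall>\<^sub>F N in sequentially.
      of_real (2 * pi) * (\<Sum>j\<in>{- int N..int N}. force j s * fourier_coeff ?\<psi> (- j)) = of_real (2 * pi) * force k s"
  proof -
    have "(\<Sum>j\<in>{- int N..int N}. force j s * fourier_coeff ?\<psi> (- j)) = force k s" if "N \<ge> nat \<bar>k\<bar>" for N
    proof -
      have "(\<Sum>j\<in>{- int N..int N}. force j s * fourier_coeff ?\<psi> (- j)) =
          (\<Sum>j\<in>{- int N..int N}. if j = k then force j s else 0)"
        by (intro sum.cong) (auto simp: fourier_coeff_mode)
      thus ?thesis using that by (simp add: abs_le_iff nat_le_iff)
    qed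
    thus ?thesis unfolding eventually_sequentially by (metis (no_types, lifting))
  qed
  show ?thesis
    using lim unfolding sum_force[symmetric] by (rule LIMSEQ_unique[OF _ tendsto_eventually[OF ev]])
qed

end

context controlled_heat
begin

text \<open>Every mode satisfies its scalar equation, so the identity holds exactly for the
  truncations \<open>P N\<close> and \<open>Q N\<close>; dominated convergence removes the
  truncation.\<close>

lemma trajectory_weak_equation:
  assumes u_L2: "\<And>t. t \<in> {0..T} \<Longrightarrow> u t \<in> L2_torus"
    and u_coeff: "\<And>t k. t \<in> {0..T} \<Longrightarrow> fourier_coeff (u t) k = mode_at k t"
    and \<psi>: "\<psi> \<in> test_torus" and t: "t \<in> {0..T}"
  shows "distr_of (u t) \<psi> - distr_of (u 0) \<psi> = integral\<^sup>L (lebesgue_on {0<..<t})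
    (\<lambda>s. distr_of (u s) (D_x (D_x \<psi>)) + v1 s * \<phi>1 \<psi> + v2 s * \<phi>2 \<psi>)"
proof -
  define \<eta> where "\<eta> = D_x (D_x \<psi>)"
  define S1 where "S1 = (\<lambda>N. \<Sum>n<N. c1 (Suc n) * (of_real (2 * pi) * fourier_coeff \<psi> (- int (Suc n))))"
  define S2 where "S2 = (\<lambda>N. \<Sum>n<N. c2 (Suc n) * (of_real (2 * pi) * fourier_coeff \<psi> (int (Suc n))))"
  define P where "P = (\<lambda>N s. of_real (2 * pi) * (\<Sum>k\<in>{- int N..int N}. mode_at k s * fourier_coeff \<psi> (- k)))"
  define R where "R = (\<lambda>N s. of_real (2 * pi) * (\<Sum>k\<in>{- int N..int N}. mode_at k s * fourier_coeff \<eta> (- k)))"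
  define Q where "Q = (\<lambda>N s. R N s + v1 s * S1 N + v2 s * S2 N)"
  have sq: "sq_int (u s)" if "s \<in> {0..T}" for s using u_L2[OF that] by (simp add: L2_torus_def)
  have \<eta>: "sq_int \<eta>" unfolding \<eta>_def by (intro sq_int_test_torus D_x_test_torus \<psi>)
  have limP: "(\<lambda>N. P N s) \<longlonglongrightarrow> distr_of (u s) \<psi>" if "s \<in> {0..T}" for s
    using torus_integral_mult_tendsto[OF sq[OF that] sq_int_test_torus[OF \<psi>]]
    by (simp add: P_def distr_of_def u_coeff[OF that])
  have limR: "(\<lambda>N. R N s) \<longlonglongrightarrow> distr_of (u s) \<eta>" if "s \<in> {0..T}" for s
    using torus_integral_mult_tendsto[OF sq[OF that] \<eta>]
    by (simp add: R_def distr_of_def u_coeff[OF that])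
  have lim1: "S1 \<longlonglongrightarrow> \<phi>1 \<psi>" and lim2: "S2 \<longlonglongrightarrow> \<phi>2 \<psi>"
    using phi1_sums[OF \<psi>] phi2_sums[OF \<psi>] by (auto simp: S1_def S2_def sums_def)
  have limQ: "(\<lambda>N. Q N s) \<longlonglongrightarrow> distr_of (u s) \<eta> + v1 s * \<phi>1 \<psi> + v2 s * \<phi>2 \<psi>" if "s \<in> {0..T}" for s
    unfolding Q_def by (intro tendsto_intros limR lim1 lim2 that)
  have sub: "{0..t} \<subseteq> {0..T}" using t by auto
  note cont_mode = continuous_on_subset[OF continuous_on_mode_at sub]
  note cont_force = continuous_on_subset[OF continuous_on_force sub]
  have contQ: "continuous_on {0..t} (Q N)" for N
    unfolding Q_def R_def
    by (intro continuous_intros cont_mode continuous_on_subset[OF v1 sub] continuous_on_subset[OF v2 sub])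
  have Q_eq: "Q N s = (\<Sum>k\<in>{- int N..int N}. of_real (2 * pi) * fourier_coeff \<psi> (- k) *
      (- of_real ((of_int k)\<^sup>2) * mode_at k s + force k s))" for N s
  proof -
    have "Q N s = R N s + of_real (2 * pi) * (\<Sum>k\<in>{- int N..int N}. force k s * fourier_coeff \<psi> (- k))"
      unfolding sum_force by (simp add: Q_def S1_def S2_def add.assoc)
    also have "\<dots> = (\<Sum>k\<in>{- int N..int N}. of_real (2 * pi) * (mode_at k s * fourier_coeff \<eta> (- k)) +
        of_real (2 * pi) * (force k s * fourier_coeff \<psi> (- k)))"
      by (simp only: R_def sum_distrib_left sum.distrib)
    also have "\<dots> = (\<Sum>k\<in>{- int N..int N}. of_real (2 * pi) * fourier_coeff \<psi> (- k) *
      (- of_real ((of_int k)\<^sup>2) * mode_at k s + force k s))"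
      by (intro sum.cong refl) (simp add: \<eta>_def fourier_coeff_D_x_D_x[OF \<psi>] algebra_simps)
    finally show ?thesis .
  qed
  have int_Q: "integral {0..t} (Q N) = P N t - P N 0" for N
  proof -
    have "integral {0..t} (Q N) = (\<Sum>k\<in>{- int N..int N}. of_real (2 * pi) * fourier_coeff \<psi> (- k) *
        integral {0..t} (\<lambda>s. - of_real ((of_int k)\<^sup>2) * mode_at k s + force k s))"
      unfolding Q_eq[abs_def]
      by (subst integral_sum)
         (auto intro!: integrable_continuous_real continuous_intros cont_mode cont_force)
    also have "\<dots> = (\<Sum>k\<in>{- int N..int N}. of_real (2 * pi) * fourier_coeff \<psi> (- k) * (mode_at k t - mode_at k 0))"
      unfolding mode_at_def linear_ode_solution_integral_eq[OF continuous_on_force t] linear_ode_solution_0 ..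
    also have "\<dots> = P N t - P N 0"
      unfolding P_def by (simp add: sum_distrib_left sum_subtractf algebra_simps)
    finally show ?thesis .
  qed
  obtain K1 K2 where K: "\<And>N. cmod (S1 N) \<le> K1" "\<And>N. cmod (S2 N) \<le> K2"
    using convergent_imp_Bseq[OF convergentI[OF lim1]] convergent_imp_Bseq[OF convergentI[OF lim2]]
    by (meson BseqE)
  \<comment> \<open>The first summand bounds \<open>R N s\<close> through \<open>mode_bound\<close>
    and Bessel's inequality for \<open>\<eta>\<close>, the other two the profile terms, whose
    partial sums converge and hence are bounded.\<close>
  define K where "K = 2 * pi * ((\<Sum>n. mode_bound (int_decode n)) + L2_norm_sq \<eta> / (2 * pi)) + vmax * K1 + vmax * K2"
  have bound: "cmod (Q N s) \<le> K" if s: "s \<in> {0..T}" for N s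
  proof -
    have "cmod (R N s) \<le> 2 * pi * (\<Sum>k\<in>{- int N..int N}. cmod (mode_at k s * fourier_coeff \<eta> (- k)))"
      unfolding R_def norm_mult by (simp add: norm_mult[symmetric] norm_sum)
    also have "\<dots> \<le> 2 * pi * (\<Sum>k\<in>{- int N..int N}. mode_bound k + (cmod (fourier_coeff \<eta> (- k)))\<^sup>2)"
    proof (intro mult_left_mono sum_mono)
      fix k
      have "2 * (cmod (mode_at k s) * cmod (fourier_coeff \<eta> (- k))) \<le>
          mode_bound k + (cmod (fourier_coeff \<eta> (- k)))\<^sup>2"
        using sum_squares_bound[of "cmod (mode_at k s)" "cmod (fourier_coeff \<eta> (- k))"]
          norm_mode_at_sq_le_bound[OF s, of k] by simp
      moreover have "0 \<le> cmod (mode_at k s) * cmod (fourier_coeff \<eta> (- k))" by simp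
      ultimately show "cmod (mode_at k s * fourier_coeff \<eta> (- k)) \<le> mode_bound k + (cmod (fourier_coeff \<eta> (- k)))\<^sup>2"
        unfolding norm_mult by linarith
    qed simp
    also have "(\<Sum>k\<in>{- int N..int N}. mode_bound k + (cmod (fourier_coeff \<eta> (- k)))\<^sup>2) =
        (\<Sum>k\<in>{- int N..int N}. mode_bound k) + (\<Sum>k\<in>{- int N..int N}. (cmod (fourier_coeff \<eta> k))\<^sup>2)"
    proof -
      have "(\<Sum>k\<in>{- int N..int N}. (cmod (fourier_coeff \<eta> (- k)))\<^sup>2) =
          (\<Sum>k\<in>{- int N..int N}. (cmod (fourier_coeff \<eta> k))\<^sup>2)"
        by (rule sum.reindex_bij_witness[of _ uminus uminus]) auto
      thus ?thesis by (simp add: sum.distrib)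
    qed
    also have "2 * pi * \<dots> \<le> 2 * pi * ((\<Sum>n. mode_bound (int_decode n)) + L2_norm_sq \<eta> / (2 * pi))"
      using Bessel_inequality[OF \<eta>, of N]
      by (intro mult_left_mono add_mono sum_symmetric_le_suminf mode_bound_nonneg summable_mode_bound)
         (auto simp: field_simps)
    finally have 1: "cmod (R N s) \<le> 2 * pi * ((\<Sum>n. mode_bound (int_decode n)) + L2_norm_sq \<eta> / (2 * pi))" .
    have 2: "cmod (v1 s * S1 N) \<le> vmax * K1" "cmod (v2 s * S2 N) \<le> vmax * K2"
      unfolding norm_mult by (intro mult_mono vmax s K vmax_nonneg norm_ge_zero)+
    have "cmod (Q N s) \<le> cmod (R N s) + cmod (v1 s * S1 N) + cmod (v2 s * S2 N)"
      unfolding Q_def by (intro norm_triangle_le add_right_mono norm_triangle_ineq)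
    with 1 2 show ?thesis by (simp add: K_def)
  qed
  have "(\<lambda>N. integral\<^sup>L (lebesgue_on {0<..<t}) (Q N)) \<longlonglongrightarrow>
      integral\<^sup>L (lebesgue_on {0<..<t}) (\<lambda>s. distr_of (u s) \<eta> + v1 s * \<phi>1 \<psi> + v2 s * \<phi>2 \<psi>)"
  proof (rule integral_dominated_convergence)
    show meas: "Q N \<in> borel_measurable (lebesgue_on {0<..<t})" for N
      using lebesgue_integral_open_interval(1)[OF contQ] by auto
    \<comment> \<open>The family \<open>u\<close> need not be jointly measurable; the integrand is
      measurable as a pointwise limit of the continuous \<open>Q N\<close>.\<close>
    show "(\<lambda>s. distr_of (u s) \<eta> + v1 s * \<phi>1 \<psi> + v2 s * \<phi>2 \<psi>) \<in> borel_measurable (lebesgue_on {0<..<t})"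
      by (rule borel_measurable_LIMSEQ_metric[OF meas limQ]) (use t in auto)
    show "integrable (lebesgue_on {0<..<t}) (\<lambda>_. K)"
      by (intro lebesgue_integral_open_interval continuous_intros)
    show "AE s in lebesgue_on {0<..<t}. (\<lambda>N. Q N s) \<longlonglongrightarrow> distr_of (u s) \<eta> + v1 s * \<phi>1 \<psi> + v2 s * \<phi>2 \<psi>"
      using t by (intro AE_I2 limQ) auto
    show "AE s in lebesgue_on {0<..<t}. norm (Q N s) \<le> K" for N
      using t by (intro AE_I2 bound) auto
  qed
  moreover have "integral\<^sup>L (lebesgue_on {0<..<t}) (Q N) = P N t - P N 0" for N
    unfolding lebesgue_integral_open_interval(2)[OF contQ] by (rule int_Q)
  moreover have "(\<lambda>N. P N t - P N 0) \<longlonglongrightarrow> distr_of (u t) \<psi> - distr_of (u 0) \<psi>"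
    using t by (intro tendsto_diff limP) auto
  ultimately show ?thesis unfolding \<eta>_def by (simp add: LIMSEQ_unique)
qed

lemma heat_solution_exists: "\<exists>u. heat_solution T \<phi>1 \<phi>2 v1 v2 u0 u"
proof -
  obtain u where u: "u 0 = u0" "\<And>t. t \<in> {0..T} \<Longrightarrow> u t \<in> L2_torus"
    "\<And>t k. t \<in> {0..T} \<Longrightarrow> fourier_coeff (u t) k = mode_at k t"
    using trajectory_exists by blast
  have "heat_solution T \<phi>1 \<phi>2 v1 v2 u0 u"
    unfolding heat_solution_def
    using trajectory_C0_L2[OF u] trajectory_L2_H1[OF u] trajectory_weak_equation[OF u(2,3)] u(1) by simp
  thus ?thesis by blast
qed

text \<open>Testing any solution with a conjugate mode gives a scalar integral equation, and
  \<open>linear_ode_unique\<close> determines its value at \<open>T\<close>. This is the uniqueness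
  needed for the final claim.\<close>

lemma heat_solution_fourier_coeff:
  assumes u: "heat_solution T \<phi>1 \<phi>2 v1 v2 u0 u"
  shows "fourier_coeff (u T) k = mode_at k T"
proof -
  define Z where "Z = (\<lambda>t. fourier_coeff (u t) k)"
  have C0: "C0_L2 T u" using u by (simp add: heat_solution_def)
  have L2: "u t \<in> L2_torus" if "t \<in> {0..T}" for t using C0 that by (simp add: C0_L2_def)
  have sq: "sq_int (u t)" if "t \<in> {0..T}" for t using L2[OF that] by (simp add: L2_torus_def)
  have cont: "continuous_on {0..T} Z"
    unfolding continuous_on_def
  proof
    fix t assume t: "t \<in> {0..T}"
    have lim: "((\<lambda>s. L2_norm_torus (\<lambda>x. u s x - u t x)) \<longlongrightarrow> 0) (at t within {0..T})"
      using C0 t by (simp add: C0_L2_def)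
    have le: "cmod (Z s - Z t) \<le> L2_norm_torus (\<lambda>x. u s x - u t x)" if s: "s \<in> {0..T}" for s
    proof -
      define r where "r = (\<lambda>x. u s x - u t x)"
      have "(cmod (fourier_coeff r k))\<^sup>2 \<le> L2_norm_sq r / (2 * pi)"
        unfolding r_def by (intro norm_fourier_coeff_sq_le sq_int_diff sq s t)
      also have "\<dots> \<le> L2_norm_sq r / 1"
        using pi_gt3 by (intro divide_left_mono) auto
      finally have "cmod (fourier_coeff r k) \<le> L2_norm_torus r"
        unfolding L2_norm_torus_eq by (intro real_le_rsqrt) simp
      thus ?thesis by (simp add: r_def Z_def fourier_coeff_diff[OF sq[OF s] sq[OF t]])
    qed
    show "(Z \<longlongrightarrow> Z t) (at t within {0..T})"
    proof (rule LIM_zero_cancel, rule Lim_null_comparison[OF _ lim])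
      show "\<forall>\<^sub>F s in at t within {0..T}. cmod (Z s - Z t) \<le> L2_norm_torus (\<lambda>x. u s x - u t x)"
        unfolding eventually_at_filter using le by (auto intro: always_eventually)
    qed
  qed
  have D: "D_x (D_x (fourier_mode (- k))) = (\<lambda>x. - of_real ((of_int k)\<^sup>2) * fourier_mode (- k) x)"
  proof -
    have "\<i> * of_int k * (\<i> * of_int k) = - complex_of_real ((of_int k)\<^sup>2)"
      by (simp add: complex_eq_iff power2_eq_square)
    thus ?thesis
      using D_x_cmult_fourier_mode[of 1 "- k"] D_x_cmult_fourier_mode[of "- (\<i> * of_int k)" "- k"]
      by simp
  qed
  have D': "distr_of (u s) (D_x (D_x (fourier_mode (- k)))) = of_real (2 * pi) * (- of_real ((of_int k)\<^sup>2) * Z s)" for s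
    unfolding D distr_of_def Z_def fourier_coeff_def torus_integral_def
    by (simp add: mult.left_commute[of "u s _"])
  have "Z t - Z 0 = integral {0..t} (\<lambda>s. - of_real ((of_int k)\<^sup>2) * Z s + force k s)" if t: "t \<in> {0..T}" for t
  proof -
    have sub: "{0..t} \<subseteq> {0..T}" using t by auto
    have "distr_of (u t) (fourier_mode (- k)) - distr_of (u 0) (fourier_mode (- k)) =
        integral\<^sup>L (lebesgue_on {0<..<t}) (\<lambda>s. distr_of (u s) (D_x (D_x (fourier_mode (- k)))) +
          v1 s * \<phi>1 (fourier_mode (- k)) + v2 s * \<phi>2 (fourier_mode (- k)))"
      using u t fourier_mode_test_torus unfolding heat_solution_def by blast
    also have "\<dots> = integral\<^sup>L (lebesgue_on {0<..<t})
        (\<lambda>s. of_real (2 * pi) * (- of_real ((of_int k)\<^sup>2) * Z s + force k s))"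
      unfolding D' add.assoc phi_fourier_mode distrib_left[symmetric] ..
    also have "\<dots> = of_real (2 * pi) * integral\<^sup>L (lebesgue_on {0<..<t})
        (\<lambda>s. - of_real ((of_int k)\<^sup>2) * Z s + force k s)"
      by (rule integral_mult_right_zero)
    also have "integral\<^sup>L (lebesgue_on {0<..<t}) (\<lambda>s. - of_real ((of_int k)\<^sup>2) * Z s + force k s) =
        integral {0..t} (\<lambda>s. - of_real ((of_int k)\<^sup>2) * Z s + force k s)"
      by (intro lebesgue_integral_open_interval continuous_intros continuous_on_subset[OF cont sub]
            continuous_on_subset[OF continuous_on_force sub])
    finally show ?thesis
      unfolding distr_of_fourier_mode by (simp add: Z_def flip: right_diff_distrib)
  qed
  from linear_ode_unique[OF T continuous_on_force cont this]
  have "of_real (exp ((of_int k)\<^sup>2 * T)) * Z T =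
      Z 0 + integral {0..T} (\<lambda>s. of_real (exp ((of_int k)\<^sup>2 * s)) * force k s)" .
  \<comment> \<open>The initial value is attained only almost everywhere, which suffices for its
    Fourier coefficients.\<close>
  moreover have "Z 0 = fourier_coeff u0 k"
  proof -
    have "AE x in lebesgue. u 0 x = u0 x" using u by (simp add: heat_solution_def)
    hence "AE x in torus_measure. u 0 x = u0 x"
      by (subst AE_restrict_space_iff) auto
    hence "torus_integral (\<lambda>x. u 0 x * fourier_mode (- k) x) = torus_integral (\<lambda>x. u0 x * fourier_mode (- k) x)"
      unfolding torus_integral_def using sq[of 0] T u0_sq_int
      by (intro integral_cong_AE borel_measurable_times sq_int_measurable sq_int_fourier_mode) auto
    thus ?thesis by (simp add: Z_def fourier_coeff_def)
  qed
  ultimately have "of_real (exp (- ((of_int k)\<^sup>2 * T))) * (of_real (exp ((of_int k)\<^sup>2 * T)) * Z T) = mode_at k T"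
    by (simp add: mode_at_def linear_ode_solution_def)
  moreover have "complex_of_real (exp (- ((of_int k)\<^sup>2 * T))) * of_real (exp ((of_int k)\<^sup>2 * T)) = 1"
    by (simp flip: of_real_mult exp_add)
  ultimately show ?thesis by (simp add: Z_def mult.assoc[symmetric])
qed

lemma heat_solution_null:
  assumes u: "heat_solution T \<phi>1 \<phi>2 v1 v2 u0 u" and null: "\<And>k. mode_at k T = 0"
  shows "AE x in lebesgue. u T x = 0"
proof -
  have "u T \<in> L2_torus" using u T by (simp add: heat_solution_def C0_L2_def)
  moreover from this have "L2_norm_sq (u T) = 0"
    by (intro L2_norm_sq_zero_of_fourier_coeff)
       (simp_all add: heat_solution_fourier_coeff[OF u] null L2_torus_def)
  ultimately show ?thesis by (rule AE_zero_of_L2_norm_sq)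
qed

end

text \<open>The lower bound on \<open>d n\<close> makes the required moments grow at most like
  \<open>real n powr (- \<alpha>)\<close>. Since \<open>ln n \<le> n\<close>, this is within the
  exponential growth allowed in the moment problem.\<close>

lemma exists_control_for_modes:
  fixes a d :: "nat \<Rightarrow> complex"
  assumes "T > 0" and "c > 0"
    and a: "\<And>n. n \<ge> 1 \<Longrightarrow> cmod (a n) \<le> A"
    and d: "\<And>n. n \<ge> 1 \<Longrightarrow> c * real n powr \<alpha> \<le> cmod (d n)"
  obtains v where "continuous_on {0..T} v"
    "\<And>n. n \<ge> 1 \<Longrightarrow> a n + d n * integral {0..T} (\<lambda>s. of_real (exp ((real n)\<^sup>2 * s)) * v s) = 0"
proof -
  have d0: "d n \<noteq> 0" if "n \<ge> 1" for n
  proof -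
    have "c * real n powr \<alpha> > 0" using that \<open>c > 0\<close> by simp
    thus ?thesis using d[OF that] by auto
  qed
  have "cmod (- a n / d n) \<le> A / c * exp (\<bar>\<alpha>\<bar> * real n)" if n: "n \<ge> 1" for n
  proof -
    have pos: "c * real n powr \<alpha> > 0" using n \<open>c > 0\<close> by simp
    have "cmod (- a n / d n) \<le> A / (c * real n powr \<alpha>)"
      unfolding norm_divide norm_minus_cancel
      using a[OF n] d[OF n] pos order_trans[OF norm_ge_zero a[OF n]] by (intro frac_le) auto
    also have "\<dots> = A / c * real n powr (- \<alpha>)" by (simp add: powr_minus divide_simps)
    also have "\<dots> \<le> A / c * exp (\<bar>\<alpha>\<bar> * real n)"
    proof (rule mult_left_mono)
      have "- \<alpha> * ln (real n) \<le> \<bar>\<alpha>\<bar> * real n"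
        using n ln_bound[of "real n"] ln_ge_zero[of "real n"] by (intro mult_mono) auto
      thus "real n powr (- \<alpha>) \<le> exp (\<bar>\<alpha>\<bar> * real n)" using n by (simp add: powr_def)
      show "0 \<le> A / c" using order_trans[OF norm_ge_zero a[OF n]] \<open>c > 0\<close> by simp
    qed
    finally show ?thesis .
  qed
  then obtain v where v: "continuous_on {0..T} v"
    "\<And>n. n \<ge> 1 \<Longrightarrow> integral {0..T} (\<lambda>s. of_real (exp ((real n)\<^sup>2 * s)) * v s) = - a n / d n"
    using exponential_moment_problem[OF \<open>T > 0\<close>, of "\<lambda>n. - a n / d n"] by blast
  show thesis by (rule that[OF v(1)]) (use v(2) d0 in simp)
qed

text \<open>The existence of a solution is asserted too, so that the vanishing of all solutions at
  time \<open>T\<close> is not vacuous.\<close>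

theorem proposition3p1:
  fixes c1 c2 :: "nat \<Rightarrow> complex" and \<phi>1 \<phi>2 :: distr and \<alpha> \<beta> c C :: real
  assumes phi1: "(\<lambda>n x. c1 (Suc n) * fourier_mode (int (Suc n)) x) distr_sums \<phi>1"
    and phi2: "(\<lambda>n x. c2 (Suc n) * fourier_mode (- int (Suc n)) x) distr_sums \<phi>2"
    and "\<alpha> \<le> \<beta>" and "\<beta> < 1 / 2" and "c > 0" and "C > 0"
    and c1: "\<And>n. n \<ge> 1 \<Longrightarrow> c * real n powr \<alpha> \<le> cmod (c1 n) \<and> cmod (c1 n) \<le> C * real n powr \<beta>"
    and c2: "\<And>n. n \<ge> 1 \<Longrightarrow> c * real n powr \<alpha> \<le> cmod (c2 n) \<and> cmod (c2 n) \<le> C * real n powr \<beta>"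
  shows "\<forall>T>0. \<forall>u0\<in>L2_torus. torus_integral u0 = 0 \<longrightarrow>
    (\<exists>v1 v2. v1 square_integrable_on {0<..<T} \<and> v2 square_integrable_on {0<..<T} \<and>
       (\<exists>u. heat_solution T \<phi>1 \<phi>2 v1 v2 u0 u) \<and>
       (\<forall>u. heat_solution T \<phi>1 \<phi>2 v1 v2 u0 u \<longrightarrow> (AE x in lebesgue. u T x = 0)))"
proof (intro allI ballI impI)
  fix T :: real and u0 :: "real \<Rightarrow> complex"
  assume T: "T > 0" and u0: "u0 \<in> L2_torus" and mean: "torus_integral u0 = 0"
  have sq: "sq_int u0" using u0 by (simp add: L2_torus_def)
  have a: "cmod (fourier_coeff u0 k) \<le> sqrt (L2_norm_sq u0 / (2 * pi))" for k
    by (intro real_le_rsqrt norm_fourier_coeff_sq_le sq)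
  obtain v1 where moment1: "continuous_on {0..T} v1"
    "\<And>n. n \<ge> 1 \<Longrightarrow> fourier_coeff u0 (int n) +
      c1 n * integral {0..T} (\<lambda>s. of_real (exp ((real n)\<^sup>2 * s)) * v1 s) = 0"
    using exists_control_for_modes[OF T \<open>c > 0\<close>, of "\<lambda>n. fourier_coeff u0 (int n)" _ \<alpha> c1] a c1 by blast
  obtain v2 where moment2: "continuous_on {0..T} v2"
    "\<And>n. n \<ge> 1 \<Longrightarrow> fourier_coeff u0 (- int n) +
      c2 n * integral {0..T} (\<lambda>s. of_real (exp ((real n)\<^sup>2 * s)) * v2 s) = 0"
    using exists_control_for_modes[OF T \<open>c > 0\<close>, of "\<lambda>n. fourier_coeff u0 (- int n)" _ \<alpha> c2] a c2 by blast
  interpret controlled_heat c1 c2 \<phi>1 \<phi>2 \<beta> C T u0 v1 v2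
    using assms T u0 mean moment1(1) moment2(1) by unfold_locales auto
  \<comment> \<open>Up to the factor \<open>exp (- k^2 * T)\<close>, the final mode is the sum of
    the datum's mode and the moment of the force, which the controls were chosen to cancel.\<close>
  have null: "mode_at k T = 0" for k
  proof -
    have "fourier_coeff u0 k + integral {0..T} (\<lambda>s. of_real (exp ((of_int k)\<^sup>2 * s)) * force k s) = 0"
    proof (cases k "0::int" rule: linorder_cases)
      case less
      define n where "n = nat (- k)"
      have n: "n \<ge> 1" "k = - int n" using less by (auto simp: n_def)
      have "(\<lambda>s. complex_of_real (exp ((of_int k)\<^sup>2 * s)) * force k s) =
          (\<lambda>s. c2 n * (of_real (exp ((real n)\<^sup>2 * s)) * v2 s))"
        using n by (simp add: force_def fun_eq_iff)
      thus ?thesis using moment2(2)[OF n(1)] n(2) by simp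
    next
      case equal
      thus ?thesis by (simp add: force_def)
    next
      case greater
      define n where "n = nat k"
      have n: "n \<ge> 1" "k = int n" using greater by (auto simp: n_def)
      have "(\<lambda>s. complex_of_real (exp ((of_int k)\<^sup>2 * s)) * force k s) =
          (\<lambda>s. c1 n * (of_real (exp ((real n)\<^sup>2 * s)) * v1 s))"
        using n by (simp add: force_def fun_eq_iff)
      thus ?thesis using moment1(2)[OF n(1)] n(2) by simp
    qed
    thus ?thesis by (simp add: mode_at_def linear_ode_solution_def)
  qed
  show "\<exists>v1 v2. v1 square_integrable_on {0<..<T} \<and> v2 square_integrable_on {0<..<T} \<and>
      (\<exists>u. heat_solution T \<phi>1 \<phi>2 v1 v2 u0 u) \<and>
      (\<forall>u. heat_solution T \<phi>1 \<phi>2 v1 v2 u0 u \<longrightarrow> (AE x in lebesgue. u T x = 0))"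
    using square_integrable_open_interval[OF moment1(1)] square_integrable_open_interval[OF moment2(1)]
      heat_solution_exists heat_solution_null[OF _ null] by blast
qed

end
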